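(* Let $\rho>0$, let $\delta_\rho:\Delta\times\Delta\to[0,\infty)$ be the hyperbolic metric on a Harnack part $\Delta$ of $\mathcal C_\rho\subset B(\mathcal H)^n$, and let $f=(f_1,\ldots,f_m)$ be a contractive free holomorphic function with $\|f(0)\|<1$ such that the boundary functions $\widetilde f_1,\ldots,\widetilde f_m$ are in the noncommutative disc algebra $\mathcal A_n$. Then $$\delta_{\rho_f}(f(A),f(B))\le\delta_\rho(A,B),\qquad A,B\in\Delta,$$ where $$\rho_f:=\begin{cases}1+(\rho-1)\dfrac{1-\|f(0)\|}{1+\|f(0)\|}&\text{if }\rho<1,\\[2mm]1+(\rho-1)\dfrac{1+\|f(0)\|}{1-\|f(0)\|}&\text{if }\rho\ge1,\end{cases}$$ and $\delta_{\rho_f}$ is the hyperbolic metric on the Harnack part of $\mathcal C_{\rho_f}\subset B(\mathcal H)^m$ containing $f(A)$ and $f(B)$ (it being implicit in the assertion that $f(A),f(B)$ lie in a common Harnack part of $\mathcal C_{\rho_f}$).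
   Context: Let $n,m\ge1$, $\mathcal H$ a complex Hilbert space, $\mathcal K$ a separable infinite-dimensional Hilbert space. $\mathbb F_n^+$ is the unital free semigroup on generators $g_1,\ldots,g_n$ with identity $g_0$; $|\alpha|$ is the length of $\alpha$. $T_\alpha:=T_{i_1}\cdots T_{i_k}$ if $\alpha=g_{i_1}\cdots g_{i_k}$, $T_{g_0}:=I$. For any number $n$ of operators and $\rho>0$, $T\in B(\mathcal H)^n$ is of class $\mathcal C_\rho$ if there exist a Hilbert space $\mathcal G\supseteq\mathcal H$ and isometries $V_1,\ldots,V_n\in B(\mathcal G)$ with mutually orthogonal ranges such that $T_\alpha=\rho P_{\mathcal H}V_\alpha|_{\mathcal H}$ for all $\alpha\in\mathbb F_n^+\setminus\{g_0\}$. Harnack domination: for $A,B\in\mathcal C_\rho$ and $c>0$, $A\overset{H}{\underset c\prec}B$ means $\Re p(A)+(\rho-1)\Re p(0)\le c^2[\Re p(B)+(\rho-1)\Re p(0)]$ for every noncommutative polynomial $p\in\mathbb C[X_1,\ldots,X_n]\otimes M_k$, $k\in\mathbb N$, such that $\Re p(X):=\frac12(p(X)^*+p(X))\ge0$ for all $X\in[B(\mathcal K)^n]_1:=\{X\in B(\mathcal K)^n:\|\sum_iX_iX_i^*\|<1\}$; here $p(A)=\sum_\alpha A_\alpha\otimes M_\alpha$ for $p=\sum_\alpha X_\alpha\otimes M_\alpha$. $A\overset{H}{\underset c\sim}B$ means $A\overset{H}{\underset c\prec}B$ and $B\overset{H}{\underset c\prec}A$; $A\overset{H}{\sim}B$ means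 this holds for some $c\ge1$. Equivalence classes of $\overset{H}{\sim}$ are the Harnack parts of $\mathcal C_\rho$; on each, $\delta_\rho(A,B):=\ln\inf\{c>1:A\overset{H}{\underset c\sim}B\}$. Each $f_j(X)=\sum_{k=0}^\infty\sum_{|\alpha|=k}a_\alpha^{(j)}X_\alpha$ ($a^{(j)}_\alpha\in\mathbb C$, $\limsup_k(\sum_{|\alpha|=k}|a_\alpha^{(j)}|^2)^{1/2k}\le1$) is a free holomorphic function on $[B(\mathcal K)^n]_1$; $f$ is contractive if the row operator $[f_1(X)\ \cdots\ f_m(X)]$ has norm at most $1$ for all $X\in[B(\mathcal K)^n]_1$. $f(0)=(f_1(0),\ldots,f_m(0))$ has norm the Euclidean norm in $\mathbb C^m$. $S_i\varphi:=e_i\otimes\varphi$ are the left creation operators on the full Fock space $F^2(H_n)=\mathbb C1\oplus\bigoplus_{k\ge1}H_n^{\otimes k}$ ($e_1,\ldots,e_n$ an orthonormal basis of the $n$-dimensional Hilbert space $H_n$), and $\mathcal A_n$ is the norm closed algebra generated by $S_1,\ldots,S_n,I$. The boundary function of $f_j$ is $\widetilde f_j=\lim_{r\to1}f_j(rS_1,\ldots,rS_n)$; $\widetilde f_j\in\mathcal A_n$ means that this limit exists in operator norm. For $T\in\mathcal C_\rho$, $f(T)=(f_1(T),\ldots,f_m(T))$ with $f_j(T):=\lim_{r\to1}f_j(rT_1,\ldots,rT_n)$ in operator norm (the limit exists). *)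

theory Defs
  imports "HOL-Analysis.Analysis"
begin

section \<open>Complex Hilbert spaces\<close>

class scaleC =
  fixes scaleC :: "complex \<Rightarrow> 'a \<Rightarrow> 'a"  (infixr \<open>*\<^sub>C\<close> 75)

class complex_vector = scaleC + real_vector +
  assumes scaleC_add_right: "c *\<^sub>C (x + y) = c *\<^sub>C x + c *\<^sub>C y"
    and scaleC_add_left: "(c + d) *\<^sub>C x = c *\<^sub>C x + d *\<^sub>C x"
    and scaleC_scaleC: "c *\<^sub>C d *\<^sub>C x = (c * d) *\<^sub>C x"
    and scaleR_scaleC: "r *\<^sub>R x = complex_of_real r *\<^sub>C x"

text \<open>
  The inner product \<open>cinner\<close> is linear in its first argument.  The real inner product of the
  library is its real part, so that the norm is the usual \<open>sqrt (cinner x x)\<close>.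
\<close>

class complex_hilbert = complex_vector + real_inner + banach +
  fixes cinner :: "'a \<Rightarrow> 'a \<Rightarrow> complex"
  assumes cinner_add_left: "cinner (x + y) z = cinner x z + cinner y z"
    and cinner_scaleC_left: "cinner (c *\<^sub>C x) y = c * cinner x y"
    and cinner_commute: "cinner y x = cnj (cinner x y)"
    and inner_eq_Re_cinner: "inner x y = Re (cinner x y)"

lemma scaleC_1 [simp]: "1 *\<^sub>C x = (x :: 'a::complex_vector)"
  using scaleR_scaleC[of 1 x] by simp

lemma scaleC_0_left [simp]: "0 *\<^sub>C x = (0 :: 'a::complex_vector)"
  using scaleR_scaleC[of 0 x] by simp

lemma scaleC_0_right [simp]: "c *\<^sub>C 0 = (0 :: 'a::complex_vector)"
  using scaleC_add_right[of c 0 0] by simp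

lemma cinner_self: "cinner x x = complex_of_real ((norm x)\<^sup>2)" for x :: "'a::complex_hilbert"
proof -
  have "Im (cinner x x) = 0"
    using arg_cong[OF cinner_commute[of x x], of Im] by simp
  moreover have "Re (cinner x x) = (norm x)\<^sup>2"
    by (simp add: inner_eq_Re_cinner[symmetric] power2_norm_eq_inner)
  ultimately show ?thesis by (simp add: complex_eq_iff)
qed

lemma cinner_scaleC_right: "cinner x (c *\<^sub>C y) = cnj c * cinner x y"
  for x y :: "'a::complex_hilbert"
  by (metis cinner_commute cinner_scaleC_left complex_cnj_mult)

lemma norm_scaleC: "norm (c *\<^sub>C x) = cmod c * norm x" for x :: "'a::complex_hilbert"
proof -
  have "complex_of_real ((norm (c *\<^sub>C x))\<^sup>2) = c * cnj c * complex_of_real ((norm x)\<^sup>2)"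
    by (simp only: cinner_self[symmetric] cinner_scaleC_left cinner_scaleC_right mult_ac)
  also have "\<dots> = complex_of_real ((cmod c * norm x)\<^sup>2)"
    by (simp add: complex_norm_square[symmetric] power_mult_distrib)
  finally have "(norm (c *\<^sub>C x))\<^sup>2 = (cmod c * norm x)\<^sup>2"
    using of_real_eq_iff by blast
  then show ?thesis by (simp add: power2_eq_iff_nonneg)
qed

lemma norm_cinner_le: "norm (cinner x y) \<le> (norm x)\<^sup>2 + (norm y)\<^sup>2" for x y :: "'a::complex_hilbert"
proof -
  have "Im (cinner x y) = - inner (\<i> *\<^sub>C x) y"
    by (simp add: inner_eq_Re_cinner cinner_scaleC_left)
  then have "\<bar>Im (cinner x y)\<bar> \<le> norm x * norm y"
    using Cauchy_Schwarz_ineq2[of "\<i> *\<^sub>C x" y] by (simp add: norm_scaleC)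
  moreover have "\<bar>Re (cinner x y)\<bar> \<le> norm x * norm y"
    using Cauchy_Schwarz_ineq2[of x y] by (simp add: inner_eq_Re_cinner)
  ultimately have "norm (cinner x y) \<le> 2 * (norm x * norm y)"
    using cmod_le[of "cinner x y"] by linarith
  also have "\<dots> \<le> (norm x)\<^sup>2 + (norm y)\<^sup>2"
    using sum_squares_bound[of "norm x" "norm y"] by simp
  finally show ?thesis .
qed

instantiation complex :: complex_hilbert
begin
definition scaleC_complex :: "complex \<Rightarrow> complex \<Rightarrow> complex" where "scaleC_complex c x = c * x"
definition cinner_complex :: "complex \<Rightarrow> complex \<Rightarrow> complex" where "cinner_complex x y = x * cnj y"
instance
  by standard
    (auto simp: scaleC_complex_def cinner_complex_def algebra_simps scaleR_conv_of_real inner_complex_def)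
end


section \<open>Square-summable families: the Hilbert direct sum of copies of a Hilbert space\<close>

typedef (overloaded) ('i, 'a) l2 = "{x :: 'i \<Rightarrow> 'a::complex_hilbert. (\<lambda>i. (norm (x i))\<^sup>2) summable_on UNIV}"
  morphisms l2_nth Abs_l2
  by (rule exI[of _ "\<lambda>_. 0"]) simp

setup_lifting type_definition_l2

lemma l2_summable_norm: "(\<lambda>i. (norm (l2_nth x i))\<^sup>2) summable_on UNIV"
  using l2_nth[of x] by simp

lemma l2_summable_add:
  fixes x y :: "'i \<Rightarrow> 'a::complex_hilbert"
  assumes "(\<lambda>i. (norm (x i))\<^sup>2) summable_on UNIV" "(\<lambda>i. (norm (y i))\<^sup>2) summable_on UNIV"
  shows "(\<lambda>i. (norm (x i + y i))\<^sup>2) summable_on UNIV"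
proof (rule summable_on_comparison_test)
  show "(\<lambda>i. 2 * (norm (x i))\<^sup>2 + 2 * (norm (y i))\<^sup>2) summable_on UNIV"
    by (intro summable_on_add summable_on_cmult_right assms)
  fix i
  have "(norm (x i + y i))\<^sup>2 \<le> (norm (x i) + norm (y i))\<^sup>2"
    by (intro power_mono norm_triangle_ineq) simp
  also have "\<dots> \<le> 2 * (norm (x i))\<^sup>2 + 2 * (norm (y i))\<^sup>2"
    using sum_squares_bound[of "norm (x i)" "norm (y i)"] by (simp add: power2_sum)
  finally show "(norm (x i + y i))\<^sup>2 \<le> 2 * (norm (x i))\<^sup>2 + 2 * (norm (y i))\<^sup>2" .
qed auto

lemma l2_summable_scaleC:
  fixes x :: "'i \<Rightarrow> 'a::complex_hilbert"
  assumes "(\<lambda>i. (norm (x i))\<^sup>2) summable_on UNIV"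
  shows "(\<lambda>i. (norm (c *\<^sub>C x i))\<^sup>2) summable_on UNIV"
  unfolding norm_scaleC power_mult_distrib by (intro summable_on_cmult_right assms)

instantiation l2 :: (type, complex_hilbert) complex_vector
begin
lift_definition zero_l2 :: "('a, 'b) l2" is "\<lambda>_. 0" by simp
lift_definition plus_l2 :: "('a, 'b) l2 \<Rightarrow> ('a, 'b) l2 \<Rightarrow> ('a, 'b) l2" is "\<lambda>x y i. x i + y i"
  by (simp add: l2_summable_add)
lift_definition uminus_l2 :: "('a, 'b) l2 \<Rightarrow> ('a, 'b) l2" is "\<lambda>x i. - x i" by simp
lift_definition minus_l2 :: "('a, 'b) l2 \<Rightarrow> ('a, 'b) l2 \<Rightarrow> ('a, 'b) l2" is "\<lambda>x y i. x i - y i"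
  subgoal for x y using l2_summable_add[of x "\<lambda>i. - y i"] by simp
  done
lift_definition scaleC_l2 :: "complex \<Rightarrow> ('a, 'b) l2 \<Rightarrow> ('a, 'b) l2" is "\<lambda>c x i. c *\<^sub>C x i"
  by (simp add: l2_summable_scaleC)
lift_definition scaleR_l2 :: "real \<Rightarrow> ('a, 'b) l2 \<Rightarrow> ('a, 'b) l2" is "\<lambda>r x i. r *\<^sub>R x i"
  by (simp add: scaleR_scaleC l2_summable_scaleC)
instance
  by standard
    (transfer; auto simp: fun_eq_iff algebra_simps scaleC_add_right scaleC_add_left scaleC_scaleC
        scaleR_scaleC)+
end

lemma l2_cinner_summable: "(\<lambda>i. cinner (l2_nth x i) (l2_nth y i)) summable_on UNIV"
proof -
  have "(\<lambda>i. norm (cinner (l2_nth x i) (l2_nth y i))) summable_on UNIV"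
    by (rule summable_on_comparison_test
        [OF summable_on_add[OF l2_summable_norm[of x] l2_summable_norm[of y]]])
       (auto intro: norm_cinner_le)
  then show ?thesis by (rule abs_summable_summable)
qed

lemma l2_inner_summable: "(\<lambda>i. inner (l2_nth x i) (l2_nth y i)) summable_on UNIV"
  unfolding inner_eq_Re_cinner by (intro summable_on_Re l2_cinner_summable)

instantiation l2 :: (type, complex_hilbert) real_inner
begin
definition inner_l2 :: "('a, 'b) l2 \<Rightarrow> ('a, 'b) l2 \<Rightarrow> real" where
  "inner_l2 x y = (\<Sum>\<^sub>\<infinity>i. inner (l2_nth x i) (l2_nth y i))"
definition norm_l2 :: "('a, 'b) l2 \<Rightarrow> real" where
  "norm_l2 x = sqrt (inner x x)"
definition sgn_l2 :: "('a, 'b) l2 \<Rightarrow> ('a, 'b) l2" where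
  "sgn_l2 x = x /\<^sub>R norm x"
definition dist_l2 :: "('a, 'b) l2 \<Rightarrow> ('a, 'b) l2 \<Rightarrow> real" where
  "dist_l2 x y = norm (x - y)"
definition uniformity_l2 :: "(('a, 'b) l2 \<times> ('a, 'b) l2) filter" where
  [code del]: "uniformity_l2 = (INF e\<in>{0 <..}. principal {(x, y). dist x y < e})"
definition open_l2 :: "('a, 'b) l2 set \<Rightarrow> bool" where
  [code del]: "open_l2 U = (\<forall>x\<in>U. \<forall>\<^sub>F (x', y) in uniformity. x' = x \<longrightarrow> y \<in> U)"
instance
proof
  fix x y z :: "('a, 'b) l2" and r :: real
  show "inner x y = inner y x" by (simp add: inner_l2_def inner_commute)
  show "inner (x + y) z = inner x z + inner y z"
    by (simp add: inner_l2_def plus_l2.rep_eq inner_add_left infsum_add l2_inner_summable)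
  show "inner (r *\<^sub>R x) y = r * inner x y"
    by (simp add: inner_l2_def scaleR_l2.rep_eq infsum_cmult_right')
  show nn: "0 \<le> inner x x" by (simp add: inner_l2_def infsum_nonneg)
  show "(inner x x = 0) = (x = 0)"
  proof
    assume "inner x x = 0"
    then have "inner (l2_nth x i) (l2_nth x i) = 0" for i
      using nonneg_infsum_le_0D[of "\<lambda>i. inner (l2_nth x i) (l2_nth x i)" UNIV i]
        l2_inner_summable[of x x] by (simp add: inner_l2_def)
    then show "x = 0" by (simp add: l2_nth_inject[symmetric] zero_l2.rep_eq fun_eq_iff)
  qed (simp add: inner_l2_def zero_l2.rep_eq)
qed (simp_all add: norm_l2_def sgn_l2_def dist_l2_def uniformity_l2_def open_l2_def)
end

lemma l2_norm_power2: "(norm x)\<^sup>2 = (\<Sum>\<^sub>\<infinity>i. (norm (l2_nth x i))\<^sup>2)"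
  by (simp add: power2_norm_eq_inner) (simp add: inner_l2_def)

lemma l2_sum_le_norm:
  assumes "finite F"
  shows "(\<Sum>i\<in>F. (norm (l2_nth x i))\<^sup>2) \<le> (norm x)\<^sup>2"
  unfolding l2_norm_power2 by (intro finite_sum_le_infsum l2_summable_norm assms) auto

lemma l2_nth_norm_le: "norm (l2_nth x i) \<le> norm x"
  using l2_sum_le_norm[of "{i}" x] by (simp add: power2_le_iff_abs_le)

instance l2 :: (type, complex_hilbert) banach
proof
  fix X :: "nat \<Rightarrow> ('a, 'b) l2"
  assume X: "Cauchy X"
  have "Cauchy (\<lambda>n. l2_nth (X n) i)" for i
  proof (rule CauchyI)
    fix e :: real assume "e > 0"
    then obtain N where N: "\<forall>m\<ge>N. \<forall>n\<ge>N. norm (X m - X n) < e" using CauchyD[OF X] by blast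
    have "norm (l2_nth (X m) i - l2_nth (X n) i) < e" if "m \<ge> N" "n \<ge> N" for m n
      using l2_nth_norm_le[of "X m - X n" i] N that by (force simp: minus_l2.rep_eq)
    then show "\<exists>N. \<forall>m\<ge>N. \<forall>n\<ge>N. norm (l2_nth (X m) i - l2_nth (X n) i) < e" by blast
  qed
  then have "\<forall>i. \<exists>l. (\<lambda>n. l2_nth (X n) i) \<longlonglongrightarrow> l"
    by (simp add: Cauchy_convergent_iff convergent_def)
  then obtain L where L: "\<And>i. (\<lambda>n. l2_nth (X n) i) \<longlonglongrightarrow> L i" by metis
  have bound: "(\<Sum>i\<in>F. (norm (l2_nth (X n) i - L i))\<^sup>2) \<le> e\<^sup>2"
    if "finite F" "e > 0" "\<forall>m\<ge>N. \<forall>n\<ge>N. norm (X m - X n) < e" "n \<ge> N" for F e N n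
  proof (rule LIMSEQ_le_const2)
    show "(\<lambda>m. \<Sum>i\<in>F. (norm (l2_nth (X n) i - l2_nth (X m) i))\<^sup>2)
        \<longlonglongrightarrow> (\<Sum>i\<in>F. (norm (l2_nth (X n) i - L i))\<^sup>2)"
      by (intro tendsto_intros L)
    have "(\<Sum>i\<in>F. (norm (l2_nth (X n) i - l2_nth (X m) i))\<^sup>2) \<le> e\<^sup>2" if "m \<ge> N" for m
    proof -
      have "(\<Sum>i\<in>F. (norm (l2_nth (X n) i - l2_nth (X m) i))\<^sup>2) \<le> (norm (X n - X m))\<^sup>2"
        using l2_sum_le_norm[OF \<open>finite F\<close>, of "X n - X m"] by (simp add: minus_l2.rep_eq)
      also have "\<dots> \<le> e\<^sup>2"
        using \<open>\<forall>m\<ge>N. \<forall>n\<ge>N. norm (X m - X n) < e\<close> \<open>n \<ge> N\<close> \<open>m \<ge> N\<close> \<open>e > 0\<close>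
        by (intro power_mono) (auto intro: less_imp_le)
      finally show ?thesis .
    qed
    then show "\<exists>M. \<forall>m\<ge>M. (\<Sum>i\<in>F. (norm (l2_nth (X n) i - l2_nth (X m) i))\<^sup>2) \<le> e\<^sup>2" by blast
  qed
  have diff: "(\<lambda>i. (norm (l2_nth (X n) i - L i))\<^sup>2) summable_on UNIV"
    if "e > 0" "\<forall>m\<ge>N. \<forall>n\<ge>N. norm (X m - X n) < e" "n \<ge> N" for e N n
    by (rule nonneg_bounded_partial_sums_imp_summable_on[where C = "e\<^sup>2"])
      (auto intro!: eventually_finite_subsets_at_top_weakI bound[OF _ that])
  obtain N0 where N0: "\<forall>m\<ge>N0. \<forall>n\<ge>N0. norm (X m - X n) < 1"
    using CauchyD[OF X, of 1] by auto
  have "(\<lambda>i. (norm (l2_nth (X N0) i + - (l2_nth (X N0) i - L i)))\<^sup>2) summable_on UNIV"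
    by (rule l2_summable_add[OF l2_summable_norm])
      (simp only: norm_minus_cancel diff[OF zero_less_one N0 order_refl])
  then have Lin: "L \<in> {x. (\<lambda>i. (norm (x i))\<^sup>2) summable_on UNIV}" by simp
  have nth: "l2_nth (Abs_l2 L) = L" by (rule Abs_l2_inverse[OF Lin])
  have "X \<longlonglongrightarrow> Abs_l2 L"
  proof (rule LIMSEQ_I)
    fix e :: real assume "e > 0"
    then have e2: "e / 2 > 0" by simp
    obtain N where N: "\<forall>m\<ge>N. \<forall>n\<ge>N. norm (X m - X n) < e / 2"
      using CauchyD[OF X e2] by blast
    have "norm (X n - Abs_l2 L) < e" if "n \<ge> N" for n
    proof -
      have "(norm (X n - Abs_l2 L))\<^sup>2 \<le> (e / 2)\<^sup>2"
        unfolding l2_norm_power2 minus_l2.rep_eq nth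
        by (rule infsum_le_finite_sums[OF diff[OF e2 N that]]) (rule bound[OF _ e2 N that])
      then have "norm (X n - Abs_l2 L) \<le> e / 2"
        using e2 by (simp add: power2_le_iff_abs_le)
      then show ?thesis using \<open>e > 0\<close> by linarith
    qed
    then show "\<exists>N. \<forall>n\<ge>N. norm (X n - Abs_l2 L) < e" by blast
  qed
  then show "convergent X" by (auto simp: convergent_def)
qed

instantiation l2 :: (type, complex_hilbert) complex_hilbert
begin
definition cinner_l2 :: "('a, 'b) l2 \<Rightarrow> ('a, 'b) l2 \<Rightarrow> complex" where
  "cinner_l2 x y = (\<Sum>\<^sub>\<infinity>i. cinner (l2_nth x i) (l2_nth y i))"
instance
proof
  fix x y z :: "('a, 'b) l2" and c :: complex
  show "cinner (x + y) z = cinner x z + cinner y z"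
    by (simp add: cinner_l2_def plus_l2.rep_eq cinner_add_left infsum_add l2_cinner_summable)
  show "cinner (c *\<^sub>C x) y = c * cinner x y"
    by (simp add: cinner_l2_def scaleC_l2.rep_eq cinner_scaleC_left infsum_cmult_right')
  show "cinner y x = cnj (cinner x y)"
    unfolding cinner_l2_def infsum_cnj[symmetric]
    by (rule infsum_cong) (rule cinner_commute)
  show "inner x y = Re (cinner x y)"
    by (simp add: inner_l2_def cinner_l2_def inner_eq_Re_cinner infsum_Re l2_cinner_summable)
qed
end


section \<open>Bounded complex-linear operators\<close>

instantiation blinfun :: (real_normed_vector, complex_hilbert) complex_vector
begin
lift_definition scaleC_blinfun :: "complex \<Rightarrow> 'a \<Rightarrow>\<^sub>L 'b \<Rightarrow> 'a \<Rightarrow>\<^sub>L 'b" is "\<lambda>c f x. c *\<^sub>C f x"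
proof -
  fix c :: complex and f :: "'a \<Rightarrow> 'b"
  assume f: "bounded_linear f"
  have "bounded_linear (\<lambda>x::'b. c *\<^sub>C x)"
    by (rule bounded_linear_intro[where K = "cmod c"])
      (simp_all add: scaleC_add_right scaleR_scaleC scaleC_scaleC norm_scaleC mult.commute)
  then show "bounded_linear (\<lambda>x. c *\<^sub>C f x)"
    using bounded_linear_compose f by blast
qed
instance
  by standard
    (transfer; simp add: fun_eq_iff scaleC_add_right scaleC_add_left scaleC_scaleC scaleR_scaleC)+
end

text \<open>The type of \<open>\<Rightarrow>\<^sub>L\<close> consists of the real-linear bounded maps; \<open>bop\<close> is the subset \<open>B(H, H')\<close>.\<close>

definition bop :: "('a::complex_hilbert \<Rightarrow>\<^sub>L 'b::complex_hilbert) set" where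
  "bop = {T. \<forall>c x. blinfun_apply T (c *\<^sub>C x) = c *\<^sub>C blinfun_apply T x}"

text \<open>The Hilbert space adjoint; it exists and is unique for \<open>T \<in> bop\<close>.\<close>

definition cadj :: "('a::complex_hilbert \<Rightarrow>\<^sub>L 'b::complex_hilbert) \<Rightarrow> ('b \<Rightarrow>\<^sub>L 'a)" where
  "cadj T = (THE S. \<forall>x y. cinner (blinfun_apply T x) y = cinner x (blinfun_apply S y))"

primrec word_op :: "('n \<Rightarrow> 'a::complex_hilbert \<Rightarrow>\<^sub>L 'a) \<Rightarrow> 'n list \<Rightarrow> 'a \<Rightarrow>\<^sub>L 'a" where
  "word_op T [] = id_blinfun"
| "word_op T (i # \<alpha>) = T i o\<^sub>L word_op T \<alpha>"


section \<open>The class \<open>C\<^sub>\<rho>\<close>\<close>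

text \<open>
  HOL cannot quantify existentially over types, so the dilation space \<open>G\<close> ranges over the closed
  subspaces of one large Hilbert space, \<open>\<ell>\<^sup>2\<close> over \<open>F\<^sub>n\<^sup>+ \<times> H\<close>.  This is no restriction: a dilation on
  an arbitrary Hilbert space restricts to the closed span of the vectors \<open>V\<^sub>\<alpha> h\<close> with
  \<open>(\<alpha>, h) \<in> F\<^sub>n\<^sup>+ \<times> H\<close>, which has an orthonormal basis indexed by a subset of \<open>F\<^sub>n\<^sup>+ \<times> H\<close> and so
  is isometric to such a subspace.  The inclusion of \<open>H\<close> in \<open>G\<close> is the isometry \<open>J\<close>; under
  this identification \<open>cadj J\<close> is the orthogonal projection onto \<open>H\<close>.  The \<open>V i\<close> are defined on the
  large space, but only their restrictions to \<open>G\<close> matter.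
\<close>

definition class_C :: "real \<Rightarrow> ('n::finite \<Rightarrow> 'h::complex_hilbert \<Rightarrow>\<^sub>L 'h) set" where
  "class_C \<rho> = {T. (\<forall>i. T i \<in> bop) \<and>
     (\<exists>(G :: ('n list \<times> 'h, complex) l2 set)
        (J :: 'h \<Rightarrow>\<^sub>L ('n list \<times> 'h, complex) l2)
        (V :: 'n \<Rightarrow> ('n list \<times> 'h, complex) l2 \<Rightarrow>\<^sub>L ('n list \<times> 'h, complex) l2).
        closed G \<and> 0 \<in> G \<and> (\<forall>x\<in>G. \<forall>y\<in>G. x + y \<in> G) \<and> (\<forall>c. \<forall>x\<in>G. c *\<^sub>C x \<in> G) \<and>
        J \<in> bop \<and> (\<forall>h. norm (J h) = norm h) \<and> range J \<subseteq> G \<and>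
        (\<forall>i. V i \<in> bop \<and> V i ` G \<subseteq> G \<and> (\<forall>x\<in>G. norm (V i x) = norm x)) \<and>
        (\<forall>i j. i \<noteq> j \<longrightarrow> (\<forall>x\<in>G. \<forall>y\<in>G. cinner (V i x) (V j y) = 0)) \<and>
        (\<forall>\<alpha>. \<alpha> \<noteq> [] \<longrightarrow> word_op T \<alpha> = \<rho> *\<^sub>R (cadj J o\<^sub>L word_op V \<alpha> o\<^sub>L J)))}"


section \<open>Noncommutative polynomials with matrix coefficients and Harnack domination\<close>

text \<open>
  An operator on \<open>H \<otimes> \<complex>\<^sup>k = H\<^sup>k\<close> is represented by its \<open>k \<times> k\<close> matrix of operators on \<open>H\<close>, of
  which only the entries with indices below \<open>k\<close> are relevant; likewise for scalar matrices.
\<close>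

type_synonym 'a opmat = "nat \<Rightarrow> nat \<Rightarrow> 'a \<Rightarrow>\<^sub>L 'a"

definition opmat_Re :: "'a::complex_hilbert opmat \<Rightarrow> 'a opmat" where
  "opmat_Re P = (\<lambda>s t. (1 / 2) *\<^sub>R (cadj (P t s) + P s t))"

definition opmat_nonneg :: "nat \<Rightarrow> 'a::complex_hilbert opmat \<Rightarrow> bool" where
  "opmat_nonneg k P \<longleftrightarrow>
     (\<forall>x :: nat \<Rightarrow> 'a. (\<Sum>s<k. cinner (\<Sum>t<k. P s t (x t)) (x s)) \<in> \<real>\<^sub>\<ge>\<^sub>0)"

definition opmat_le :: "nat \<Rightarrow> 'a::complex_hilbert opmat \<Rightarrow> 'a opmat \<Rightarrow> bool" where
  "opmat_le k P Q \<longleftrightarrow> opmat_nonneg k (\<lambda>s t. Q s t - P s t)"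

text \<open>\<open>M \<alpha>\<close> is the matrix coefficient of \<open>X\<^sub>\<alpha>\<close>.\<close>

definition poly_supp :: "nat \<Rightarrow> ('n list \<Rightarrow> nat \<Rightarrow> nat \<Rightarrow> complex) \<Rightarrow> 'n list set" where
  "poly_supp k M = {\<alpha>. \<exists>s<k. \<exists>t<k. M \<alpha> s t \<noteq> 0}"

definition is_nc_poly :: "nat \<Rightarrow> ('n list \<Rightarrow> nat \<Rightarrow> nat \<Rightarrow> complex) \<Rightarrow> bool" where
  "is_nc_poly k M \<longleftrightarrow> finite (poly_supp k M)"

definition poly_eval ::
    "nat \<Rightarrow> ('n list \<Rightarrow> nat \<Rightarrow> nat \<Rightarrow> complex) \<Rightarrow> ('n \<Rightarrow> 'a::complex_hilbert \<Rightarrow>\<^sub>L 'a) \<Rightarrow> 'a opmat" where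
  "poly_eval k M X = (\<lambda>s t. \<Sum>\<alpha>\<in>poly_supp k M. M \<alpha> s t *\<^sub>C word_op X \<alpha>)"

definition op_ball :: "('n::finite \<Rightarrow> 'k::complex_hilbert \<Rightarrow>\<^sub>L 'k) set" where
  "op_ball = {X. (\<forall>i. X i \<in> bop) \<and> norm (\<Sum>i\<in>UNIV. X i o\<^sub>L cadj (X i)) < 1}"

text \<open>Real and complex infinite-dimensionality coincide, so the library's real \<open>span\<close> is used.\<close>

definition separable_infinite_dim :: "'k::complex_hilbert itself \<Rightarrow> bool" where
  "separable_infinite_dim _ \<longleftrightarrow>
     separable_space (euclidean :: 'k topology) \<and> (\<nexists>B :: 'k set. finite B \<and> span B = UNIV)"

definition Re_nonneg_on_ball ::
    "'k::complex_hilbert itself \<Rightarrow> nat \<Rightarrow> ('n::finite list \<Rightarrow> nat \<Rightarrow> nat \<Rightarrow> complex) \<Rightarrow> bool" where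
  "Re_nonneg_on_ball _ k M \<longleftrightarrow>
     (\<forall>X \<in> (op_ball :: ('n \<Rightarrow> 'k \<Rightarrow>\<^sub>L 'k) set). opmat_nonneg k (opmat_Re (poly_eval k M X)))"

text \<open>\<open>Re p(A) + (\<rho> - 1) Re p(0)\<close>\<close>

definition harnack_form ::
    "real \<Rightarrow> nat \<Rightarrow> ('n list \<Rightarrow> nat \<Rightarrow> nat \<Rightarrow> complex) \<Rightarrow> ('n \<Rightarrow> 'h::complex_hilbert \<Rightarrow>\<^sub>L 'h) \<Rightarrow> 'h opmat" where
  "harnack_form \<rho> k M A =
     (\<lambda>s t. opmat_Re (poly_eval k M A) s t + (\<rho> - 1) *\<^sub>R opmat_Re (poly_eval k M (\<lambda>_. 0)) s t)"

definition harnack_dom ::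
    "'k::complex_hilbert itself \<Rightarrow> real \<Rightarrow> real \<Rightarrow>
     ('n::finite \<Rightarrow> 'h::complex_hilbert \<Rightarrow>\<^sub>L 'h) \<Rightarrow> ('n \<Rightarrow> 'h \<Rightarrow>\<^sub>L 'h) \<Rightarrow> bool" where
  "harnack_dom K \<rho> c A B \<longleftrightarrow> A \<in> class_C \<rho> \<and> B \<in> class_C \<rho> \<and> c > 0 \<and>
     (\<forall>k M. is_nc_poly k M \<and> Re_nonneg_on_ball K k M \<longrightarrow>
        opmat_le k (harnack_form \<rho> k M A) (\<lambda>s t. c\<^sup>2 *\<^sub>R harnack_form \<rho> k M B s t))"

definition harnack_equiv_const ::
    "'k::complex_hilbert itself \<Rightarrow> real \<Rightarrow> real \<Rightarrow>
     ('n::finite \<Rightarrow> 'h::complex_hilbert \<Rightarrow>\<^sub>L 'h) \<Rightarrow> ('n \<Rightarrow> 'h \<Rightarrow>\<^sub>L 'h) \<Rightarrow> bool" where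
  "harnack_equiv_const K \<rho> c A B \<longleftrightarrow> harnack_dom K \<rho> c A B \<and> harnack_dom K \<rho> c B A"

definition harnack_rel ::
    "'k::complex_hilbert itself \<Rightarrow> real \<Rightarrow> ('n::finite \<Rightarrow> 'h::complex_hilbert \<Rightarrow>\<^sub>L 'h) rel" where
  "harnack_rel K \<rho> = {(A, B). \<exists>c\<ge>1. harnack_equiv_const K \<rho> c A B}"

definition harnack_parts ::
    "'k::complex_hilbert itself \<Rightarrow> real \<Rightarrow> ('n::finite \<Rightarrow> 'h::complex_hilbert \<Rightarrow>\<^sub>L 'h) set set" where
  "harnack_parts K \<rho> = class_C \<rho> // harnack_rel K \<rho>"

definition hyp_metric ::
    "'k::complex_hilbert itself \<Rightarrow> real \<Rightarrow>
     ('n::finite \<Rightarrow> 'h::complex_hilbert \<Rightarrow>\<^sub>L 'h) \<Rightarrow> ('n \<Rightarrow> 'h \<Rightarrow>\<^sub>L 'h) \<Rightarrow> real" where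
  "hyp_metric K \<rho> A B = ln (Inf {c. c > 1 \<and> harnack_equiv_const K \<rho> c A B})"


section \<open>Free holomorphic functions\<close>

definition free_holomorphic :: "('n::finite list \<Rightarrow> complex) \<Rightarrow> bool" where
  "free_holomorphic a \<longleftrightarrow>
     limsup (\<lambda>k. ereal ((\<Sum>\<alpha> | length \<alpha> = k. (cmod (a \<alpha>))\<^sup>2) powr (1 / (2 * real k)))) \<le> 1"

definition free_eval :: "('n::finite list \<Rightarrow> complex) \<Rightarrow> ('n \<Rightarrow> 'a::complex_hilbert \<Rightarrow>\<^sub>L 'a) \<Rightarrow> 'a \<Rightarrow>\<^sub>L 'a" where
  "free_eval a X = (\<Sum>k. \<Sum>\<alpha> | length \<alpha> = k. a \<alpha> *\<^sub>C word_op X \<alpha>)"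

lemma bounded_linear_row:
  "bounded_linear (\<lambda>y :: ('m::finite, 'a::complex_hilbert) l2. \<Sum>j\<in>UNIV. (Y j :: 'a \<Rightarrow>\<^sub>L 'a) (l2_nth y j))"
proof -
  have "bounded_linear (\<lambda>y :: ('m, 'a) l2. l2_nth y j)" for j
    by (rule bounded_linear_intro[where K = 1])
      (simp_all add: plus_l2.rep_eq scaleR_l2.rep_eq l2_nth_norm_le)
  then show ?thesis
    by (intro bounded_linear_sum bounded_linear_compose[OF blinfun.bounded_linear_right])
qed

text \<open>The row operator \<open>[Y\<^sub>1 \<dots> Y\<^sub>m]\<close> from the \<open>m\<close>-fold Hilbert direct sum to the space.\<close>

lift_definition row_op :: "('m::finite \<Rightarrow> 'a::complex_hilbert \<Rightarrow>\<^sub>L 'a) \<Rightarrow> ('m, 'a) l2 \<Rightarrow>\<^sub>L 'a"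
  is "\<lambda>Y y. \<Sum>j\<in>UNIV. blinfun_apply (Y j) (l2_nth y j)"
  by (rule bounded_linear_row)

definition free_contractive ::
    "'k::complex_hilbert itself \<Rightarrow> ('m::finite \<Rightarrow> 'n::finite list \<Rightarrow> complex) \<Rightarrow> bool" where
  "free_contractive _ a \<longleftrightarrow>
     (\<forall>X \<in> (op_ball :: ('n \<Rightarrow> 'k \<Rightarrow>\<^sub>L 'k) set). norm (row_op (\<lambda>j. free_eval (a j) X)) \<le> 1)"

text \<open>\<open>f\<^sub>j(0)\<close> is the scalar coefficient of the empty word.\<close>

definition free_at_0 :: "('m::finite \<Rightarrow> 'n list \<Rightarrow> complex) \<Rightarrow> complex ^ 'm" where
  "free_at_0 a = (\<chi> j. a j [])"

text \<open>\<open>f(T)\<close>, the limit being taken in operator norm.\<close>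

definition free_apply ::
    "('m \<Rightarrow> 'n::finite list \<Rightarrow> complex) \<Rightarrow> ('n \<Rightarrow> 'h::complex_hilbert \<Rightarrow>\<^sub>L 'h) \<Rightarrow> 'm \<Rightarrow> 'h \<Rightarrow>\<^sub>L 'h" where
  "free_apply a T = (\<lambda>j. Lim (at_left 1) (\<lambda>r::real. free_eval (a j) (\<lambda>i. r *\<^sub>R T i)))"


section \<open>The noncommutative disc algebra\<close>

text \<open>
  The full Fock space in the orthonormal basis \<open>e\<^sub>\<alpha> = e\<^sub>i\<^sub>1 \<otimes> \<dots> \<otimes> e\<^sub>i\<^sub>k\<close>, the empty word giving
  the vacuum vector \<open>1\<close>; in these coordinates tensoring with \<open>e\<^sub>i\<close> on the left prefixes the letter \<open>i\<close>.
\<close>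

type_synonym 'n fock = "('n list, complex) l2"

definition prefix_coords :: "'n \<Rightarrow> ('n list \<Rightarrow> complex) \<Rightarrow> 'n list \<Rightarrow> complex" where
  "prefix_coords i \<phi> \<alpha> = (case \<alpha> of [] \<Rightarrow> 0 | j # \<beta> \<Rightarrow> if j = i then \<phi> \<beta> else 0)"

lemma has_sum_prefix_coords:
  assumes "((\<lambda>\<alpha>. (norm (\<phi> \<alpha>))\<^sup>2) has_sum S) UNIV"
  shows "((\<lambda>\<alpha>. (norm (prefix_coords i \<phi> \<alpha>))\<^sup>2) has_sum S) UNIV"
proof -
  have "((\<lambda>\<alpha>. (norm (prefix_coords i \<phi> \<alpha>))\<^sup>2) has_sum S) (range (Cons i))"
    using assms by (subst has_sum_reindex) (auto simp: o_def prefix_coords_def)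
  then show ?thesis
    by (rule has_sum_cong_neutral[THEN iffD1, rotated -1])
      (auto simp: prefix_coords_def split: list.splits)
qed

lift_definition creation_fun :: "'n \<Rightarrow> 'n fock \<Rightarrow> 'n fock" is prefix_coords
  by (auto simp: summable_on_def intro: has_sum_prefix_coords)

lemma norm_creation_fun: "norm (creation_fun i \<phi>) = norm \<phi>"
proof -
  have "((\<lambda>\<alpha>. (norm (l2_nth \<phi> \<alpha>))\<^sup>2) has_sum (norm \<phi>)\<^sup>2) UNIV"
    unfolding l2_norm_power2 using l2_summable_norm by (rule has_sum_infsum)
  then have "(norm (creation_fun i \<phi>))\<^sup>2 = (norm \<phi>)\<^sup>2"
    unfolding l2_norm_power2[of "creation_fun i \<phi>"] creation_fun.rep_eq
    by (intro infsumI has_sum_prefix_coords)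
  then show ?thesis by (simp add: power2_eq_iff_nonneg)
qed

lift_definition creation :: "'n \<Rightarrow> 'n fock \<Rightarrow>\<^sub>L 'n fock" is creation_fun
proof (rule bounded_linear_intro[where K = 1])
  fix i :: 'n and x y :: "'n fock" and r :: real
  show "creation_fun i (x + y) = creation_fun i x + creation_fun i y"
    by (simp add: l2_nth_inject[symmetric] creation_fun.rep_eq plus_l2.rep_eq prefix_coords_def
        fun_eq_iff split: list.splits)
  show "creation_fun i (r *\<^sub>R x) = r *\<^sub>R creation_fun i x"
    by (simp add: l2_nth_inject[symmetric] creation_fun.rep_eq scaleR_l2.rep_eq prefix_coords_def
        fun_eq_iff split: list.splits)
qed (simp add: norm_creation_fun)

definition norm_closed_algebra :: "('a::complex_hilbert \<Rightarrow>\<^sub>L 'a) set \<Rightarrow> bool" where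
  "norm_closed_algebra \<A> \<longleftrightarrow> closed \<A> \<and> 0 \<in> \<A> \<and> (\<forall>S\<in>\<A>. \<forall>T\<in>\<A>. S + T \<in> \<A> \<and> S o\<^sub>L T \<in> \<A>) \<and>
     (\<forall>c. \<forall>T\<in>\<A>. c *\<^sub>C T \<in> \<A>)"

definition disc_algebra :: "('n fock \<Rightarrow>\<^sub>L 'n fock) set" where
  "disc_algebra = norm_closed_algebra hull (insert id_blinfun (range creation))"

definition boundary_in_disc_algebra :: "('n::finite list \<Rightarrow> complex) \<Rightarrow> bool" where
  "boundary_in_disc_algebra a \<longleftrightarrow>
     (\<exists>F \<in> disc_algebra. ((\<lambda>r::real. free_eval a (\<lambda>i. r *\<^sub>R creation i)) \<longlongrightarrow> F) (at_left 1))"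


definition rho_f :: "real \<Rightarrow> real \<Rightarrow> real" where
  "rho_f \<rho> t = (if \<rho> < 1 then 1 + (\<rho> - 1) * ((1 - t) / (1 + t)) else 1 + (\<rho> - 1) * ((1 + t) / (1 - t)))"

end

theory Submission
  imports Defs "HOL-Complex_Analysis.Conformal_Mappings"
begin

text \<open>
  A tuple \<open>T\<close> is of class \<open>C\<^sub>\<rho>\<close> if and only if \<open>Re p(T) + (\<rho> - 1) Re p(0) \<ge> 0\<close> for all polynomials \<open>p\<close>
  with \<open>Re p \<ge> 0\<close> on the ball.  Necessity follows by writing the dilation, scaled by \<open>r < 1\<close>, as a
  compression of creation operators (the Poisson kernel).  For sufficiency, apply the hypothesis to
  the polynomials that encode the multi-Toeplitz kernel of a dilation and realise the resulting
  positive kernel by vectors.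

  If \<open>Re p \<ge> 0\<close> on the ball in \<open>m\<close> variables, then \<open>Re (p \<circ> f) \<ge> 0\<close> on the ball in \<open>n\<close> variables, so both
  the positivity above and Harnack domination carry over from \<open>T\<close> to \<open>f(T)\<close>, with \<open>p(f(0))\<close> in place of
  \<open>p(0)\<close>.  The Harnack inequality on the disc compares \<open>Re p(f(0))\<close> with \<open>Re p(0)\<close>; this is
  where \<open>\<rho>\<^sub>f\<close> comes from.  Since \<open>p \<circ> f\<close> is not a polynomial, it is approximated by \<open>p \<circ> q\<close>, where \<open>q\<close> is
  a normalised Taylor polynomial of \<open>f(r \<cdot>)\<close>.
\<close>


section \<open>Inner products, the Riesz representation and adjoints\<close>

text \<open>Positivity on the ball is given over the separable space \<open>'k\<close>, whereas the
  tuples act on an arbitrary \<open>'h\<close> and their dilations on a larger space still. The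
  bridge is \<open>toep_nonneg\<close>, a statement about finitely many scalar coefficients. It can
  be read off from finite orthonormal systems in \<open>'k\<close>, and it implies positivity on
  every Hilbert space, because inner products are sums over coordinates and the Poisson kernel turns
  evaluation at a strict row contraction into Toeplitz sums.

  Put Z = (\<rho> - 1) Re p(f(0)) and let D be \<rho>_f - 1 times Re p(0). The constant \<rho>_f is
  chosen so that the scalar Harnack inequality gives Z \<le> D for every admissible p; the sign of
  \<rho> - 1 decides which side of that inequality is relevant. For c \<ge> 1, adding D - Z on the
  left and c^2 (D - Z) on the right turns A + Z \<le> c^2 (B + Z) into A + D \<le> c^2 (B + D).
  Hence the same c serves f(A) and f(B), and the infimum defining the metric cannot grow.\<close>

lemma cinner_add_right: "cinner x (y + z) = cinner x y + cinner x z"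
  for x :: "'a::complex_hilbert"
  by (metis cinner_add_left cinner_commute complex_cnj_add)

lemma cmod_cinner_le: "cmod (cinner x y) \<le> norm x * norm y" for x :: "'a::complex_hilbert"
proof (cases "cinner x y = 0")
  case False
  \<comment> \<open>The unimodular factor u turns the inner product into its modulus, so the real
    Cauchy-Schwarz inequality applies without loss.\<close>
  define u where "u = cnj (cinner x y) / cmod (cinner x y)"
  have u: "cmod u = 1" using False by (simp add: u_def norm_divide)
  have "cinner (u *\<^sub>C x) y = complex_of_real (cmod (cinner x y))"
    using False complex_norm_square[of "cinner x y"]
    by (simp add: cinner_scaleC_left u_def field_simps power2_eq_square)
  then have "cmod (cinner x y) = inner (u *\<^sub>C x) y"
    by (simp add: inner_eq_Re_cinner)
  also have "\<dots> \<le> norm (u *\<^sub>C x) * norm y" by (rule norm_cauchy_schwarz)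
  finally show ?thesis by (simp add: norm_scaleC u)
qed simp

interpretation cinner: bounded_bilinear "cinner :: 'a::complex_hilbert \<Rightarrow> 'a \<Rightarrow> complex"
proof
  fix r :: real and x y z :: 'a
  show "cinner (x + y) z = cinner x z + cinner y z" by (rule cinner_add_left)
  show "cinner x (y + z) = cinner x y + cinner x z" by (rule cinner_add_right)
  show "cinner (r *\<^sub>R x) y = r *\<^sub>R cinner x y"
    by (simp add: scaleR_scaleC[of r x] cinner_scaleC_left scaleR_conv_of_real)
  show "cinner x (r *\<^sub>R y) = r *\<^sub>R cinner x y"
    by (simp add: scaleR_scaleC[of r y] cinner_scaleC_right scaleR_conv_of_real)
  show "\<exists>K. \<forall>x y::'a. cmod (cinner x y) \<le> norm x * norm y * K"
    by (rule exI[of _ 1]) (simp add: cmod_cinner_le)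
qed

lemmas cinner_simps = cinner.add_left cinner.add_right cinner.diff_left cinner.diff_right
  cinner.sum_left cinner.sum_right cinner_scaleC_left cinner_scaleC_right

lemma cinner_zero [simp]: "cinner 0 x = 0" "cinner x 0 = 0" for x :: "'a::complex_hilbert"
  by (simp_all add: cinner.zero_left cinner.zero_right)

lemma cinner_eq_zero_iff: "cinner x x = 0 \<longleftrightarrow> x = 0" for x :: "'a::complex_hilbert"
  by (simp add: cinner_self)

lemma cinner_ext: "(\<And>z. cinner x z = cinner y z) \<Longrightarrow> x = y" for x y :: "'a::complex_hilbert"
  using cinner_eq_zero_iff[of "x - y"] by (simp add: cinner_simps)

lemma cinner_ext_right: "(\<And>z. cinner z x = cinner z y) \<Longrightarrow> x = y" for x y :: "'a::complex_hilbert"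
  using cinner_eq_zero_iff[of "x - y"] by (simp add: cinner_simps)

lemma norm_eq_if_cinner_eq: "cinner x x = cinner y y \<Longrightarrow> norm x = norm y"
  for x :: "'a::complex_hilbert" and y :: "'b::complex_hilbert"
  unfolding cinner_self of_real_eq_iff by (simp add: power2_eq_iff_nonneg)

lemma scaleC_sum_right: "c *\<^sub>C sum f A = (\<Sum>i\<in>A. c *\<^sub>C f i)"
  for f :: "'i \<Rightarrow> 'a::complex_vector"
  by (induction A rule: infinite_finite_induct) (simp_all add: scaleC_add_right)

lemma scaleC_minus_one: "(-1) *\<^sub>C x = - x" for x :: "'a::complex_vector"
  using scaleR_scaleC[of "-1" x] by simp

lemma tendsto_scaleC:
  fixes f :: "'b \<Rightarrow> 'a::complex_hilbert"
  assumes "(f \<longlongrightarrow> x) F"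
  shows "((\<lambda>z. c *\<^sub>C f z) \<longlongrightarrow> c *\<^sub>C x) F"
proof (rule Lim_null_comparison[where g = "\<lambda>z. cmod c * norm (f z - x)", THEN LIM_zero_cancel])
  have "c *\<^sub>C f z - c *\<^sub>C x = c *\<^sub>C (f z - x)" for z
    using scaleC_add_right[of c "f z - x" x] by simp
  then show "\<forall>\<^sub>F z in F. norm (c *\<^sub>C f z - c *\<^sub>C x) \<le> cmod c * norm (f z - x)"
    by (simp add: norm_scaleC)
  show "((\<lambda>z. cmod c * norm (f z - x)) \<longlongrightarrow> 0) F"
    using tendsto_mult_right_zero[OF tendsto_norm_zero[OF LIM_zero[OF assms]]] by simp
qed

text \<open>
  The subspace \<open>N\<close> is the graph of a bounded functional on a not necessarily closed subspace; the
  representing vector is the limit of a minimising sequence of \<open>\<parallel>x\<parallel>\<^sup>2 - 2 Re b\<close>.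
\<close>

lemma riesz_graph:
  fixes N :: "('a::complex_hilbert \<times> complex) set"
  assumes zero: "(0, 0) \<in> N"
    and add: "\<And>x b x' b'. (x, b) \<in> N \<Longrightarrow> (x', b') \<in> N \<Longrightarrow> (x + x', b + b') \<in> N"
    and scale: "\<And>c x b. (x, b) \<in> N \<Longrightarrow> (c *\<^sub>C x, c * b) \<in> N"
    and bound: "\<And>x b. (x, b) \<in> N \<Longrightarrow> cmod b \<le> C * norm x" and C: "0 \<le> C"
  shows "\<exists>y \<in> closure (fst ` N). norm y \<le> C \<and> (\<forall>(x, b) \<in> N. cinner x y = b)"
proof -
  define F where "F = (\<lambda>(x::'a, b::complex). (norm x)\<^sup>2 - 2 * Re b)"
  have lower: "F p \<ge> - C\<^sup>2" if "p \<in> N" for p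
  proof -
    obtain x b where p: "p = (x, b)" by force
    have "Re b \<le> C * norm x"
      using bound[of x b] that complex_Re_le_cmod[of b] by (simp add: p)
    moreover have "0 \<le> (norm x - C)\<^sup>2" by simp
    ultimately show ?thesis by (simp add: F_def p power2_diff mult.commute[of C])
  qed
  define m where "m = Inf (F ` N)"
  have bdd: "bdd_below (F ` N)" using lower by (auto intro!: bdd_belowI)
  have mle: "m \<le> F p" if "p \<in> N" for p
    unfolding m_def by (rule cInf_lower[OF _ bdd]) (use that in auto)
  have "\<exists>p\<in>N. F p < m + 1 / real (Suc n)" for n
  proof -
    have "\<exists>z\<in>F ` N. z < m + 1 / real (Suc n)"
      unfolding m_def by (rule cInf_lessD) (use zero in auto)
    then show ?thesis by auto
  qed
  then obtain p where pN: "\<And>n. p n \<in> N" and pm: "\<And>n. F (p n) < m + 1 / real (Suc n)"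
    by metis
  define X B where "X = (\<lambda>n. fst (p n))" and "B = (\<lambda>n. snd (p n))"
  have XB: "(X n, B n) \<in> N" for n using pN[of n] by (simp add: X_def B_def)
  have Fn: "F (X n, B n) < m + 1 / real (Suc n)" for n
    using pm[of n] by (simp add: X_def B_def)
  \<comment> \<open>The midpoint of two terms belongs to the graph, so its value is at least m,
    while both terms are close to m. The parallelogram law turns this into a bound on their
    distance.\<close>
  have par: "(norm (X n - X k))\<^sup>2 \<le> 2 * (1 / real (Suc n) + 1 / real (Suc k))" for n k
  proof -
    have "((1/2) *\<^sub>C (X n + X k), (1/2) * (B n + B k)) \<in> N"
      by (intro scale add XB)
    from mle[OF this]
    have "m \<le> (norm (X n + X k))\<^sup>2 / 4 - (2 * Re (B n) + 2 * Re (B k)) / 2"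
      by (simp add: F_def norm_scaleC norm_divide power_mult_distrib power_divide)
    moreover have "(norm (X n + X k))\<^sup>2 + (norm (X n - X k))\<^sup>2 = 2 * (norm (X n))\<^sup>2 + 2 * (norm (X k))\<^sup>2"
      by (simp add: power2_norm_eq_inner inner_simps inner_commute)
    moreover have "R \<le> 2 * (e + e')"
      if "m \<le> Q / 4 - (2 * b + 2 * b') / 2" "Q + R = 2 * P + 2 * P'" "P - 2 * b < m + e" "P' - 2 * b' < m + e'"
      for Q R P P' b b' e e' :: real
      using that by (simp add: field_simps)
    ultimately show ?thesis
      using Fn[of n] Fn[of k] unfolding F_def prod.case by blast
  qed
  have "Cauchy X"
  proof (rule CauchyI)
    fix e :: real assume e: "e > 0"
    obtain M :: nat where M: "4 / e\<^sup>2 < real M" using reals_Archimedean2 by blast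
    have "norm (X n - X k) < e" if nk: "n \<ge> M" "k \<ge> M" for n k
    proof -
      have small: "1 / real (Suc j) < e\<^sup>2 / 4" if "j \<ge> M" for j
      proof -
        have "4 / e\<^sup>2 < real (Suc j)" using M that by simp
        then show ?thesis using e by (simp add: field_simps)
      qed
      have "(norm (X n - X k))\<^sup>2 < e\<^sup>2"
        using par[of n k] small[OF nk(1)] small[OF nk(2)] by simp
      then show ?thesis using e power_less_imp_less_base[of _ 2 e] by simp
    qed
    then show "\<exists>M. \<forall>n\<ge>M. \<forall>k\<ge>M. norm (X n - X k) < e" by blast
  qed
  then obtain y where y: "X \<longlonglongrightarrow> y" by (auto simp: Cauchy_convergent_iff convergent_def)
  have rep: "cinner x y = b" if xb: "(x, b) \<in> N" for x b
  proof (rule ccontr)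
    assume "cinner x y \<noteq> b"
    define d where "d = cinner x y - b"
    have d0: "cmod d > 0" using \<open>cinner x y \<noteq> b\<close> by (simp add: d_def)
    \<comment> \<open>Displacing a near-minimiser by a multiple of (x, b) cannot bring the
      functional below m; this is the limit of that statement along the sequence.\<close>
    have key: "0 \<le> 2 * Re (\<tau> * d) + (cmod \<tau>)\<^sup>2 * (norm x)\<^sup>2" for \<tau>
    proof (rule LIMSEQ_le_const)
      have "(\<lambda>n. 1 / real (Suc n) + 2 * Re (\<tau> * (cinner x (X n) - b)) + (cmod \<tau>)\<^sup>2 * (norm x)\<^sup>2)
          \<longlonglongrightarrow> 0 + 2 * Re (\<tau> * (cinner x y - b)) + (cmod \<tau>)\<^sup>2 * (norm x)\<^sup>2"
        by (intro tendsto_intros cinner.tendsto y LIMSEQ_Suc lim_1_over_n)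
      then show "(\<lambda>n. 1 / real (Suc n) + 2 * Re (\<tau> * (cinner x (X n) - b)) + (cmod \<tau>)\<^sup>2 * (norm x)\<^sup>2)
          \<longlonglongrightarrow> 2 * Re (\<tau> * d) + (cmod \<tau>)\<^sup>2 * (norm x)\<^sup>2" by (simp add: d_def)
      have "0 \<le> 1 / real (Suc n) + 2 * Re (\<tau> * (cinner x (X n) - b)) + (cmod \<tau>)\<^sup>2 * (norm x)\<^sup>2" for n
      proof -
        have "m \<le> F (X n + \<tau> *\<^sub>C x, B n + \<tau> * b)" by (intro mle add XB scale xb)
        also have "\<dots> = (norm (X n))\<^sup>2 + 2 * inner (\<tau> *\<^sub>C x) (X n) + (norm (\<tau> *\<^sub>C x))\<^sup>2
            - 2 * Re (B n) - 2 * Re (\<tau> * b)"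
          by (simp add: F_def power2_norm_eq_inner inner_simps inner_commute)
        also have "\<dots> = F (X n, B n) + 2 * Re (\<tau> * (cinner x (X n) - b)) + (cmod \<tau>)\<^sup>2 * (norm x)\<^sup>2"
          by (simp add: F_def inner_eq_Re_cinner cinner_scaleC_left norm_scaleC power_mult_distrib
              right_diff_distrib)
        finally show ?thesis using Fn[of n] by simp
      qed
      then show "\<exists>N. \<forall>n\<ge>N. 0 \<le> 1 / real (Suc n) + 2 * Re (\<tau> * (cinner x (X n) - b)) + (cmod \<tau>)\<^sup>2 * (norm x)\<^sup>2"
        by blast
    qed
    \<comment> \<open>A step of this length against the direction of d keeps the quadratic term
      below the linear one, so a nonzero d would contradict \<open>key\<close>.\<close>
    define s where "s = 1 / ((norm x)\<^sup>2 + 1)"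
    have s: "s > 0" and s1: "s * (norm x)\<^sup>2 < 1"
      by (simp_all add: s_def divide_simps add_nonneg_pos)
    have "complex_of_real (-s) * cnj d * d = complex_of_real (- (s * (cmod d)\<^sup>2))"
      using complex_norm_square[of d] by (simp add: mult_ac)
    then have "Re (complex_of_real (-s) * cnj d * d) = - (s * (cmod d)\<^sup>2)"
      by (metis Re_complex_of_real)
    then have "0 \<le> 2 * - (s * (cmod d)\<^sup>2) + (s * cmod d)\<^sup>2 * (norm x)\<^sup>2"
      using key[of "complex_of_real (-s) * cnj d"] s
      by (simp only: norm_mult norm_of_real complex_mod_cnj) simp
    then have "0 \<le> (cmod d)\<^sup>2 * (s * (s * (norm x)\<^sup>2 - 2))"
      by (simp add: algebra_simps power2_eq_square)
    then have "0 \<le> s * (norm x)\<^sup>2 - 2"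
      using d0 s by (simp add: zero_le_mult_iff)
    then show False using s1 by simp
  qed
  have "(norm y)\<^sup>2 \<le> C * norm y"
  proof (rule LIMSEQ_le)
    show "(\<lambda>n. cmod (cinner (X n) y)) \<longlonglongrightarrow> (norm y)\<^sup>2"
      using tendsto_norm[OF cinner.tendsto[OF y tendsto_const[of y]]]
      by (simp add: cinner_self norm_power)
    show "(\<lambda>n. C * norm (X n)) \<longlonglongrightarrow> C * norm y" by (intro tendsto_intros y)
    show "\<exists>M. \<forall>n\<ge>M. cmod (cinner (X n) y) \<le> C * norm (X n)"
      using rep[OF XB] bound[OF XB] by simp
  qed
  then have "norm y \<le> C"
    using C by (cases "y = 0") (simp_all add: power2_eq_square)
  moreover have "X n \<in> fst ` N" for n using imageI[OF XB, of fst n] by simp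
  then have "y \<in> closure (fst ` N)"
    using y unfolding closure_sequential by blast
  ultimately show ?thesis using rep by (intro bexI[of _ y]) auto
qed

corollary riesz_subspace:
  fixes G :: "'a::complex_hilbert set"
  assumes "0 \<in> G" "\<And>x y. x \<in> G \<Longrightarrow> y \<in> G \<Longrightarrow> x + y \<in> G" "\<And>c x. x \<in> G \<Longrightarrow> c *\<^sub>C x \<in> G"
    and add: "\<And>x y. \<phi> (x + y) = \<phi> x + \<phi> y" and scale: "\<And>c x. \<phi> (c *\<^sub>C x) = c * \<phi> x"
    and bound: "\<And>x. cmod (\<phi> x) \<le> C * norm x" "0 \<le> C"
  shows "\<exists>y \<in> closure G. norm y \<le> C \<and> (\<forall>x\<in>G. cinner x y = \<phi> x)"
proof -
  define N where "N = (\<lambda>x. (x, \<phi> x)) ` G"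
  have N: "(x, b) \<in> N \<longleftrightarrow> x \<in> G \<and> b = \<phi> x" for x b by (auto simp: N_def)
  have "\<phi> 0 = 0" using scale[of 0 0] by simp
  then have "\<exists>y \<in> closure (fst ` N). norm y \<le> C \<and> (\<forall>(x, b) \<in> N. cinner x y = b)"
    by (intro riesz_graph) (simp_all add: N assms)
  moreover have "fst ` N = G" by (force simp: N_def)
  ultimately show ?thesis by (auto simp: N_def)
qed

lemma closure_subspace:
  fixes S :: "'a::complex_hilbert set"
  assumes add: "\<And>x y. x \<in> S \<Longrightarrow> y \<in> S \<Longrightarrow> x + y \<in> S" and scale: "\<And>c x. x \<in> S \<Longrightarrow> c *\<^sub>C x \<in> S"
  shows "x \<in> closure S \<Longrightarrow> y \<in> closure S \<Longrightarrow> x + y \<in> closure S"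
    and "x \<in> closure S \<Longrightarrow> c *\<^sub>C x \<in> closure S"
proof -
  assume "x \<in> closure S"
  then obtain f where f: "\<And>n. f n \<in> S" "f \<longlonglongrightarrow> x" by (auto simp: closure_sequential)
  show "c *\<^sub>C x \<in> closure S"
    unfolding closure_sequential
    by (intro exI[of _ "\<lambda>n. c *\<^sub>C f n"] conjI tendsto_scaleC f allI scale)
  assume "y \<in> closure S"
  then obtain g where g: "\<And>n. g n \<in> S" "g \<longlonglongrightarrow> y" by (auto simp: closure_sequential)
  show "x + y \<in> closure S"
    unfolding closure_sequential
    by (intro exI[of _ "\<lambda>n. f n + g n"] conjI tendsto_add f g allI add)
qed

section \<open>Bounded operators: adjoints and orthogonal projections\<close>

lemma bopD: "T \<in> bop \<Longrightarrow> blinfun_apply T (c *\<^sub>C x) = c *\<^sub>C blinfun_apply T x"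
  by (simp add: bop_def)

lemma bopI:
  assumes "\<And>x y. f (x + y) = f x + f y" "\<And>c x. f (c *\<^sub>C x) = c *\<^sub>C f x" "\<And>x. norm (f x) \<le> K * norm x"
  shows "\<exists>T\<in>bop. \<forall>x. blinfun_apply T x = f x"
proof -
  have f: "bounded_linear f"
    by (rule bounded_linear_intro[where K = K]) (use assms in \<open>simp_all add: scaleR_scaleC mult.commute\<close>)
  show ?thesis
    by (rule bexI[of _ "Blinfun f"]) (simp_all add: bop_def bounded_linear_Blinfun_apply[OF f] assms)
qed

lemma cadj_eqI:
  assumes "\<And>x y. cinner (blinfun_apply T x) y = cinner x (blinfun_apply S y)"
  shows "cadj T = S"
  unfolding cadj_def
proof (rule the_equality)
  fix S' assume "\<forall>x y. cinner (blinfun_apply T x) y = cinner x (blinfun_apply S' y)"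
  then have "cinner x (blinfun_apply S' y) = cinner x (blinfun_apply S y)" for x y
    using assms[of x y] by simp
  then show "S' = S" by (rule blinfun_eqI[OF cinner_ext_right])
qed (use assms in auto)

lemma cadj_exists:
  assumes T: "T \<in> bop"
  shows "\<exists>S\<in>bop. \<forall>x y. cinner (blinfun_apply T x) y = cinner x (blinfun_apply S y)"
proof -
  have "\<exists>z. norm z \<le> norm T * norm y \<and> (\<forall>x. cinner (blinfun_apply T x) y = cinner x z)" for y
  proof -
    have "cmod (cinner (blinfun_apply T x) y) \<le> norm T * norm y * norm x" for x
    proof -
      have "cmod (cinner (blinfun_apply T x) y) \<le> norm (blinfun_apply T x) * norm y"
        by (rule cmod_cinner_le)
      also have "\<dots> \<le> norm T * norm x * norm y" by (intro mult_right_mono norm_blinfun) simp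
      finally show ?thesis by (simp add: mult_ac)
    qed
    then have "\<exists>z\<in>closure UNIV. norm z \<le> norm T * norm y \<and>
        (\<forall>x\<in>UNIV. cinner x z = cinner (blinfun_apply T x) y)"
      by (intro riesz_subspace) (simp_all add: cinner_simps blinfun.add_right bopD[OF T])
    then obtain z where "norm z \<le> norm T * norm y" "\<forall>x\<in>UNIV. cinner x z = cinner (blinfun_apply T x) y"
      by blast
    then show ?thesis by (intro exI[of _ z]) simp
  qed
  then have "\<forall>y. \<exists>z. norm z \<le> norm T * norm y \<and> (\<forall>x. cinner (blinfun_apply T x) y = cinner x z)"
    by simp
  from choice[OF this] obtain f
    where f: "\<And>y. norm (f y) \<le> norm T * norm y" "\<And>x y. cinner (blinfun_apply T x) y = cinner x (f y)"
    by blast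
  have "\<exists>S\<in>bop. \<forall>x. blinfun_apply S x = f x"
  proof (rule bopI)
    show "f (x + y) = f x + f y" for x y
      by (rule cinner_ext_right) (simp only: f(2)[symmetric] cinner_simps)
    show "f (c *\<^sub>C x) = c *\<^sub>C f x" for c x
      by (rule cinner_ext_right) (simp only: f(2)[symmetric] cinner_simps)
    show "norm (f x) \<le> norm T * norm x" for x by (rule f)
  qed
  then obtain S where "S \<in> bop" "\<And>x. blinfun_apply S x = f x" by blast
  then show ?thesis by (intro bexI[of _ S]) (simp_all add: f(2))
qed

lemma cinner_cadj: "T \<in> bop \<Longrightarrow> cinner (blinfun_apply T x) y = cinner x (blinfun_apply (cadj T) y)"
  and cadj_in_bop: "T \<in> bop \<Longrightarrow> cadj T \<in> bop"
proof -
  assume "T \<in> bop"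
  then obtain S where S: "S \<in> bop" "\<And>x y. cinner (blinfun_apply T x) y = cinner x (blinfun_apply S y)"
    using cadj_exists by blast
  from cadj_eqI[OF S(2)] S show "cadj T \<in> bop"
    and "cinner (blinfun_apply T x) y = cinner x (blinfun_apply (cadj T) y)" by auto
qed

lemma cinner_cadj': "T \<in> bop \<Longrightarrow> cinner (blinfun_apply (cadj T) x) y = cinner x (blinfun_apply T y)"
  using cinner_cadj[of T y x] cinner_commute[of "blinfun_apply T y" x]
    cinner_commute[of y "blinfun_apply (cadj T) x"] by simp

text \<open>The image of y is the vector of G that represents the functional x \<mapsto> <x, y> on
  G. Uniqueness of this vector gives linearity and the identity on G.\<close>

lemma orth_projection:
  fixes G :: "'a::complex_hilbert set"
  assumes G: "closed G" "0 \<in> G" "\<And>x y. x \<in> G \<Longrightarrow> y \<in> G \<Longrightarrow> x + y \<in> G" "\<And>c x. x \<in> G \<Longrightarrow> c *\<^sub>C x \<in> G"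
  obtains P where "P \<in> bop" "\<And>x. blinfun_apply P x \<in> G" "\<And>x. x \<in> G \<Longrightarrow> blinfun_apply P x = x"
    "\<And>x y. cinner (blinfun_apply P x) y = cinner x (blinfun_apply P y)" "\<And>x. norm (blinfun_apply P x) \<le> norm x"
proof -
  have "\<exists>z\<in>G. norm z \<le> norm y \<and> (\<forall>x\<in>G. cinner x z = cinner x y)" for y
  proof -
    have "\<exists>z\<in>closure G. norm z \<le> norm y \<and> (\<forall>x\<in>G. cinner x z = cinner x y)"
      by (intro riesz_subspace)
        (simp_all add: G cinner_simps cmod_cinner_le mult.commute[of "norm y"])
    then show ?thesis using G(1) by simp
  qed
  then obtain f where f: "\<And>y. f y \<in> G" "\<And>y. norm (f y) \<le> norm y" "\<And>x y. x \<in> G \<Longrightarrow> cinner x (f y) = cinner x y"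
    by metis
  have uniq: "z = w" if "z \<in> G" "w \<in> G" "\<And>x. x \<in> G \<Longrightarrow> cinner x z = cinner x w" for z w
  proof -
    have "z + (-1) *\<^sub>C w \<in> G" by (intro G that)
    then have "cinner (z - w) (z - w) = 0" using that(3)[of "z - w"]
        by (simp add: scaleC_minus_one cinner_simps)
    then show ?thesis by (simp add: cinner_eq_zero_iff)
  qed
  have "\<exists>P\<in>bop. \<forall>x. blinfun_apply P x = f x"
  proof (rule bopI)
    show "f (x + y) = f x + f y" for x y
      by (rule uniq) (simp_all only: G(3,4) f(1,3) cinner_simps)
    show "f (c *\<^sub>C x) = c *\<^sub>C f x" for c x
      by (rule uniq) (simp_all only: G(3,4) f(1,3) cinner_simps)
    show "norm (f x) \<le> 1 * norm x" for x using f(2) by simp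
  qed
  then obtain P where P: "P \<in> bop" "\<And>x. blinfun_apply P x = f x" by blast
  show thesis
  proof (rule that[OF P(1)])
    show "x \<in> G \<Longrightarrow> blinfun_apply P x = x" for x
      unfolding P by (rule uniq) (simp_all only: f(1,3))
    show "cinner (blinfun_apply P x) y = cinner x (blinfun_apply P y)" for x y
    proof -
      have "cinner (f x) y = cnj (cinner (f y) (f x))"
        by (rule trans[OF f(3)[OF f(1), of x y, symmetric] cinner_commute])
      also have "\<dots> = cinner x (f y)"
        unfolding f(3)[OF f(1)[of y], of x] by (rule cinner_commute[symmetric])
      finally show ?thesis unfolding P .
    qed
    show "norm (blinfun_apply P x) \<le> norm x" for x unfolding P by (rule f)
    show "blinfun_apply P x \<in> G" for x unfolding P by (rule f)
  qed
qed


section \<open>Realising positive kernels and extending isometries\<close>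

lift_definition l2_basis :: "'i \<Rightarrow> ('i, complex) l2" is "\<lambda>i j. if j = i then 1 else 0"
  by (rule finite_nonzero_values_imp_summable_on) (auto intro: finite_subset[of _ "{_}"])

lemma cinner_l2_basis [simp]: "cinner x (l2_basis i) = l2_nth x i"
proof -
  have "cinner x (l2_basis i) = (\<Sum>\<^sub>\<infinity>j. l2_nth x j * (if j = i then 1 else 0))"
    by (simp add: cinner_l2_def l2_basis.rep_eq cinner_complex_def if_distrib cong: if_cong)
  also have "\<dots> = (\<Sum>\<^sub>\<infinity>j\<in>{i}. l2_nth x j * (if j = i then 1 else 0))"
    by (rule infsum_cong_neutral) auto
  finally show ?thesis by simp
qed

lemma l2_nth_sum: "l2_nth (\<Sum>i\<in>F. f i) j = (\<Sum>i\<in>F. l2_nth (f i) j)"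
  by (induction F rule: infinite_finite_induct) (simp_all add: zero_l2.rep_eq plus_l2.rep_eq)

lemma cinner_double_sum:
  fixes v w :: "_ \<Rightarrow> 'a::complex_hilbert"
  shows "cinner (\<Sum>i\<in>F. c i *\<^sub>C v i) (\<Sum>j\<in>F'. d j *\<^sub>C w j)
    = (\<Sum>i\<in>F. \<Sum>j\<in>F'. c i * cnj (d j) * cinner (v i) (w j))"
  unfolding cinner.sum_left
proof (rule sum.cong)
  fix i
  show "cinner (c i *\<^sub>C v i) (\<Sum>j\<in>F'. d j *\<^sub>C w j) = (\<Sum>j\<in>F'. c i * cnj (d j) * cinner (v i) (w j))"
    unfolding cinner.sum_right by (simp add: cinner_scaleC_left cinner_scaleC_right mult_ac)
qed simp

lemma l2_nth_basis: "l2_nth (l2_basis i) j = (if j = i then 1 else 0)"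
  by (simp add: l2_basis.rep_eq)

lemma cinner_l2_basis_left [simp]: "cinner (l2_basis i) x = cnj (l2_nth x i)"
  using cinner_commute[of "l2_basis i" x] by simp

lemma closure_coord_0:
  assumes "x \<in> closure S" "\<And>y. y \<in> S \<Longrightarrow> cinner y z = 0"
  shows "cinner x z = 0"
proof -
  have "closed {y. cinner y z = 0}"
    by (intro closed_Collect_eq continuous_intros linear_continuous_on cinner.bounded_linear_left)
  then have "closure S \<subseteq> {y. cinner y z = 0}" by (intro closure_minimal) (use assms in auto)
  with assms show ?thesis by auto
qed

lemma scaleC_combination_add:
  fixes v :: "'i \<Rightarrow> 'a::complex_vector"
  assumes "finite F" "finite F'"
  shows "(\<Sum>i\<in>F. c i *\<^sub>C v i) + (\<Sum>i\<in>F'. c' i *\<^sub>C v i)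
    = (\<Sum>i\<in>F \<union> F'. ((if i \<in> F then c i else 0) + (if i \<in> F' then c' i else 0)) *\<^sub>C v i)"
proof -
  have "(\<Sum>i\<in>F. c i *\<^sub>C v i) = (\<Sum>i\<in>F \<union> F'. (if i \<in> F then c i else 0) *\<^sub>C v i)"
    using assms by (intro sum.mono_neutral_cong_left) auto
  moreover have "(\<Sum>i\<in>F'. c' i *\<^sub>C v i) = (\<Sum>i\<in>F \<union> F'. (if i \<in> F' then c' i else 0) *\<^sub>C v i)"
    using assms by (intro sum.mono_neutral_cong_left) auto
  ultimately show ?thesis by (simp add: scaleC_add_left sum.distrib)
qed

lemma scaleC_combination_scale:
  "c *\<^sub>C (\<Sum>i\<in>F. d i *\<^sub>C v i) = (\<Sum>i\<in>F. (c * d i) *\<^sub>C (v i :: 'a::complex_vector))"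
  by (simp add: scaleC_sum_right scaleC_scaleC)

text \<open>Only the real part of the form is required to be nonnegative, so Hermitian symmetry,
  which makes the form real, is a separate clause. The position of \<open>cnj\<close> agrees with
  \<open>cinner\<close>, so that Gram kernels <v_i, v_j> qualify.\<close>

definition psd_kernel :: "('i \<Rightarrow> 'i \<Rightarrow> complex) \<Rightarrow> bool" where
  "psd_kernel k \<longleftrightarrow> (\<forall>i j. k j i = cnj (k i j)) \<and>
     (\<forall>F c. finite F \<longrightarrow> 0 \<le> Re (\<Sum>i\<in>F. \<Sum>j\<in>F. c i * cnj (c j) * k i j))"

lemma psd_kernelD:
  "psd_kernel k \<Longrightarrow> finite F \<Longrightarrow> 0 \<le> Re (\<Sum>i\<in>F. \<Sum>j\<in>F. c i * cnj (c j) * k i j)"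
  unfolding psd_kernel_def by blast

lemma psd_kernel_diag:
  assumes "psd_kernel k"
  shows "k i i = complex_of_real (Re (k i i))" "0 \<le> Re (k i i)"
proof -
  have "k i i = cnj (k i i)" using assms unfolding psd_kernel_def by blast
  from arg_cong[OF this, of Im] have "Im (k i i) = 0" by simp
  then show "k i i = complex_of_real (Re (k i i))" by (intro complex_eqI) simp_all
  show "0 \<le> Re (k i i)"
    using psd_kernelD[OF assms, of "{i}" "\<lambda>_. 1"] by simp
qed

text \<open>The best choice is s = 1/\<kappa>. For \<kappa> = 0 the expression is affine in s, and a
  large s forces q = 0.\<close>

lemma quadratic_nonneg_bound:
  fixes p q \<kappa> :: real
  assumes "\<And>s. 0 \<le> p - 2 * s * q + s\<^sup>2 * q * \<kappa>" "0 \<le> \<kappa>" "0 \<le> q"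
  shows "q \<le> \<kappa> * p"
proof (cases "\<kappa> = 0")
  case True
  have "q = 0"
  proof (rule ccontr)
    assume "q \<noteq> 0"
    then show False using assms(1)[of "(p + 1) / (2 * q)"] True by (simp add: field_simps)
  qed
  with True show ?thesis by simp
next
  case False
  then have "\<kappa> > 0" using assms by simp
  moreover have "0 \<le> p - q / \<kappa>"
    using assms(1)[of "1 / \<kappa>"] \<open>\<kappa> > 0\<close> by (simp add: power2_eq_square field_simps)
  ultimately show ?thesis by (simp add: field_simps)
qed

text \<open>One step of a Cholesky decomposition: y is the component, in the closed span of the
  vectors already found, of the vector wanted at i0. It represents the functional with values k i i0
  on the v i. This functional is given by its graph because the v i may be linearly dependent;
  positivity of the kernel bounds it.\<close>

lemma kernel_extend:
  fixes v :: "'i \<Rightarrow> 'a::complex_hilbert"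
  assumes k: "psd_kernel k" and v: "\<And>i j. i \<in> D \<Longrightarrow> j \<in> D \<Longrightarrow> cinner (v i) (v j) = k i j"
    and i0: "i0 \<notin> D"
  shows "\<exists>y \<in> closure {\<Sum>i\<in>F. c i *\<^sub>C v i | F c. finite F \<and> F \<subseteq> D}.
    (norm y)\<^sup>2 \<le> Re (k i0 i0) \<and> (\<forall>j\<in>D. cinner (v j) y = k j i0)"
proof -
  have herm: "k j i = cnj (k i j)" for i j using k unfolding psd_kernel_def by blast
  define \<kappa> where "\<kappa> = Re (k i0 i0)"
  have \<kappa>: "k i0 i0 = complex_of_real \<kappa>" "0 \<le> \<kappa>" using psd_kernel_diag[OF k] by (simp_all add: \<kappa>_def)
  define N where "N = {(\<Sum>i\<in>F. c i *\<^sub>C v i, \<Sum>i\<in>F. c i *\<^sub>C k i i0) | F c. finite F \<and> F \<subseteq> D}"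
  have NI: "(\<Sum>i\<in>F. c i *\<^sub>C v i, \<Sum>i\<in>F. c i *\<^sub>C k i i0) \<in> N" if "finite F" "F \<subseteq> D" for F c
    unfolding N_def using that by blast
  have "\<exists>y \<in> closure (fst ` N). norm y \<le> sqrt \<kappa> \<and> (\<forall>(x, b) \<in> N. cinner x y = b)"
  proof (rule riesz_graph)
    show "(0, 0) \<in> N" unfolding N_def by (auto intro!: exI[of _ "{}"])
  next
    fix x b x' b' assume "(x, b) \<in> N" "(x', b') \<in> N"
    then obtain F c F' c' where "finite F" "F \<subseteq> D" "finite F'" "F' \<subseteq> D"
      "x = (\<Sum>i\<in>F. c i *\<^sub>C v i)" "b = (\<Sum>i\<in>F. c i *\<^sub>C k i i0)"
      "x' = (\<Sum>i\<in>F'. c' i *\<^sub>C v i)" "b' = (\<Sum>i\<in>F'. c' i *\<^sub>C k i i0)"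
      unfolding N_def by blast
    then show "(x + x', b + b') \<in> N"
      by (simp only: scaleC_combination_add) (simp only: NI finite_UnI Un_least)
  next
    fix c x b assume "(x, b) \<in> N"
    then obtain F d where "finite F" "F \<subseteq> D"
      "x = (\<Sum>i\<in>F. d i *\<^sub>C v i)" "b = (\<Sum>i\<in>F. d i *\<^sub>C k i i0)"
      unfolding N_def by blast
    moreover have "c * b = c *\<^sub>C b" by (simp add: scaleC_complex_def)
    ultimately show "(c *\<^sub>C x, c * b) \<in> N"
      by (simp only: scaleC_combination_scale) (simp only: NI)
  next
    fix x b assume "(x, b) \<in> N"
    then obtain F c where F: "finite F" "F \<subseteq> D" and x: "x = (\<Sum>i\<in>F. c i *\<^sub>C v i)"
      and b: "b = (\<Sum>i\<in>F. c i * k i i0)"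
      unfolding N_def scaleC_complex_def by blast
    have i0F: "i0 \<notin> F" using F i0 by auto
    \<comment> \<open>Positivity on F enlarged by i0, where i0 carries the free coefficient d; the
      optimal d then yields the Cauchy-Schwarz bound.\<close>
    have quad: "0 \<le> (norm x)\<^sup>2 + 2 * Re (cnj d * b) + (cmod d)\<^sup>2 * \<kappa>" for d
    proof -
      define c' where "c' = c(i0 := d)"
      have c': "c' i = c i" if "i \<in> F" for i using that i0F by (auto simp: c'_def)
      have c'0: "c' i0 = d" by (simp add: c'_def)
      have "(\<Sum>i\<in>F. \<Sum>j\<in>F. c' i * cnj (c' j) * k i j) = cinner x x"
      proof -
        have "(\<Sum>i\<in>F. \<Sum>j\<in>F. c' i * cnj (c' j) * k i j)
            = (\<Sum>i\<in>F. \<Sum>j\<in>F. c i * cnj (c j) * cinner (v i) (v j))"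
        proof (intro sum.cong refl)
          fix i j assume ij: "i \<in> F" "j \<in> F"
          then have "cinner (v i) (v j) = k i j" using F v[of i j] by blast
          with ij show "c' i * cnj (c' j) * k i j = c i * cnj (c j) * cinner (v i) (v j)"
            by (simp add: c')
        qed
        also have "\<dots> = cinner x x"
          unfolding x by (rule cinner_double_sum[symmetric])
        finally show ?thesis .
      qed
      moreover have "(\<Sum>i\<in>F. c' i * cnj (c' i0) * k i i0) = cnj d * b"
        unfolding b sum_distrib_left by (intro sum.cong refl) (simp add: c' c'0 mult_ac)
      moreover have "(\<Sum>j\<in>F. c' i0 * cnj (c' j) * k i0 j) = cnj (cnj d * b)"
        unfolding b sum_distrib_left cnj_sum
      proof (rule sum.cong)
        fix j assume "j \<in> F"
        then show "c' i0 * cnj (c' j) * k i0 j = cnj (cnj d * (c j * k j i0))"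
          unfolding herm[of j i0] by (simp add: c' c'0 mult_ac)
      qed simp
      moreover have "c' i0 * cnj (c' i0) * k i0 i0 = complex_of_real ((cmod d)\<^sup>2 * \<kappa>)"
        unfolding c'0 \<kappa> using complex_norm_square[of d] by simp
      ultimately have "(\<Sum>i\<in>insert i0 F. \<Sum>j\<in>insert i0 F. c' i * cnj (c' j) * k i j)
          = complex_of_real ((cmod d)\<^sup>2 * \<kappa>) + cnj (cnj d * b) + (cnj d * b + cinner x x)"
        using F i0F by (simp only: sum.insert sum.distrib not_False_eq_True ac_simps)
      then have "Re (\<Sum>i\<in>insert i0 F. \<Sum>j\<in>insert i0 F. c' i * cnj (c' j) * k i j)
          = (norm x)\<^sup>2 + 2 * Re (cnj d * b) + (cmod d)\<^sup>2 * \<kappa>"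
        by (simp add: cinner_self)
      moreover have "0 \<le> Re (\<Sum>i\<in>insert i0 F. \<Sum>j\<in>insert i0 F. c' i * cnj (c' j) * k i j)"
        by (rule psd_kernelD[OF k]) (use F in simp)
      ultimately show ?thesis by simp
    qed
    have "(cmod b)\<^sup>2 \<le> \<kappa> * (norm x)\<^sup>2"
    proof (rule quadratic_nonneg_bound)
      fix s :: real
      have "cnj (complex_of_real (-s) * b) * b = complex_of_real (-(s * (cmod b)\<^sup>2))"
        using complex_norm_square[of b] by (simp add: mult_ac)
      then have "Re (cnj (complex_of_real (-s) * b) * b) = -(s * (cmod b)\<^sup>2)"
        by (metis Re_complex_of_real)
      with quad[of "complex_of_real (-s) * b"]
      show "0 \<le> (norm x)\<^sup>2 - 2 * s * (cmod b)\<^sup>2 + s\<^sup>2 * (cmod b)\<^sup>2 * \<kappa>"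
        by (simp only: norm_mult norm_of_real power_mult_distrib) simp
    qed (use \<kappa> in auto)
    then have "sqrt ((cmod b)\<^sup>2) \<le> sqrt (\<kappa> * (norm x)\<^sup>2)" by (rule real_sqrt_le_mono)
    then show "cmod b \<le> sqrt \<kappa> * norm x" by (simp add: real_sqrt_mult)
  qed (simp add: \<kappa>)
  then obtain y where y: "y \<in> closure (fst ` N)" "norm y \<le> sqrt \<kappa>" "\<And>x b. (x, b) \<in> N \<Longrightarrow> cinner x y = b"
    by fast
  have "fst ` N \<subseteq> {\<Sum>i\<in>F. c i *\<^sub>C v i | F c. finite F \<and> F \<subseteq> D}"
    unfolding N_def by (auto; blast)
  then have "y \<in> closure {\<Sum>i\<in>F. c i *\<^sub>C v i | F c. finite F \<and> F \<subseteq> D}"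
    using y(1) closure_mono by blast
  moreover have "(norm y)\<^sup>2 \<le> \<kappa>"
    using power_mono[OF y(2), of 2] \<kappa> by simp
  moreover have "cinner (v j) y = k j i0" if "j \<in> D" for j
  proof -
    have "(v j, k j i0) \<in> N"
      unfolding N_def
      by (rule CollectI, rule exI[of _ "{j}"], rule exI[of _ "\<lambda>_. 1"]) (use that in simp)
    then show ?thesis by (rule y(3))
  qed
  ultimately show ?thesis by (intro bexI[of _ y]) (auto simp: \<kappa>_def)
qed

text \<open>A transfinite Cholesky decomposition: \<open>v i\<close> is supported on the indices up to \<open>i\<close>.\<close>

lemma psd_kernel_realisation:
  fixes k :: "'i \<Rightarrow> 'i \<Rightarrow> complex"
  assumes k: "psd_kernel k"
  shows "\<exists>v :: 'i \<Rightarrow> ('i, complex) l2. \<forall>i j. cinner (v i) (v j) = k i j"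
proof -
  have herm: "k j i = cnj (k i j)" for i j using k unfolding psd_kernel_def by blast
  obtain r :: "'i rel" where r: "well_order_on UNIV r" using well_order_on by blast
  define R where "R = r - Id"
  have wf: "wf R" using r by (simp add: well_order_on_def R_def)
  have total: "i = j \<or> (i, j) \<in> R \<or> (j, i) \<in> R" for i j
    using r by (auto simp: R_def well_order_on_def linear_order_on_def total_on_def)
  have trans: "trans R"
    using r unfolding R_def well_order_on_def linear_order_on_def partial_order_on_def preorder_on_def
    by (intro trans_diff_Id) auto
  have asym: "(j, i) \<notin> R" if "(i, j) \<in> R" for i j using wf_not_sym[OF wf that] .
  \<comment> \<open>\<open>P f i x\<close> says that x may serve as the vector at i once f gives the
    vectors below i. The support clause keeps coordinate i free until step i.\<close>
  define P where "P = (\<lambda>(f :: 'i \<Rightarrow> ('i, complex) l2) i x. (\<forall>j. (j, i) \<in> R \<longrightarrow> cinner (f j) x = k j i)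
     \<and> cinner x x = k i i \<and> (\<forall>l. l \<noteq> i \<longrightarrow> (l, i) \<notin> R \<longrightarrow> l2_nth x l = 0))"
  have "\<exists>f. \<forall>i. P f i (f i)"
  proof (rule dependent_wf_choice[OF wf])
    fix f g :: "'i \<Rightarrow> ('i, complex) l2" and i x
    assume "\<And>j. (j, i) \<in> R \<Longrightarrow> f j = g j"
    then show "P f i x = P g i x" by (simp add: P_def)
  next
    fix i and f :: "'i \<Rightarrow> ('i, complex) l2" assume IH: "\<And>j. (j, i) \<in> R \<Longrightarrow> P f j (f j)"
    define D where "D = {j. (j, i) \<in> R}"
    have iD: "i \<notin> D" using asym[of i i] by (auto simp: D_def)
    have gram: "cinner (f j) (f l) = k j l" if "j \<in> D" "l \<in> D" for j l
    proof -
      consider "j = l" | "(j, l) \<in> R" | "(l, j) \<in> R" using total by blast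
      then show ?thesis
      proof cases
        case 3
        then have "cinner (f l) (f j) = k l j" using IH[of j] that by (auto simp: P_def D_def)
        then show ?thesis using cinner_commute[of "f j" "f l"] herm[of j l] by simp
      qed (use IH that in \<open>auto simp: P_def D_def\<close>)
    qed
    obtain y where y: "y \<in> closure {\<Sum>i\<in>F. c i *\<^sub>C f i | F c. finite F \<and> F \<subseteq> D}"
      "(norm y)\<^sup>2 \<le> Re (k i i)" "\<And>j. j \<in> D \<Longrightarrow> cinner (f j) y = k j i"
      using kernel_extend[OF k gram iD] by blast
    have supp: "l2_nth (f j) l = 0" if "j \<in> D" "l \<notin> D" for j l
    proof -
      have "l \<noteq> j" using that by auto
      moreover have "(l, j) \<notin> R" using that transD[OF trans, of l j i] by (auto simp: D_def)
      ultimately show ?thesis using IH[of j] that by (auto simp: P_def D_def)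
    qed
    have ysupp: "l2_nth y l = 0" if "l \<notin> D" for l
    proof -
      have "cinner y (l2_basis l) = 0"
      proof (rule closure_coord_0[OF y(1)])
        fix z assume "z \<in> {\<Sum>i\<in>F. c i *\<^sub>C f i | F c. finite F \<and> F \<subseteq> D}"
        then obtain F c where z: "z = (\<Sum>i\<in>F. c i *\<^sub>C f i)" "F \<subseteq> D" by blast
        have "cinner z (l2_basis l) = (\<Sum>i\<in>F. c i * l2_nth (f i) l)"
          unfolding z by (simp add: l2_nth_sum scaleC_l2.rep_eq scaleC_complex_def)
        also have "\<dots> = 0" using z(2) supp[OF _ that] by (intro sum.neutral) auto
        finally show "cinner z (l2_basis l) = 0" .
      qed
      then show ?thesis by simp
    qed
    \<comment> \<open>The vectors below i and y itself vanish at coordinate i. Adding s times the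
      basis vector there changes no inner product with the former and raises the norm of y to the
      prescribed diagonal value.\<close>
    define s where "s = sqrt (Re (k i i) - (norm y)\<^sup>2)"
    have s2: "s * s = Re (k i i) - (norm y)\<^sup>2"
      using y(2) by (simp add: s_def)
    define x where "x = y + complex_of_real s *\<^sub>C l2_basis i"
    have "P f i x"
      unfolding P_def
    proof (intro conjI allI impI)
      fix j assume "(j, i) \<in> R"
      then have "j \<in> D" by (simp add: D_def)
      then show "cinner (f j) x = k j i"
        using supp[OF _ iD] by (simp add: x_def cinner_simps y(3))
    next
      have "cinner x x = complex_of_real ((norm y)\<^sup>2 + s * s)"
        using ysupp[OF iD] by (simp add: x_def cinner_simps cinner_self[of y] l2_nth_basis
            plus_l2.rep_eq scaleC_l2.rep_eq scaleC_complex_def)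
      also have "\<dots> = k i i" unfolding s2 using psd_kernel_diag(1)[OF k, of i] by simp
      finally show "cinner x x = k i i" .
    next
      fix l assume "l \<noteq> i" "(l, i) \<notin> R"
      then show "l2_nth x l = 0"
        using ysupp[of l] by (simp add: x_def D_def plus_l2.rep_eq scaleC_l2.rep_eq l2_nth_basis)
    qed
    then show "\<exists>x. P f i x" ..
  qed
  then obtain v where v: "\<And>i. P v i (v i)" by blast
  have "cinner (v i) (v j) = k i j" for i j
  proof -
    consider "i = j" | "(i, j) \<in> R" | "(j, i) \<in> R" using total by blast
    then show ?thesis
    proof cases
      case 3
      then have "cinner (v j) (v i) = k j i" using v[of i] by (auto simp: P_def)
      then show ?thesis using cinner_commute[of "v i" "v j"] herm[of i j] by simp
    qed (use v[of j] in \<open>auto simp: P_def\<close>)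
  qed
  then show ?thesis by blast
qed

text \<open>The inner product is itself a positive kernel, so its realisation in \<open>l2\<close>
  provides coordinates on an arbitrary Hilbert space, in the role of an orthonormal basis.\<close>

lemma cinner_coordinates:
  "\<exists>\<Phi> :: 'a::complex_hilbert \<Rightarrow> 'a \<Rightarrow> complex.
     \<forall>x y. ((\<lambda>i. \<Phi> x i * cnj (\<Phi> y i)) has_sum cinner x y) UNIV"
proof -
  have "psd_kernel (cinner :: 'a \<Rightarrow> 'a \<Rightarrow> complex)"
    unfolding psd_kernel_def
  proof (intro conjI allI impI)
    fix F :: "'a set" and c
    have "(\<Sum>i\<in>F. \<Sum>j\<in>F. c i * cnj (c j) * cinner i j)
        = cinner (\<Sum>i\<in>F. c i *\<^sub>C i) (\<Sum>i\<in>F. c i *\<^sub>C i)"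
      by (rule cinner_double_sum[symmetric])
    then show "0 \<le> Re (\<Sum>i\<in>F. \<Sum>j\<in>F. c i * cnj (c j) * cinner i j)"
      by (simp add: cinner_self)
  qed (rule cinner_commute)
  then obtain v :: "'a \<Rightarrow> ('a, complex) l2" where v: "\<And>i j. cinner (v i) (v j) = cinner i j"
    using psd_kernel_realisation by blast
  have "((\<lambda>i. l2_nth (v x) i * cnj (l2_nth (v y) i)) has_sum cinner x y) UNIV" for x y
    using has_sum_infsum[OF l2_cinner_summable[of "v x" "v y"]]
    by (simp add: cinner_complex_def v[of x y, symmetric] cinner_l2_def)
  then show ?thesis by (intro exI[of _ "\<lambda>x. l2_nth (v x)"]) simp
qed

text \<open>N is the graph of an isometry on a subspace. The adjoint is built first, sending z to
  the vector of the closed domain that represents x \<mapsto> <w, z>; its own adjoint V then extends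
  N and vanishes on the orthogonal complement of the domain.\<close>

lemma isometry_extension:
  fixes N :: "('a::complex_hilbert \<times> 'b::complex_hilbert) set"
  assumes zero: "(0, 0) \<in> N"
    and add: "\<And>x w x' w'. (x, w) \<in> N \<Longrightarrow> (x', w') \<in> N \<Longrightarrow> (x + x', w + w') \<in> N"
    and scale: "\<And>c x w. (x, w) \<in> N \<Longrightarrow> (c *\<^sub>C x, c *\<^sub>C w) \<in> N"
    and iso: "\<And>x w. (x, w) \<in> N \<Longrightarrow> norm w = norm x"
  shows "\<exists>V\<in>bop. \<forall>(x, w)\<in>N. blinfun_apply V x = w"
proof -
  define S where "S = closure (fst ` N)"
  have Nadd: "x + y \<in> fst ` N" if xy: "x \<in> fst ` N" "y \<in> fst ` N" for x y
  proof -
    obtain w w' where "(x, w) \<in> N" "(y, w') \<in> N" using xy by auto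
    from imageI[OF add[OF this], of fst] show ?thesis by simp
  qed
  have Nscale: "c *\<^sub>C x \<in> fst ` N" if x: "x \<in> fst ` N" for c x
  proof -
    obtain w where "(x, w) \<in> N" using x by auto
    from imageI[OF scale[OF this], of fst] show ?thesis by simp
  qed
  note sub = closure_subspace[of "fst ` N", OF Nadd Nscale, folded S_def]
  have "\<exists>y\<in>S. norm y \<le> norm z \<and> (\<forall>(x, w)\<in>N. cinner x y = cinner w z)" for z
  proof -
    define M where "M = (\<lambda>(x, w). (x, cinner w z)) ` N"
    have "\<exists>y \<in> closure (fst ` M). norm y \<le> norm z \<and> (\<forall>(x, b) \<in> M. cinner x y = b)"
    proof (rule riesz_graph)
      show "(0, 0) \<in> M" using zero by (force simp: M_def)
    next
      fix x b x' b' assume "(x, b) \<in> M" "(x', b') \<in> M"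
      then obtain w w' where w: "(x, w) \<in> N" "b = cinner w z" "(x', w') \<in> N" "b' = cinner w' z"
        by (auto simp: M_def)
      then show "(x + x', b + b') \<in> M"
        using imageI[OF add[OF w(1,3)], of "\<lambda>(x, w). (x, cinner w z)"] by (simp add: M_def cinner_simps)
    next
      fix c x b assume "(x, b) \<in> M"
      then obtain w where w: "(x, w) \<in> N" "b = cinner w z" by (auto simp: M_def)
      then show "(c *\<^sub>C x, c * b) \<in> M"
        using imageI[OF scale[OF w(1), of c], of "\<lambda>(x, w). (x, cinner w z)"] by (simp add: M_def cinner_simps)
    next
      fix x b assume "(x, b) \<in> M"
      then obtain w where w: "(x, w) \<in> N" "b = cinner w z" by (auto simp: M_def)
      then show "cmod b \<le> norm z * norm x"
        using cmod_cinner_le[of w z] iso[OF w(1)] by (simp add: mult.commute)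
    qed simp
    moreover have "fst ` M = fst ` N" by (force simp: M_def)
    ultimately show ?thesis by (force simp: S_def M_def)
  qed
  then have "\<forall>z. \<exists>y. y \<in> S \<and> norm y \<le> norm z \<and> (\<forall>(x, w)\<in>N. cinner x y = cinner w z)" by blast
  from choice[OF this] obtain f where f: "\<And>z. f z \<in> S" "\<And>z. norm (f z) \<le> norm z"
    "\<And>z x w. (x, w) \<in> N \<Longrightarrow> cinner x (f z) = cinner w z"
    by blast
  have uniq: "y = y'" if "y \<in> S" "y' \<in> S" "\<And>x w. (x, w) \<in> N \<Longrightarrow> cinner x y = cinner x y'" for y y'
  proof -
    have "y + (-1) *\<^sub>C y' \<in> S" by (intro sub that)
    then have "y - y' \<in> closure (fst ` N)" by (simp add: scaleC_minus_one S_def)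
    then have "cinner (y - y') (y - y') = 0"
      by (rule closure_coord_0) (use that(3) in \<open>auto simp: cinner_simps\<close>)
    then show ?thesis by (simp add: cinner_eq_zero_iff)
  qed
  have "\<exists>T\<in>bop. \<forall>z. blinfun_apply T z = f z"
  proof (rule bopI)
    show "f (x + y) = f x + f y" for x y
      by (rule uniq) (auto intro!: sub f(1) simp: f(3) cinner_simps)
    show "f (c *\<^sub>C x) = c *\<^sub>C f x" for c x
      by (rule uniq) (auto intro!: sub f(1) simp: f(3) cinner_simps)
    show "norm (f x) \<le> 1 * norm x" for x using f(2) by simp
  qed
  then obtain T where T: "T \<in> bop" "\<And>z. blinfun_apply T z = f z" by blast
  have "blinfun_apply (cadj T) x = w" if "(x, w) \<in> N" for x w
    by (rule cinner_ext) (simp add: cinner_cadj'[OF T(1)] T(2) f(3)[OF that])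
  then show ?thesis using cadj_in_bop[OF T(1)] by blast
qed


section \<open>Dilations from positive multi-Toeplitz kernels\<close>

lemma word_op_bop: "(\<And>i. X i \<in> bop) \<Longrightarrow> word_op X \<alpha> \<in> bop"
  by (induction \<alpha>) (simp_all add: bop_def)

lemma word_op_append: "blinfun_apply (word_op X (\<alpha> @ \<beta>)) x = blinfun_apply (word_op X \<alpha>) (blinfun_apply
    (word_op X \<beta>) x)"
  by (induction \<alpha>) simp_all

text \<open>What the compression of \<open>V\<^sub>\<gamma>\<close> to H has to be: the dilation
  equation fixes it as \<open>T\<^sub>\<gamma>\<close> / \<sigma> for nonempty words, while the
  empty word always compresses to the identity.\<close>

definition dil_coeff :: "real \<Rightarrow> ('n \<Rightarrow> 'h::complex_hilbert \<Rightarrow>\<^sub>L 'h) \<Rightarrow> 'n list \<Rightarrow> 'h \<Rightarrow>\<^sub>L 'h" where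
  "dil_coeff \<sigma> T \<gamma> = (if \<gamma> = [] then id_blinfun else (1 / \<sigma>) *\<^sub>R word_op T \<gamma>)"

text \<open>
  The value \<open>cinner (V\<^sub>\<alpha> h) (V\<^sub>\<beta> h')\<close> that a dilation of \<open>T\<close> must have.
\<close>

definition toeplitz_kernel ::
    "real \<Rightarrow> ('n \<Rightarrow> 'h::complex_hilbert \<Rightarrow>\<^sub>L 'h) \<Rightarrow> 'n list \<times> 'h \<Rightarrow> 'n list \<times> 'h \<Rightarrow> complex" where
  "toeplitz_kernel \<sigma> T = (\<lambda>(\<alpha>, h) (\<beta>, h').
     if take (length \<beta>) \<alpha> = \<beta> then cinner (dil_coeff \<sigma> T (drop (length \<beta>) \<alpha>) h) h'
     else if take (length \<alpha>) \<beta> = \<alpha> then cinner h (dil_coeff \<sigma> T (drop (length \<alpha>) \<beta>) h')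
     else 0)"

text \<open>Throughout, the equation \<open>take (length \<beta>) \<alpha> = \<beta>\<close> encodes
  that \<beta> is a prefix of \<alpha>.\<close>

lemma take_eq_antisym: "take (length \<beta>) \<alpha> = \<beta> \<Longrightarrow> take (length \<alpha>) \<beta> = \<alpha> \<Longrightarrow> \<alpha> = \<beta>"
  by (metis linear take_all)

lemma toeplitz_kernel_herm:
  "toeplitz_kernel \<sigma> T q p = cnj (toeplitz_kernel \<sigma> T p q)"
proof -
  obtain \<alpha> h \<beta> h' where pq: "p = (\<alpha>, h)" "q = (\<beta>, h')" by (metis surj_pair)
  have C: "cinner x y = cnj (cinner y x)" for x y :: 'b by (rule cinner_commute)
  show ?thesis
  proof (cases "\<alpha> = \<beta>")
    case True
    then show ?thesis unfolding pq toeplitz_kernel_def dil_coeff_def by simp (rule C)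
  next
    case False
    then have "\<not> (take (length \<beta>) \<alpha> = \<beta> \<and> take (length \<alpha>) \<beta> = \<alpha>)" using take_eq_antisym by blast
    then show ?thesis
      using C[of "blinfun_apply (dil_coeff \<sigma> T (drop (length \<beta>) \<alpha>)) h" h']
        C[of h "blinfun_apply (dil_coeff \<sigma> T (drop (length \<alpha>) \<beta>)) h'"]
      by (auto simp: pq toeplitz_kernel_def)
  qed
qed

text \<open>The realising vector v (\<alpha>, h) plays the part of
  \<open>V\<^sub>\<alpha> h\<close>. Prefixing one letter to all words preserves the kernel, which
  makes the shifts isometric, and words with different first letters are orthogonal. The kernel is
  indexed by pairs of a word and a vector, so the realisation lands in exactly the space over which
  \<open>class_C\<close> quantifies.\<close>

lemma class_C_if_psd_kernel:
  fixes T :: "'m::finite \<Rightarrow> 'h::complex_hilbert \<Rightarrow>\<^sub>L 'h"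
  assumes T: "\<And>i. T i \<in> bop" and \<sigma>: "\<sigma> > 0" and psd: "psd_kernel (toeplitz_kernel \<sigma> T)"
  shows "T \<in> class_C \<sigma>"
proof -
  obtain v :: "'m list \<times> 'h \<Rightarrow> ('m list \<times> 'h, complex) l2"
    where v: "\<And>p q. cinner (v p) (v q) = toeplitz_kernel \<sigma> T p q"
    using psd_kernel_realisation[OF psd] by blast
  define S where "S = {\<Sum>p\<in>F. c p *\<^sub>C v p | F c. finite F}"
  have SI: "(\<Sum>p\<in>F. c p *\<^sub>C v p) \<in> S" if "finite F" for F c unfolding S_def using that by blast
  have SE: "\<exists>F c. finite F \<and> x = (\<Sum>p\<in>F. c p *\<^sub>C v p)" if "x \<in> S" for x
    using that unfolding S_def by blast
  have vS: "v p \<in> S" for p using SI[of "{p}" "\<lambda>_. 1"] by simp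
  have Sadd: "x + y \<in> S" if "x \<in> S" "y \<in> S" for x y
    using SE[OF that(1)] SE[OF that(2)] by (auto simp: scaleC_combination_add intro!: SI)
  have Sscale: "c *\<^sub>C x \<in> S" if "x \<in> S" for c x
    using SE[OF that] by (auto simp: scaleC_combination_scale intro!: SI)
  define G where "G = closure S"
  note Gsub = closure_subspace[of S, OF Sadd Sscale, folded G_def]
  have SG: "S \<subseteq> G" by (simp add: G_def closure_subset)
  have "0 \<in> G" using SG SI[of "{}"] by auto

  have v0: "cinner (v ([], h)) (v ([], h')) = cinner h h'" for h h'
    by (simp add: v toeplitz_kernel_def dil_coeff_def)
  \<comment> \<open>The realisation is not linear in h by construction; the kernel shows that each
    defect of linearity has norm 0.\<close>
  have "\<exists>J\<in>bop. \<forall>h. blinfun_apply J h = v ([], h)"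
  proof (rule bopI)
    fix h h'
    let ?x = "v ([], h + h') - (v ([], h) + v ([], h'))"
    have "cinner ?x ?x = 0" by (simp add: cinner_simps v0)
    then show "v ([], h + h') = v ([], h) + v ([], h')" by (simp only: cinner_eq_zero_iff right_minus_eq)
  next
    fix c h
    let ?x = "v ([], c *\<^sub>C h) - c *\<^sub>C v ([], h)"
    have "cinner ?x ?x = 0" by (simp add: cinner_simps v0)
    then show "v ([], c *\<^sub>C h) = c *\<^sub>C v ([], h)" by (simp only: cinner_eq_zero_iff right_minus_eq)
  next
    fix h
    show "norm (v ([], h)) \<le> 1 * norm h" using norm_eq_if_cinner_eq[OF v0[of h h]] by simp
  qed
  then obtain J where J: "J \<in> bop" "\<And>h. blinfun_apply J h = v ([], h)" by blast
  have normJ: "norm (blinfun_apply J h) = norm h" for h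
    unfolding J(2) by (rule norm_eq_if_cinner_eq[OF v0])

  have shift: "cinner (v (i # \<alpha>, h)) (v (i # \<beta>, h')) = cinner (v (\<alpha>, h)) (v (\<beta>, h'))" for i \<alpha> h \<beta> h'
    by (simp add: v toeplitz_kernel_def)
  have orth: "cinner (v (i # \<alpha>, h)) (v (j # \<beta>, h')) = 0" if "i \<noteq> j" for i j \<alpha> h \<beta> h'
    using that by (simp add: v toeplitz_kernel_def)
  define sh where "sh = (\<lambda>i p. v (i # fst p, snd p))"
  have "\<exists>V\<in>bop. \<forall>p. blinfun_apply V (v p) = sh i p" for i
  proof -
    \<comment> \<open>A relation rather than a map, since the v p may be linearly dependent;
      \<open>shift\<close> makes it norm-preserving and thereby single-valued.\<close>
    define N where "N = {(\<Sum>p\<in>F. c p *\<^sub>C v p, \<Sum>p\<in>F. c p *\<^sub>C sh i p) | F c. finite F}"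
    have NI: "(\<Sum>p\<in>F. c p *\<^sub>C v p, \<Sum>p\<in>F. c p *\<^sub>C sh i p) \<in> N" if "finite F" for F c
      unfolding N_def using that by blast
    have NE: "\<exists>F c. finite F \<and> x = (\<Sum>p\<in>F. c p *\<^sub>C v p) \<and> w = (\<Sum>p\<in>F. c p *\<^sub>C sh i p)" if "(x, w) \<in> N" for x w
      using that unfolding N_def by blast
    have "\<exists>V\<in>bop. \<forall>(x, w)\<in>N. blinfun_apply V x = w"
    proof (rule isometry_extension)
      show "(0, 0) \<in> N" using NI[of "{}"] by simp
      show "(x + x', w + w') \<in> N" if "(x, w) \<in> N" "(x', w') \<in> N" for x w x' w'
        using NE[OF that(1)] NE[OF that(2)] by (auto simp: scaleC_combination_add intro!: NI)
      show "(c *\<^sub>C x, c *\<^sub>C w) \<in> N" if "(x, w) \<in> N" for c x w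
        using NE[OF that] by (auto simp: scaleC_combination_scale intro!: NI)
      show "norm w = norm x" if xw: "(x, w) \<in> N" for x w
      proof -
        obtain F c where x: "x = (\<Sum>p\<in>F. c p *\<^sub>C v p)" and w: "w = (\<Sum>p\<in>F. c p *\<^sub>C sh i p)"
          using NE[OF xw] by blast
        show ?thesis
          unfolding x w by (rule norm_eq_if_cinner_eq, unfold cinner_double_sum)
            (intro sum.cong refl, simp add: sh_def shift)
      qed
    qed
    then obtain V where V: "V \<in> bop" "\<And>x w. (x, w) \<in> N \<Longrightarrow> blinfun_apply V x = w" by fast
    have "blinfun_apply V (v p) = sh i p" for p
      by (rule V(2)) (use NI[of "{p}" "\<lambda>_. 1"] in simp)
    with V(1) show ?thesis by blast
  qed
  then have "\<forall>i. \<exists>V. V \<in> bop \<and> (\<forall>p. blinfun_apply V (v p) = sh i p)" by blast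
  from choice[OF this] obtain V where V: "\<And>i. V i \<in> bop" "\<And>i p. blinfun_apply (V i) (v p) = sh i p"
    by blast
  have Vcomb: "blinfun_apply (V i) (\<Sum>p\<in>F. c p *\<^sub>C v p) = (\<Sum>p\<in>F. c p *\<^sub>C sh i p)" for i F c
    by (simp add: blinfun.sum_right bopD[OF V(1)] V(2))
  have VS: "blinfun_apply (V i) x \<in> S" if "x \<in> S" for i x
  proof -
    obtain F c where F: "finite F" "x = (\<Sum>p\<in>F. c p *\<^sub>C v p)" using SE[OF \<open>x \<in> S\<close>] by blast
    have "(\<Sum>p\<in>A. c p *\<^sub>C sh i p) \<in> S" if "finite A" for A
      using that by (induction A) (use SI[of "{}"] in \<open>auto intro!: Sadd Sscale vS simp: sh_def\<close>)
    with F show ?thesis by (simp add: Vcomb)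
  qed
  have VG: "blinfun_apply (V i) ` G \<subseteq> G" for i
    unfolding G_def using VS closure_subset[of S]
    by (intro image_closure_subset linear_continuous_on blinfun.bounded_linear_right) auto
  have Viso: "norm (blinfun_apply (V i) x) = norm x" if "x \<in> G" for i x
  proof -
    have "closed {x. norm (blinfun_apply (V i) x) = norm x}"
      by (intro closed_Collect_eq continuous_intros linear_continuous_on blinfun.bounded_linear_right)
    moreover have "S \<subseteq> {x. norm (blinfun_apply (V i) x) = norm x}"
    proof
      fix x assume "x \<in> S"
      then obtain F c where F: "finite F" and x: "x = (\<Sum>p\<in>F. c p *\<^sub>C v p)" using SE by blast
      have "cinner (blinfun_apply (V i) x) (blinfun_apply (V i) x) = cinner x x"
        unfolding x Vcomb cinner_double_sum by (intro sum.cong refl) (simp add: sh_def shift)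
      then show "x \<in> {x. norm (blinfun_apply (V i) x) = norm x}"
        by (intro CollectI norm_eq_if_cinner_eq)
    qed
    ultimately show ?thesis using closure_minimal that unfolding G_def by blast
  qed
  have Vorth: "cinner (blinfun_apply (V i) x) (blinfun_apply (V j) y) = 0"
    if ij: "i \<noteq> j" and x: "x \<in> G" and y: "y \<in> G" for i j x y
  proof -
    have S0: "cinner (blinfun_apply (V i) x) (blinfun_apply (V j) y) = 0" if xS: "x \<in> S" and yS: "y \<in> S" for x y
    proof -
      obtain F c where x: "x = (\<Sum>p\<in>F. c p *\<^sub>C v p)" using SE[OF xS] by blast
      obtain F' c' where y: "y = (\<Sum>p\<in>F'. c' p *\<^sub>C v p)" using SE[OF yS] by blast
      show ?thesis unfolding x y Vcomb cinner_double_sum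
        by (intro sum.neutral ballI) (simp add: sh_def orth[OF ij])
    qed
    \<comment> \<open>Orthogonality passes to the closure in one argument at a time: the adjoint
      moves the operator away from the argument being varied.\<close>
    have G0: "cinner (blinfun_apply (V i) x) (blinfun_apply (V j) y) = 0" if yS: "y \<in> S" for y
    proof -
      have "cinner x (blinfun_apply (cadj (V i)) (blinfun_apply (V j) y)) = 0"
        by (rule closure_coord_0[OF x[unfolded G_def]]) (simp add: cinner_cadj[OF V(1), symmetric] S0 yS)
      then show ?thesis by (simp add: cinner_cadj[OF V(1)])
    qed
    have "cinner y (blinfun_apply (cadj (V j)) (blinfun_apply (V i) x)) = 0"
    proof (rule closure_coord_0[OF y[unfolded G_def]])
      fix z assume "z \<in> S"
      from G0[OF this] show "cinner z (blinfun_apply (cadj (V j)) (blinfun_apply (V i) x)) = 0"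
        using cinner_commute[of "blinfun_apply (V j) z" "blinfun_apply (V i) x"]
        by (simp add: cinner_cadj[OF V(1), symmetric])
    qed
    then show ?thesis
      using cinner_commute[of "blinfun_apply (V i) x" "blinfun_apply (V j) y"]
      by (simp add: cinner_cadj[OF V(1), symmetric])
  qed
  have Vword: "blinfun_apply (word_op V \<alpha>) (v ([], h)) = v (\<alpha>, h)" for \<alpha> h
    by (induction \<alpha>) (simp_all add: V(2) sh_def)
  have dil: "word_op T \<alpha> = \<sigma> *\<^sub>R (cadj J o\<^sub>L word_op V \<alpha> o\<^sub>L J)" if "\<alpha> \<noteq> []" for \<alpha>
  proof (rule blinfun_eqI, rule cinner_ext)
    fix h h'
    show "cinner (blinfun_apply (word_op T \<alpha>) h) h' = cinner (blinfun_apply (\<sigma> *\<^sub>R (cadj J o\<^sub>L word_op V \<alpha>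
        o\<^sub>L J)) h) h'"
      using \<sigma> that
      by (simp add: blinfun.scaleR_left cinner.scaleR_left cinner_cadj'[OF J(1)] J(2) Vword v
          toeplitz_kernel_def dil_coeff_def)
  qed
  show ?thesis
    unfolding class_C_def
  proof (intro CollectI conjI allI exI[of _ G] exI[of _ J] exI[of _ V] ballI impI)
    show "range (blinfun_apply J) \<subseteq> G" using J(2) vS SG by auto
    show "closed G" by (simp add: G_def)
    show "word_op T \<alpha> = \<sigma> *\<^sub>R (cadj J o\<^sub>L word_op V \<alpha> o\<^sub>L J)" if "\<alpha> \<noteq> []" for \<alpha> by (rule dil[OF that])
    show "cinner (blinfun_apply (V i) x) (blinfun_apply (V j) y) = 0" if "i \<noteq> j" "x \<in> G" "y \<in> G" for i j x y
      by (rule Vorth[OF that])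
  qed (fact T \<open>0 \<in> G\<close> J(1) normJ V(1) VG | rule Gsub Viso; assumption)+
qed


section \<open>Quadratic forms of noncommutative polynomials\<close>

text \<open>The quadratic form <p(X)x, x> on k copies of the space. All operator inequalities are
  reduced to inequalities between real parts of such forms.\<close>

definition pform ::
    "nat \<Rightarrow> ('n list \<Rightarrow> nat \<Rightarrow> nat \<Rightarrow> complex) \<Rightarrow> ('n \<Rightarrow> 'a::complex_hilbert \<Rightarrow>\<^sub>L 'a) \<Rightarrow> (nat \<Rightarrow> 'a) \<Rightarrow> complex" where
  "pform k M X x = (\<Sum>s<k. \<Sum>t<k. \<Sum>\<alpha>\<in>poly_supp k M. M \<alpha> s t * cinner (word_op X \<alpha> (x t)) (x s))"

definition opform :: "nat \<Rightarrow> 'a::complex_hilbert opmat \<Rightarrow> (nat \<Rightarrow> 'a) \<Rightarrow> complex" where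
  "opform k P x = (\<Sum>s<k. cinner (\<Sum>t<k. P s t (x t)) (x s))"

lemma opform_add: "opform k (\<lambda>s t. P s t + Q s t) x = opform k P x + opform k Q x"
  by (simp add: opform_def blinfun.add_left sum.distrib cinner_simps)

lemma opform_diff: "opform k (\<lambda>s t. P s t - Q s t) x = opform k P x - opform k Q x"
  by (simp add: opform_def blinfun.diff_left sum_subtractf cinner_simps)

lemma opform_scaleR: "opform k (\<lambda>s t. r *\<^sub>R P s t) x = r *\<^sub>R opform k P x"
  by (simp add: opform_def blinfun.scaleR_left scaleR_sum_right[symmetric] cinner.scaleR_left)

lemma opform_poly_eval: "opform k (poly_eval k M X) x = pform k M X x"
  unfolding opform_def pform_def poly_eval_def blinfun.sum_left cinner.sum_left
  by (simp add: scaleC_blinfun.rep_eq cinner_scaleC_left)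

lemma bop_sum: "(\<And>i. i \<in> A \<Longrightarrow> f i \<in> bop) \<Longrightarrow> sum f A \<in> bop"
  by (simp add: bop_def blinfun.sum_left scaleC_sum_right)

lemma bop_scaleC: "T \<in> bop \<Longrightarrow> c *\<^sub>C T \<in> bop"
  by (simp add: bop_def scaleC_blinfun.rep_eq scaleC_scaleC mult.commute)

lemma bop_scaleR: "T \<in> bop \<Longrightarrow> r *\<^sub>R T \<in> bop"
  unfolding bop_def mem_Collect_eq blinfun.scaleR_left
  by (simp add: scaleR_scaleC scaleC_scaleC mult.commute)

lemma bop_compose: "S \<in> bop \<Longrightarrow> T \<in> bop \<Longrightarrow> S o\<^sub>L T \<in> bop"
  by (simp add: bop_def)

lemma bop_0: "0 \<in> bop"
  by (simp add: bop_def)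

lemma bop_id: "id_blinfun \<in> bop"
  by (simp add: bop_def)

lemma poly_eval_bop: "(\<And>i. X i \<in> bop) \<Longrightarrow> poly_eval k M X s t \<in> bop"
  by (simp add: poly_eval_def bop_sum bop_scaleC word_op_bop)

lemma opform_Re:
  assumes "\<And>s t. P s t \<in> bop"
  shows "opform k (opmat_Re P) x = complex_of_real (Re (opform k P x))"
proof -
  have "opform k (\<lambda>s t. cadj (P t s)) x = (\<Sum>s<k. \<Sum>t<k. cinner (x t) (P t s (x s)))"
    by (simp add: opform_def cinner.sum_left cinner_cadj'[OF assms])
  also have "\<dots> = cnj (opform k P x)"
    unfolding opform_def cinner.sum_left cnj_sum
    by (subst sum.swap) (intro sum.cong refl cinner_commute)
  finally have "opform k (opmat_Re P) x = (1 / 2) *\<^sub>R (cnj (opform k P x) + opform k P x)"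
    by (simp only: opmat_Re_def opform_scaleR opform_add)
  then show ?thesis by (simp add: complex_eq_iff)
qed

lemma opmat_nonneg_iff:
  assumes "\<And>i. X i \<in> bop"
  shows "opmat_nonneg k (opmat_Re (poly_eval k M X)) \<longleftrightarrow> (\<forall>x. 0 \<le> Re (pform k M X x))"
proof -
  have "(\<Sum>s<k. cinner (\<Sum>t<k. opmat_Re (poly_eval k M X) s t (x t)) (x s))
      = complex_of_real (Re (pform k M X x))" for x
    unfolding opform_def[symmetric] opform_Re[OF poly_eval_bop[OF assms]] opform_poly_eval ..
  then show ?thesis by (simp add: opmat_nonneg_def)
qed

lemma Re_nonneg_on_ball_iff:
  "Re_nonneg_on_ball TYPE('k::complex_hilbert) k M \<longleftrightarrow>
     (\<forall>X \<in> (op_ball :: ('n::finite \<Rightarrow> 'k \<Rightarrow>\<^sub>L 'k) set). \<forall>x. 0 \<le> Re (pform k M X x))"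
  unfolding Re_nonneg_on_ball_def by (intro ball_cong refl opmat_nonneg_iff) (simp add: op_ball_def)

lemma opform_harnack:
  assumes "\<And>i. A i \<in> bop"
  shows "opform k (harnack_form \<rho> k M A) x
    = complex_of_real (Re (pform k M A x) + (\<rho> - 1) * Re (pform k M (\<lambda>_. 0) x))"
  unfolding harnack_form_def opform_add opform_scaleR
    opform_Re[OF poly_eval_bop[OF assms]] opform_Re[OF poly_eval_bop[OF bop_0]] opform_poly_eval
  by (simp add: scaleR_conv_of_real)

lemma harnack_le_iff:
  assumes "\<And>i. A i \<in> bop" "\<And>i. B i \<in> bop"
  shows "opmat_le k (harnack_form \<rho> k M A) (\<lambda>s t. c *\<^sub>R harnack_form \<rho> k M B s t) \<longleftrightarrow>
    (\<forall>x. Re (pform k M A x) + (\<rho> - 1) * Re (pform k M (\<lambda>_. 0) x)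
      \<le> c * (Re (pform k M B x) + (\<rho> - 1) * Re (pform k M (\<lambda>_. 0) x)))"
proof -
  have "opform k (\<lambda>s t. c *\<^sub>R harnack_form \<rho> k M B s t - harnack_form \<rho> k M A s t) x
    = complex_of_real (c * (Re (pform k M B x) + (\<rho> - 1) * Re (pform k M (\<lambda>_. 0) x))
      - (Re (pform k M A x) + (\<rho> - 1) * Re (pform k M (\<lambda>_. 0) x)))" for x
    unfolding opform_diff opform_scaleR opform_harnack[OF assms(1)] opform_harnack[OF assms(2)]
    by (simp add: scaleR_conv_of_real)
  then show ?thesis
    unfolding opmat_le_def opmat_nonneg_def opform_def[symmetric]
    by (simp only: nonneg_Reals_of_real_iff) simp
qed


lemma eventually_at_left_1: "\<forall>\<^sub>F r :: real in at_left 1. 0 \<le> r \<and> r < 1"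
  by (rule eventually_at_leftI[of 0]) auto

lemma nonneg_at_left_1:
  fixes F :: "real \<Rightarrow> real"
  assumes "(F \<longlongrightarrow> L) (at_left 1)" "\<And>r. 0 \<le> r \<Longrightarrow> r < 1 \<Longrightarrow> 0 \<le> F r"
  shows "0 \<le> L"
  using assms(1)
  by (rule tendsto_lowerbound) (use assms(2) in \<open>auto intro: eventually_mono[OF eventually_at_left_1]\<close>)


section \<open>Row contractions\<close>

text \<open>The closed unit ball of row operators, stated through vectors. The closed ball matters
  because creation operators, dilations and the values of a contractive f lie in it, but possibly
  outside the open ball.\<close>

definition row_contr :: "('n::finite \<Rightarrow> 'a::complex_hilbert \<Rightarrow>\<^sub>L 'a) \<Rightarrow> bool" where
  "row_contr X \<longleftrightarrow> (\<forall>u. (norm (\<Sum>i\<in>UNIV. X i (u i)))\<^sup>2 \<le> (\<Sum>i\<in>UNIV. (norm (u i))\<^sup>2))"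

lemma row_contrD:
  "row_contr X \<Longrightarrow> (norm (\<Sum>i\<in>UNIV. X i (u i)))\<^sup>2 \<le> (\<Sum>i\<in>UNIV. (norm (u i))\<^sup>2)"
  unfolding row_contr_def by (rule spec[where x = u])

lemma finite_words: "finite {\<alpha> :: 'n::finite list. length \<alpha> \<le> N}"
  using finite_lists_length_le[of "UNIV :: 'n set" N] by simp

lemma finite_words_eq [simp]: "finite {\<alpha> :: 'n::finite list. length \<alpha> = N}"
  by (rule finite_subset[OF _ finite_words[of N]]) auto

lemma cmod_sum_cinner_le:
  fixes x y :: "'i \<Rightarrow> 'a::complex_hilbert"
  shows "cmod (\<Sum>i\<in>A. cinner (x i) (y i)) \<le> sqrt (\<Sum>i\<in>A. (norm (x i))\<^sup>2) * sqrt (\<Sum>i\<in>A. (norm (y i))\<^sup>2)"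
proof -
  have "cmod (\<Sum>i\<in>A. cinner (x i) (y i)) \<le> (\<Sum>i\<in>A. norm (x i) * norm (y i))"
    by (rule sum_norm_le) (rule cmod_cinner_le)
  also have "\<dots> \<le> L2_set (\<lambda>i. norm (x i)) A * L2_set (\<lambda>i. norm (y i)) A"
    using L2_set_mult_ineq[of "\<lambda>i. norm (x i)" "\<lambda>i. norm (y i)" A] by simp
  finally show ?thesis by (simp add: L2_set_def)
qed

text \<open>A row and its column of adjoints have the same norm: pair the vector y = \<Sum>
  \<open>X\<^sub>i u\<^sub>i\<close> with itself and apply Cauchy-Schwarz in the direct sum.\<close>

lemma row_contr_adjI:
  assumes X: "\<And>i. X i \<in> bop" and le: "\<And>y. (\<Sum>i\<in>UNIV. (norm (cadj (X i) y))\<^sup>2) \<le> (norm y)\<^sup>2"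
  shows "row_contr (X :: 'n::finite \<Rightarrow> 'a::complex_hilbert \<Rightarrow>\<^sub>L 'a)"
  unfolding row_contr_def
proof
  fix u :: "'n \<Rightarrow> 'a"
  define y where "y = (\<Sum>i\<in>UNIV. X i (u i))"
  define q where "q = (\<Sum>i\<in>UNIV. (norm (u i))\<^sup>2)"
  have "cinner y y = (\<Sum>i\<in>UNIV. cinner (u i) (cadj (X i) y))"
    unfolding y_def cinner.sum_left by (simp add: cinner_cadj[OF X])
  then have "(norm y)\<^sup>2 = cmod (\<Sum>i\<in>UNIV. cinner (u i) (cadj (X i) y))"
    by (metis cinner_self norm_of_real abs_power2)
  also have "\<dots> \<le> sqrt q * sqrt (\<Sum>i\<in>UNIV. (norm (cadj (X i) y))\<^sup>2)"
    unfolding q_def by (rule cmod_sum_cinner_le)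
  also have "\<dots> \<le> sqrt q * norm y"
    using real_sqrt_le_mono[OF le[of y]] by (intro mult_left_mono) (auto simp: q_def sum_nonneg)
  finally have "norm y \<le> sqrt q"
    by (cases "y = 0") (auto simp: power2_eq_square q_def sum_nonneg)
  then have "(norm y)\<^sup>2 \<le> (sqrt q)\<^sup>2" by (intro power_mono) auto
  then show "(norm (\<Sum>i\<in>UNIV. X i (u i)))\<^sup>2 \<le> (\<Sum>i\<in>UNIV. (norm (u i))\<^sup>2)"
    by (simp add: y_def q_def sum_nonneg)
qed

lemma cinner_row_adj:
  assumes X: "\<And>i. X i \<in> bop"
  shows "cinner ((\<Sum>i\<in>UNIV. X i o\<^sub>L cadj (X i)) y) y = complex_of_real (\<Sum>i\<in>UNIV. (norm (cadj (X i) y))\<^sup>2)"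
  by (simp add: blinfun.sum_left cinner.sum_left cinner_cadj[OF X] cinner_self)

lemma row_contr_adjD:
  assumes X: "\<And>i. X i \<in> bop" and "row_contr X"
  shows "(\<Sum>i\<in>UNIV. (norm (cadj (X i) y))\<^sup>2) \<le> (norm y)\<^sup>2"
proof -
  define q where "q = (\<Sum>i\<in>UNIV. (norm (cadj (X i) y))\<^sup>2)"
  define z where "z = (\<Sum>i\<in>UNIV. X i (cadj (X i) y))"
  have z: "(norm z)\<^sup>2 \<le> q" unfolding z_def q_def by (rule row_contrD[OF assms(2)])
  have "cinner z y = complex_of_real q"
    using cinner_row_adj[OF X, where y = y] by (simp only: z_def q_def blinfun.sum_left
        blinfun_apply_blinfun_compose)
  then have "q = cmod (cinner z y)" by (simp only: norm_of_real) (simp add: q_def sum_nonneg)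
  also have "\<dots> \<le> norm z * norm y" by (rule cmod_cinner_le)
  finally have "q\<^sup>2 \<le> (norm z)\<^sup>2 * (norm y)\<^sup>2"
    unfolding power_mult_distrib[symmetric] by (intro power_mono) (auto simp: q_def sum_nonneg)
  also have "\<dots> \<le> q * (norm y)\<^sup>2" using z by (intro mult_right_mono) auto
  finally show ?thesis unfolding q_def[symmetric]
    using sum_nonneg[of UNIV "\<lambda>i. (norm (cadj (X i) y))\<^sup>2"]
    by (cases "q = 0") (auto simp: power2_eq_square[of q] q_def[symmetric])
qed

lemma op_ball_row_contr:
  assumes "X \<in> op_ball"
  shows "row_contr X"
proof (rule row_contr_adjI)
  show X: "\<And>i. X i \<in> bop" using assms by (simp add: op_ball_def)
  fix y
  let ?S = "\<Sum>i\<in>UNIV. X i o\<^sub>L cadj (X i)"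
  have "(\<Sum>i\<in>UNIV. (norm (cadj (X i) y))\<^sup>2) = cmod (cinner (?S y) y)"
    unfolding cinner_row_adj[OF X] norm_of_real by (simp add: sum_nonneg)
  also have "\<dots> \<le> norm (?S y) * norm y" by (rule cmod_cinner_le)
  also have "\<dots> \<le> (1 * norm y) * norm y"
  proof (intro mult_right_mono)
    have "norm (?S y) \<le> norm ?S * norm y" by (rule norm_blinfun)
    also have "\<dots> \<le> 1 * norm y" using assms by (intro mult_right_mono) (auto simp: op_ball_def)
    finally show "norm (?S y) \<le> 1 * norm y" .
  qed simp
  finally show "(\<Sum>i\<in>UNIV. (norm (cadj (X i) y))\<^sup>2) \<le> (norm y)\<^sup>2" by (simp add: power2_eq_square)
qed

lemma cadj_scaleR: "T \<in> bop \<Longrightarrow> cadj (r *\<^sub>R T) = r *\<^sub>R cadj T"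
  by (rule cadj_eqI) (simp add: blinfun.scaleR_left cinner.scaleR_left cinner.scaleR_right cinner_cadj)

text \<open>Scaling moves a tuple of the closed ball into the open one, where positivity is assumed;
  letting s tend to 1 afterwards recovers the tuple.\<close>

lemma scaled_row_contr_op_ball:
  assumes Y: "\<And>i. Y i \<in> bop" "row_contr Y" and s: "0 \<le> s" "s < 1"
  shows "(\<lambda>i. s *\<^sub>R Y i) \<in> op_ball"
proof -
  let ?S = "\<Sum>i\<in>UNIV. Y i o\<^sub>L cadj (Y i)"
  have "norm ?S \<le> 1"
  proof (rule norm_blinfun_bound)
    fix y
    have "(norm (?S y))\<^sup>2 \<le> (\<Sum>i\<in>UNIV. (norm (cadj (Y i) y))\<^sup>2)"
      using Y(2)[unfolded row_contr_def, rule_format, of "\<lambda>i. cadj (Y i) y"] by (simp add: blinfun.sum_left)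
    also have "\<dots> \<le> (norm y)\<^sup>2" by (rule row_contr_adjD[OF Y])
    finally show "norm (?S y) \<le> 1 * norm y" by (simp add: power2_le_iff_abs_le)
  qed simp
  moreover have "(\<Sum>i\<in>UNIV. (s *\<^sub>R Y i) o\<^sub>L cadj (s *\<^sub>R Y i)) = (s * s) *\<^sub>R ?S"
    by (rule blinfun_eqI)
      (simp add: blinfun.sum_left blinfun.scaleR_left blinfun.scaleR_right cadj_scaleR[OF Y(1)]
          scaleR_sum_right)
  moreover have "s * s * norm ?S < 1"
  proof -
    have "s * s * norm ?S \<le> s * 1 * 1" using s \<open>norm ?S \<le> 1\<close> by (intro mult_mono) auto
    then show ?thesis using s by simp
  qed
  ultimately show ?thesis using Y(1) s by (simp add: op_ball_def bop_scaleR)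
qed

text \<open>A word with prefix \<alpha> either equals \<alpha> or has the prefix \<alpha>i for
  exactly one letter i.\<close>

lemma sum_over_prefixes:
  fixes \<beta> :: "'n::finite list" and f :: "'n list \<Rightarrow> 'b::comm_monoid_add"
  shows "(if take (length \<alpha>) \<beta> = \<alpha> then f \<beta> else 0)
    = (if \<beta> = \<alpha> then f \<beta> else 0) + (\<Sum>i\<in>UNIV. if take (Suc (length \<alpha>)) \<beta> = \<alpha> @ [i] then f \<beta> else 0)"
proof (cases "take (length \<alpha>) \<beta> = \<alpha>")
  case True
  then obtain \<gamma> where \<beta>: "\<beta> = \<alpha> @ \<gamma>" by (metis append_take_drop_id)
  show ?thesis
  proof (cases \<gamma>)
    case (Cons j \<delta>)
    have "(\<Sum>i\<in>UNIV. if take (Suc (length \<alpha>)) \<beta> = \<alpha> @ [i] then f \<beta> else 0) = (\<Sum>i\<in>UNIV. if j = i then f \<beta> else 0)"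
      by (intro sum.cong refl) (simp add: \<beta> Cons)
    then show ?thesis by (simp add: \<beta> Cons)
  qed (simp add: \<beta>)
next
  case False
  have "take (Suc (length \<alpha>)) \<beta> \<noteq> \<alpha> @ [i]" for i
  proof
    assume "take (Suc (length \<alpha>)) \<beta> = \<alpha> @ [i]"
    from arg_cong[OF this, of "take (length \<alpha>)"] show False using False by simp
  qed
  then show ?thesis using False by auto
qed

text \<open>
  With \<open>u\<^sub>\<alpha> = \<Sum>\<^sub>\<gamma> Y\<^sub>\<gamma> h\<^sub>\<alpha>\<^sub>\<gamma>\<close> one has \<open>u\<^sub>\<alpha> = h\<^sub>\<alpha> + \<Sum>\<^sub>i Y\<^sub>i u\<^sub>\<alpha>\<^sub>i\<close>, so the form equals
  \<open>\<Sum>\<^sub>\<alpha> (\<parallel>u\<^sub>\<alpha>\<parallel>\<^sup>2 - \<parallel>\<Sum>\<^sub>i Y\<^sub>i u\<^sub>\<alpha>\<^sub>i\<parallel>\<^sup>2)\<close>, which telescopes.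
\<close>

lemma row_contr_toeplitz_nonneg:
  fixes Y :: "'n::finite \<Rightarrow> 'a::complex_hilbert \<Rightarrow>\<^sub>L 'a" and N :: nat
  assumes Y: "row_contr Y"
  defines "W \<equiv> {\<alpha> :: 'n list. length \<alpha> \<le> N}"
  shows "0 \<le> Re (\<Sum>\<alpha>\<in>W. \<Sum>\<beta>\<in>W. if take (length \<alpha>) \<beta> = \<alpha>
    then (if \<alpha> = \<beta> then 1 else 2) * cinner (word_op Y (drop (length \<alpha>) \<beta>) (h \<beta>)) (h \<alpha>) else 0)"
proof -
  have fW: "finite W" unfolding W_def by (rule finite_words)
  define u where "u = (\<lambda>\<alpha>. \<Sum>\<beta>\<in>W. if take (length \<alpha>) \<beta> = \<alpha> then word_op Y (drop (length \<alpha>) \<beta>) (h \<beta>) else 0)"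
  have rec: "u \<alpha> = h \<alpha> + (\<Sum>i\<in>UNIV. Y i (u (\<alpha> @ [i])))" if \<alpha>: "\<alpha> \<in> W" for \<alpha>
  proof -
    have 1: "(if take (Suc (length \<alpha>)) \<beta> = \<alpha> @ [i] then word_op Y (drop (length \<alpha>) \<beta>) (h \<beta>) else 0)
        = Y i (if take (length (\<alpha> @ [i])) \<beta> = \<alpha> @ [i] then word_op Y (drop (length (\<alpha> @ [i])) \<beta>) (h \<beta>)
            else 0)" for \<beta> i
    proof (cases "take (Suc (length \<alpha>)) \<beta> = \<alpha> @ [i]")
      case True
      then obtain \<gamma> where "\<beta> = \<alpha> @ i # \<gamma>" by (metis append_take_drop_id append.assoc append_Cons append_Nil)
      then show ?thesis by simp
    qed (simp add: blinfun.zero_right)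
    have "u \<alpha> = (\<Sum>\<beta>\<in>W. if \<beta> = \<alpha> then word_op Y (drop (length \<alpha>) \<beta>) (h \<beta>) else 0)
        + (\<Sum>\<beta>\<in>W. \<Sum>i\<in>UNIV. if take (Suc (length \<alpha>)) \<beta> = \<alpha> @ [i] then word_op Y (drop (length \<alpha>) \<beta>) (h \<beta>) else 0)"
      unfolding u_def sum.distrib[symmetric]
      by (intro sum.cong refl sum_over_prefixes)
    also have "(\<Sum>\<beta>\<in>W. if \<beta> = \<alpha> then word_op Y (drop (length \<alpha>) \<beta>) (h \<beta>) else 0) = h \<alpha>"
      using \<alpha> fW by simp
    also have "(\<Sum>\<beta>\<in>W. \<Sum>i\<in>UNIV. if take (Suc (length \<alpha>)) \<beta> = \<alpha> @ [i] then word_op Y (drop (length \<alpha>) \<beta>)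
        (h \<beta>) else 0)
        = (\<Sum>i\<in>UNIV. Y i (u (\<alpha> @ [i])))"
      unfolding u_def blinfun.sum_right 1 by (rule sum.swap)
    finally show ?thesis .
  qed
  have u0: "u \<alpha> = 0" if "\<alpha> \<notin> W" for \<alpha>
  proof -
    have "take (length \<alpha>) \<beta> \<noteq> \<alpha>" if "\<beta> \<in> W" for \<beta>
    proof
      assume "take (length \<alpha>) \<beta> = \<alpha>"
      from arg_cong[OF this, of length] show False using that \<open>\<alpha> \<notin> W\<close> by (simp add: W_def)
    qed
    then show ?thesis by (simp add: u_def)
  qed
  \<comment> \<open>The weights 1 and 2 make row \<alpha> equal to 2 <u, h> - <h, h>, whose real
    part is |u|^2 - |u - h|^2.\<close>
  have rowterm: "Re (\<Sum>\<beta>\<in>W. if take (length \<alpha>) \<beta> = \<alpha>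
      then (if \<alpha> = \<beta> then 1 else 2) * cinner (word_op Y (drop (length \<alpha>) \<beta>) (h \<beta>)) (h \<alpha>) else 0)
      = (norm (u \<alpha>))\<^sup>2 - (norm (\<Sum>i\<in>UNIV. Y i (u (\<alpha> @ [i]))))\<^sup>2" if \<alpha>: "\<alpha> \<in> W" for \<alpha>
  proof -
    have "(\<Sum>\<beta>\<in>W. if take (length \<alpha>) \<beta> = \<alpha>
        then (if \<alpha> = \<beta> then 1 else 2) * cinner (word_op Y (drop (length \<alpha>) \<beta>) (h \<beta>)) (h \<alpha>) else 0)
      = (\<Sum>\<beta>\<in>W. 2 * cinner (if take (length \<alpha>) \<beta> = \<alpha> then word_op Y (drop (length \<alpha>) \<beta>) (h \<beta>) else 0) (h \<alpha>)
          - (if \<beta> = \<alpha> then cinner (h \<alpha>) (h \<alpha>) else 0))"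
      by (intro sum.cong refl) auto
    also have "\<dots> = 2 * cinner (u \<alpha>) (h \<alpha>) - cinner (h \<alpha>) (h \<alpha>)"
      using \<alpha> fW by (simp add: sum_subtractf sum_distrib_left[symmetric] cinner.sum_left[symmetric] u_def)
    also have "Re \<dots> = (norm (u \<alpha>))\<^sup>2 - (norm (u \<alpha> - h \<alpha>))\<^sup>2"
      by (simp add: power2_norm_eq_inner inner_simps inner_commute inner_eq_Re_cinner[symmetric])
    also have "u \<alpha> - h \<alpha> = (\<Sum>i\<in>UNIV. Y i (u (\<alpha> @ [i])))"
      using rec[OF \<alpha>] by simp
    finally show ?thesis .
  qed
  \<comment> \<open>Each word of P is a word of W with a letter appended, in a unique way. Since u
    vanishes outside W, the subtracted terms are controlled by a part of the sum over W.\<close>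
  define P where "P = (\<lambda>(\<alpha>, i::'n). \<alpha> @ [i]) ` (W \<times> UNIV)"
  have inj: "inj_on (\<lambda>(\<alpha>, i::'n). \<alpha> @ [i]) (W \<times> UNIV)" by (auto simp: inj_on_def)
  have "(\<Sum>\<alpha>\<in>W. (norm (\<Sum>i\<in>UNIV. Y i (u (\<alpha> @ [i]))))\<^sup>2) \<le> (\<Sum>\<alpha>\<in>W. \<Sum>i\<in>UNIV. (norm (u (\<alpha> @ [i])))\<^sup>2)"
    by (intro sum_mono row_contrD[OF Y])
  also have "\<dots> = (\<Sum>\<beta>\<in>P. (norm (u \<beta>))\<^sup>2)"
    unfolding P_def sum.reindex[OF inj] using fW by (simp add: sum.cartesian_product split_def)
  also have "\<dots> = (\<Sum>\<beta>\<in>P \<inter> W. (norm (u \<beta>))\<^sup>2)"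
    using fW u0 by (intro sum.mono_neutral_right) (auto simp: P_def)
  also have "\<dots> \<le> (\<Sum>\<beta>\<in>W. (norm (u \<beta>))\<^sup>2)"
    using fW by (intro sum_mono2) auto
  finally have "0 \<le> (\<Sum>\<alpha>\<in>W. (norm (u \<alpha>))\<^sup>2 - (norm (\<Sum>i\<in>UNIV. Y i (u (\<alpha> @ [i]))))\<^sup>2)"
    by (simp add: sum_subtractf)
  also have "\<dots> = Re (\<Sum>\<alpha>\<in>W. \<Sum>\<beta>\<in>W. if take (length \<alpha>) \<beta> = \<alpha>
    then (if \<alpha> = \<beta> then 1 else 2) * cinner (word_op Y (drop (length \<alpha>) \<beta>) (h \<beta>)) (h \<alpha>) else 0)"
    by (subst Re_sum, rule sum.cong[OF refl rowterm[symmetric]])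
  finally show ?thesis .
qed

text \<open>The words w s index rows and columns, and entry (s, t) is the monomial of \<gamma> when
  w t = (w s)\<gamma>. Taking the real part halves an off-diagonal entry and puts its adjoint at (t,
  s), so the coefficient 2 yields the full Hermitian Toeplitz matrix with identities on the
  diagonal.\<close>

definition toeplitz_poly :: "(nat \<Rightarrow> 'n list) \<Rightarrow> nat \<Rightarrow> 'n list \<Rightarrow> nat \<Rightarrow> nat \<Rightarrow> complex" where
  "toeplitz_poly w k \<gamma> s t =
    (if s < k \<and> t < k \<and> take (length (w s)) (w t) = w s \<and> \<gamma> = drop (length (w s)) (w t)
     then if w s = w t then 1 else 2 else 0)"

lemma toeplitz_poly_is_nc_poly: "is_nc_poly k (toeplitz_poly w k)"
  unfolding is_nc_poly_def
proof (rule finite_subset)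
  show "poly_supp k (toeplitz_poly w k) \<subseteq> (\<lambda>(s, t). drop (length (w s)) (w t)) ` ({..<k} \<times> {..<k})"
  proof
    fix \<gamma> assume "\<gamma> \<in> poly_supp k (toeplitz_poly w k)"
    then obtain s t where "s < k" "t < k" "toeplitz_poly w k \<gamma> s t \<noteq> 0" unfolding poly_supp_def by blast
    then show "\<gamma> \<in> (\<lambda>(s, t). drop (length (w s)) (w t)) ` ({..<k} \<times> {..<k})"
      by (intro image_eqI[of _ _ "(s, t)"]) (auto simp: toeplitz_poly_def split: if_splits)
  qed
qed simp

lemma pform_toeplitz_poly:
  assumes w: "bij_betw w {..<k} W"
  shows "pform k (toeplitz_poly w k) X (\<lambda>s. h (w s)) = (\<Sum>\<alpha>\<in>W. \<Sum>\<beta>\<in>W. if take (length \<alpha>) \<beta> = \<alpha>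
    then (if \<alpha> = \<beta> then 1 else 2) * cinner (word_op X (drop (length \<alpha>) \<beta>) (h \<beta>)) (h \<alpha>) else 0)"
proof -
  let ?M = "toeplitz_poly w k"
  have fin: "finite (poly_supp k ?M)" using toeplitz_poly_is_nc_poly unfolding is_nc_poly_def .
  have inner: "(\<Sum>\<gamma>\<in>poly_supp k ?M. ?M \<gamma> s t * cinner (word_op X \<gamma> (h (w t))) (h (w s)))
    = (if take (length (w s)) (w t) = w s
      then (if w s = w t then 1 else 2) * cinner (word_op X (drop (length (w s)) (w t)) (h (w t))) (h (w
          s)) else 0)"
    if st: "s < k" "t < k" for s t
  proof (cases "take (length (w s)) (w t) = w s")
    case True
    let ?d = "drop (length (w s)) (w t)"
    have "?M ?d s t \<noteq> 0" using st True by (simp add: toeplitz_poly_def)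
    then have d: "?d \<in> poly_supp k ?M" using st unfolding poly_supp_def by blast
    have "(\<Sum>\<gamma>\<in>poly_supp k ?M. ?M \<gamma> s t * cinner (word_op X \<gamma> (h (w t))) (h (w s)))
      = (\<Sum>\<gamma>\<in>poly_supp k ?M. if \<gamma> = ?d then (if w s = w t then 1 else 2)
          * cinner (word_op X ?d (h (w t))) (h (w s)) else 0)"
      by (intro sum.cong refl) (use st True in \<open>simp add: toeplitz_poly_def\<close>)
    then show ?thesis using fin d True by simp
  qed (simp add: toeplitz_poly_def)
  show ?thesis
    unfolding sum.reindex_bij_betw[OF w, symmetric] pform_def
    by (intro sum.cong refl) (simp add: inner)
qed

lemma pform_cong: "(\<And>s. s < k \<Longrightarrow> x s = y s) \<Longrightarrow> pform k M X x = pform k M X y"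
  unfolding pform_def by (intro sum.cong refl) simp

lemma toeplitz_poly_nonneg:
  assumes w: "bij_betw w {..<k} {\<alpha> :: 'n::finite list. length \<alpha> \<le> N}"
  shows "Re_nonneg_on_ball TYPE('k::complex_hilbert) k (toeplitz_poly w k)"
  unfolding Re_nonneg_on_ball_iff
proof (intro ballI allI)
  fix X :: "'n \<Rightarrow> 'k \<Rightarrow>\<^sub>L 'k" and x :: "nat \<Rightarrow> 'k" assume "X \<in> op_ball"
  then have X: "row_contr X" by (rule op_ball_row_contr)
  define h where "h = (\<lambda>\<alpha>. x (inv_into {..<k} w \<alpha>))"
  have "h (w s) = x s" if "s < k" for s
    using bij_betw_imp_inj_on[OF w] that by (simp add: h_def)
  then have "pform k (toeplitz_poly w k) X x = pform k (toeplitz_poly w k) X (\<lambda>s. h (w s))"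
    by (intro pform_cong) simp
  then show "0 \<le> Re (pform k (toeplitz_poly w k) X x)"
    unfolding pform_toeplitz_poly[OF w] using row_contr_toeplitz_nonneg[OF X, where N = N and h = h] by simp
qed

lemma word_op_0: "\<gamma> \<noteq> [] \<Longrightarrow> word_op (\<lambda>_. 0) \<gamma> = 0"
  by (cases \<gamma>) (auto intro: blinfun_eqI)

lemma dil_coeff_bop: "(\<And>i. T i \<in> bop) \<Longrightarrow> dil_coeff \<sigma> T \<gamma> \<in> bop"
  by (simp add: dil_coeff_def bop_id bop_scaleR word_op_bop)

lemma toeplitz_kernel_sum:
  assumes T: "\<And>i. T i \<in> bop"
  shows "(\<Sum>p\<in>A. \<Sum>q\<in>B. c p * cnj (d q) * toeplitz_kernel \<sigma> T (\<alpha>, f p) (\<beta>, g q))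
    = toeplitz_kernel \<sigma> T (\<alpha>, \<Sum>p\<in>A. c p *\<^sub>C f p) (\<beta>, \<Sum>q\<in>B. d q *\<^sub>C g q)"
  by (simp add: toeplitz_kernel_def blinfun.sum_right bopD[OF dil_coeff_bop[OF T]] cinner_double_sum)

text \<open>Grouping the pairs (\<alpha>, h) by their word leaves one vector per word, at which the
  hypothesis is applied to the Toeplitz polynomial. The result is \<sigma> times the kernel form: on
  the diagonal 1 + (\<sigma> - 1) = \<sigma>, and off it \<open>T\<^sub>\<gamma>\<close> = \<sigma>
  (\<open>T\<^sub>\<gamma>\<close> / \<sigma>).\<close>

lemma class_C_if_harnack_nonneg:
  fixes T :: "'m::finite \<Rightarrow> 'h::complex_hilbert \<Rightarrow>\<^sub>L 'h"
  assumes T: "\<And>i. T i \<in> bop" and \<sigma>: "\<sigma> > 0"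
    and H: "\<And>k M x. is_nc_poly k M \<Longrightarrow> Re_nonneg_on_ball TYPE('k::complex_hilbert) k (M :: 'm list \<Rightarrow> _)
      \<Longrightarrow> 0 \<le> Re (pform k M T x) + (\<sigma> - 1) * Re (pform k M (\<lambda>_. 0) x)"
  shows "T \<in> class_C \<sigma>"
proof (rule class_C_if_psd_kernel[OF T \<sigma>])
  have "0 \<le> Re (\<Sum>p\<in>F. \<Sum>q\<in>F. c p * cnj (c q) * toeplitz_kernel \<sigma> T p q)"
    if F: "finite F" for F and c :: "'m list \<times> 'h \<Rightarrow> complex"
  proof -
    define N where "N = Max (insert 0 ((\<lambda>p. length (fst p)) ` F))"
    define W where "W = {\<alpha> :: 'm list. length \<alpha> \<le> N}"
    have fW: "finite W" unfolding W_def by (rule finite_words)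
    have FW: "fst ` F \<subseteq> W" using F by (auto simp: W_def N_def intro!: Max_ge)
    define h where "h = (\<lambda>\<alpha>. \<Sum>p\<in>{p\<in>F. fst p = \<alpha>}. c p *\<^sub>C snd p)"
    obtain w :: "nat \<Rightarrow> 'm list" where w: "bij_betw w {..<card W} W"
      using ex_bij_betw_nat_finite[OF fW] by (auto simp: lessThan_atLeast0)
    have group: "(\<Sum>\<alpha>\<in>W. \<Sum>p\<in>{p\<in>F. fst p = \<alpha>}. g p) = (\<Sum>p\<in>F. g p)" for g :: "'m list \<times> 'h \<Rightarrow> complex"
      using sum.group[OF F fW FW, of g] .
    have "(\<Sum>p\<in>F. \<Sum>q\<in>F. c p * cnj (c q) * toeplitz_kernel \<sigma> T p q)
        = (\<Sum>\<alpha>\<in>W. \<Sum>p\<in>{p\<in>F. fst p = \<alpha>}. \<Sum>\<beta>\<in>W. \<Sum>q\<in>{q\<in>F. fst q = \<beta>}.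
             c p * cnj (c q) * toeplitz_kernel \<sigma> T p q)"
      unfolding group ..
    also have "\<dots> = (\<Sum>\<alpha>\<in>W. \<Sum>\<beta>\<in>W. \<Sum>p\<in>{p\<in>F. fst p = \<alpha>}. \<Sum>q\<in>{q\<in>F. fst q = \<beta>}.
             c p * cnj (c q) * toeplitz_kernel \<sigma> T p q)"
      by (intro sum.cong refl sum.swap)
    also have "\<dots> = (\<Sum>\<alpha>\<in>W. \<Sum>\<beta>\<in>W. \<Sum>p\<in>{p\<in>F. fst p = \<alpha>}. \<Sum>q\<in>{q\<in>F. fst q = \<beta>}.
             c p * cnj (c q) * toeplitz_kernel \<sigma> T (\<alpha>, snd p) (\<beta>, snd q))"
      by (intro sum.cong refl) auto
    also have "\<dots> = (\<Sum>\<alpha>\<in>W. \<Sum>\<beta>\<in>W. toeplitz_kernel \<sigma> T (\<alpha>, h \<alpha>) (\<beta>, h \<beta>))"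
      unfolding toeplitz_kernel_sum[OF T] h_def ..
    finally have expand: "Re (\<Sum>p\<in>F. \<Sum>q\<in>F. c p * cnj (c q) * toeplitz_kernel \<sigma> T p q)
        = (\<Sum>\<alpha>\<in>W. \<Sum>\<beta>\<in>W. Re (toeplitz_kernel \<sigma> T (\<alpha>, h \<alpha>) (\<beta>, h \<beta>)))" by simp
    define e where "e = (\<lambda>(X :: 'm \<Rightarrow> 'h \<Rightarrow>\<^sub>L 'h) \<alpha> \<beta>. if take (length \<alpha>) \<beta> = \<alpha>
      then (if \<alpha> = \<beta> then 1 else 2) * cinner (word_op X (drop (length \<alpha>) \<beta>) (h \<beta>)) (h \<alpha>) else 0)"
    define r where "r = (\<lambda>\<alpha> \<beta>. Re (e T \<alpha> \<beta>) + (\<sigma> - 1) * Re (e (\<lambda>_. 0) \<alpha> \<beta>))"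
    \<comment> \<open>The polynomial sees a comparable pair of words in one order only, the kernel
      in both; hence the comparison with the symmetrised term.\<close>
    have pair: "\<sigma> * Re (toeplitz_kernel \<sigma> T (\<alpha>, h \<alpha>) (\<beta>, h \<beta>)) = (r \<alpha> \<beta> + r \<beta> \<alpha>) / 2" for \<alpha> \<beta>
    proof -
      have ReC: "Re (cinner a b) = Re (cinner b a)" for a b :: 'h
        by (simp add: inner_eq_Re_cinner[symmetric] inner_commute)
      consider "\<alpha> = \<beta>" | "\<alpha> \<noteq> \<beta>" "take (length \<beta>) \<alpha> = \<beta>" "take (length \<alpha>) \<beta> \<noteq> \<alpha>"
        | "\<alpha> \<noteq> \<beta>" "take (length \<alpha>) \<beta> = \<alpha>" "take (length \<beta>) \<alpha> \<noteq> \<beta>"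
        | "\<alpha> \<noteq> \<beta>" "take (length \<alpha>) \<beta> \<noteq> \<alpha>" "take (length \<beta>) \<alpha> \<noteq> \<beta>"
        using take_eq_antisym by blast
      then show ?thesis
      proof cases
        case 1
        then show ?thesis
          by (simp add: toeplitz_kernel_def r_def e_def dil_coeff_def algebra_simps)
      next
        case 2
        then have d: "drop (length \<beta>) \<alpha> \<noteq> []" by (metis append_Nil2 append_take_drop_id)
        show ?thesis using 2 d \<sigma>
          by (simp add: toeplitz_kernel_def r_def e_def dil_coeff_def word_op_0 blinfun.scaleR_left
              cinner.scaleR_left)
      next
        case 3
        then have d: "drop (length \<alpha>) \<beta> \<noteq> []" by (metis append_Nil2 append_take_drop_id)
        show ?thesis using 3 d \<sigma> ReC[of "h \<alpha>"]
          by (simp add: toeplitz_kernel_def r_def e_def dil_coeff_def word_op_0 blinfun.scaleR_left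
              cinner.scaleR_right)
      next
        case 4
        then show ?thesis by (simp add: toeplitz_kernel_def r_def e_def)
      qed
    qed
    let ?M = "toeplitz_poly w (card W)"
    have pe: "pform (card W) ?M X (\<lambda>s. h (w s)) = (\<Sum>\<alpha>\<in>W. \<Sum>\<beta>\<in>W. e X \<alpha> \<beta>)" for X
      unfolding pform_toeplitz_poly[OF w] e_def ..
    have "0 \<le> Re (pform (card W) ?M T (\<lambda>s. h (w s))) + (\<sigma> - 1) * Re (pform (card W) ?M (\<lambda>_. 0) (\<lambda>s. h (w s)))"
      by (intro H toeplitz_poly_is_nc_poly toeplitz_poly_nonneg[OF w[unfolded W_def], folded W_def])
    also have "\<dots> = (\<Sum>\<alpha>\<in>W. \<Sum>\<beta>\<in>W. r \<alpha> \<beta>)"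
      unfolding pe r_def by (simp add: sum.distrib sum_distrib_left)
    also have "\<dots> = ((\<Sum>\<alpha>\<in>W. \<Sum>\<beta>\<in>W. r \<alpha> \<beta>) + (\<Sum>\<alpha>\<in>W. \<Sum>\<beta>\<in>W. r \<beta> \<alpha>)) / 2"
      by (subst (2) sum.swap) simp
    also have "\<dots> = \<sigma> * Re (\<Sum>p\<in>F. \<Sum>q\<in>F. c p * cnj (c q) * toeplitz_kernel \<sigma> T p q)"
      unfolding expand sum_distrib_left pair by (simp add: sum.distrib sum_divide_distrib[symmetric])
    finally show ?thesis using \<sigma> by (simp add: zero_le_mult_iff)
  qed
  then show "psd_kernel (toeplitz_kernel \<sigma> T)"
    unfolding psd_kernel_def using toeplitz_kernel_herm by blast
qed


section \<open>From positivity on the ball to positivity on Fock space\<close>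

text \<open>The form of p at the left creation operators, which send the basis vector of \<alpha> to
  that of \<gamma>\<alpha>. The vectors have coordinates \<zeta> cut off at length N, and the length
  condition keeps both \<alpha> and \<gamma>\<alpha> below the cut.\<close>

definition toep :: "nat \<Rightarrow> ('n list \<Rightarrow> nat \<Rightarrow> nat \<Rightarrow> complex) \<Rightarrow> (nat \<Rightarrow> 'n list \<Rightarrow> complex) \<Rightarrow> nat \<Rightarrow> complex" where
  "toep k M \<zeta> N = (\<Sum>s<k. \<Sum>t<k. \<Sum>\<gamma>\<in>poly_supp k M. M \<gamma> s t *
     (\<Sum>\<alpha> | length \<gamma> + length \<alpha> \<le> N. \<zeta> t \<alpha> * cnj (\<zeta> s (\<gamma> @ \<alpha>))))"

text \<open>
  Positivity of the real part of the polynomial evaluated at the left creation operators.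
\<close>

definition toep_nonneg :: "nat \<Rightarrow> ('n list \<Rightarrow> nat \<Rightarrow> nat \<Rightarrow> complex) \<Rightarrow> bool" where
  "toep_nonneg k M \<longleftrightarrow> (\<forall>N \<zeta>. 0 \<le> Re (toep k M \<zeta> N))"

lemma word_op_scaleR: "word_op (\<lambda>i. r *\<^sub>R X i) \<gamma> = r ^ length \<gamma> *\<^sub>R word_op X \<gamma>"
  by (induction \<gamma>) (auto intro!: blinfun_eqI simp: blinfun.scaleR_left blinfun.scaleR_right)

text \<open>Only matrix entries between words of length at most N are prescribed. The lemma thus
  covers the creation operators and also their truncations to a finite-dimensional subspace of
  another Hilbert space.\<close>

lemma cinner_word_combination:
  fixes X :: "'n::finite \<Rightarrow> 'a::complex_hilbert \<Rightarrow>\<^sub>L 'a"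
  assumes X: "\<And>i. X i \<in> bop"
    and u: "\<And>\<alpha> \<beta>. length \<alpha> \<le> N \<Longrightarrow> length \<beta> \<le> N \<Longrightarrow>
      cinner (word_op X \<gamma> (u \<alpha>)) (u \<beta>) = (if \<beta> = \<gamma> @ \<alpha> then 1 else 0)"
  shows "cinner (word_op X \<gamma> (\<Sum>\<alpha> | length \<alpha> \<le> N. \<zeta> \<alpha> *\<^sub>C u \<alpha>)) (\<Sum>\<alpha> | length \<alpha> \<le> N. \<eta> \<alpha> *\<^sub>C u \<alpha>)
    = (\<Sum>\<alpha> | length \<gamma> + length \<alpha> \<le> N. \<zeta> \<alpha> * cnj (\<eta> (\<gamma> @ \<alpha>)))"
proof -
  define W where "W = {\<alpha> :: 'n list. length \<alpha> \<le> N}"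
  have fW: "finite W" unfolding W_def by (rule finite_words)
  have "cinner (word_op X \<gamma> (\<Sum>\<alpha>\<in>W. \<zeta> \<alpha> *\<^sub>C u \<alpha>)) (\<Sum>\<alpha>\<in>W. \<eta> \<alpha> *\<^sub>C u \<alpha>)
      = (\<Sum>\<alpha>\<in>W. \<Sum>\<beta>\<in>W. \<zeta> \<alpha> * cnj (\<eta> \<beta>) * cinner (word_op X \<gamma> (u \<alpha>)) (u \<beta>))"
    by (simp add: blinfun.sum_right bopD[OF word_op_bop[OF X]] cinner_double_sum)
  also have "\<dots> = (\<Sum>\<alpha>\<in>W. \<Sum>\<beta>\<in>W. if \<beta> = \<gamma> @ \<alpha> then \<zeta> \<alpha> * cnj (\<eta> (\<gamma> @ \<alpha>)) else 0)"
    by (intro sum.cong refl) (simp add: u W_def)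
  also have "\<dots> = (\<Sum>\<alpha>\<in>W. if \<gamma> @ \<alpha> \<in> W then \<zeta> \<alpha> * cnj (\<eta> (\<gamma> @ \<alpha>)) else 0)"
    using fW by simp
  also have "\<dots> = (\<Sum>\<alpha> | length \<gamma> + length \<alpha> \<le> N. \<zeta> \<alpha> * cnj (\<eta> (\<gamma> @ \<alpha>)))"
    using fW by (intro sum.mono_neutral_cong_right) (auto simp: W_def)
  finally show ?thesis by (simp add: W_def)
qed

section \<open>Finite orthonormal systems\<close>

lemma orthonormal_finite:
  assumes K: "separable_infinite_dim TYPE('k::complex_hilbert)"
  shows "\<exists>u :: nat \<Rightarrow> 'k. \<forall>i<n. \<forall>j<n. cinner (u i) (u j) = (if i = j then 1 else 0)"
proof (induction n)
  case (Suc n)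
  then obtain u :: "nat \<Rightarrow> 'k" where u: "\<And>i j. i < n \<Longrightarrow> j < n \<Longrightarrow> cinner (u i) (u j) = (if i = j then 1 else 0)"
    by blast
  \<comment> \<open>The span is a real one, so each vector is accompanied by its multiple by
    \<i>.\<close>
  define B where "B = u ` {..<n} \<union> (\<lambda>i. \<i> *\<^sub>C u i) ` {..<n}"
  have "finite B" by (simp add: B_def)
  then have "span B \<noteq> UNIV" using K unfolding separable_infinite_dim_def by blast
  then obtain v where v: "v \<notin> span B" by blast
  define p where "p = (\<Sum>i<n. cinner v (u i) *\<^sub>C u i)"
  have "p \<in> span B"
    unfolding p_def
  proof (rule span_sum)
    fix i assume i: "i \<in> {..<n}"
    have eq: "c *\<^sub>C u i = Re c *\<^sub>R u i + Im c *\<^sub>R (\<i> *\<^sub>C u i)" for c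
    proof -
      have "complex_of_real (Re c) + complex_of_real (Im c) * \<i> = c" by (simp add: complex_eq_iff)
      then show ?thesis unfolding scaleR_scaleC scaleC_scaleC scaleC_add_left[symmetric]
          by (rule arg_cong[OF sym])
    qed
    have "u i \<in> span B" "\<i> *\<^sub>C u i \<in> span B" using i by (auto simp: B_def intro: span_base)
    then show "cinner v (u i) *\<^sub>C u i \<in> span B" unfolding eq[of "cinner v (u i)"] by (intro span_add span_scale)
  qed
  then have ne: "v - p \<noteq> 0" using v by auto
  have orth: "cinner (v - p) (u j) = 0" if j: "j < n" for j
  proof -
    have "cinner p (u j) = (\<Sum>i<n. if i = j then cinner v (u j) else 0)"
      unfolding p_def cinner.sum_left cinner_scaleC_left using u j by (intro sum.cong) auto
    then show ?thesis using j by (simp add: cinner_simps)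
  qed
  define e where "e = complex_of_real (1 / norm (v - p)) *\<^sub>C (v - p)"
  have "norm e = 1" using ne by (simp add: e_def norm_scaleC norm_divide)
  then have "cinner e e = 1" by (simp add: cinner_self)
  moreover have eu: "cinner e (u j) = 0" if "j < n" for j
    using orth[OF that] by (simp add: e_def cinner_scaleC_left)
  moreover have "cinner (u j) e = 0" if "j < n" for j
    using eu[OF that] cinner_commute[of "u j" e] by simp
  ultimately show ?case
    by (intro exI[of _ "u(n := e)"]) (auto simp: less_Suc_eq u)
qed simp

lemma bessel_inequality:
  assumes "finite A" "\<And>i j. i \<in> A \<Longrightarrow> j \<in> A \<Longrightarrow> cinner (u i) (u j) = (if i = j then 1 else 0)"
  shows "(\<Sum>i\<in>A. (cmod (cinner v (u i)))\<^sup>2) \<le> (norm (v :: 'a::complex_hilbert))\<^sup>2"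
proof -
  define p where "p = (\<Sum>i\<in>A. cinner v (u i) *\<^sub>C u i)"
  define q where "q = (\<Sum>i\<in>A. (cmod (cinner v (u i)))\<^sup>2)"
  have vp: "cinner v p = complex_of_real q"
    unfolding p_def q_def cinner.sum_right cinner_scaleC_right of_real_sum
    by (intro sum.cong refl) (simp only: complex_norm_square mult.commute)
  have "cinner p p = (\<Sum>i\<in>A. \<Sum>j\<in>A. if i = j then cinner v (u i) * cnj (cinner v (u i)) else 0)"
    unfolding p_def cinner_double_sum using assms(2) by (intro sum.cong refl) auto
  also have "\<dots> = complex_of_real q"
    using assms(1) unfolding q_def of_real_sum complex_norm_square by simp
  finally have pp: "cinner p p = complex_of_real q" .
  have "0 \<le> Re (cinner (v - p) (v - p))" by (simp add: cinner_self)
  also have "\<dots> = (norm v)\<^sup>2 - q"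
    using vp pp cinner_commute[of p v] by (simp add: cinner.diff_left cinner.diff_right cinner_self[of v])
  finally show ?thesis by (simp add: q_def)
qed

lemma orthonormal_norm_sum:
  fixes u :: "'i \<Rightarrow> 'a::complex_hilbert"
  assumes "finite A" "\<And>i j. i \<in> A \<Longrightarrow> j \<in> A \<Longrightarrow> cinner (u i) (u j) = (if i = j then 1 else 0)"
  shows "(norm (\<Sum>i\<in>A. c i *\<^sub>C u i))\<^sup>2 = (\<Sum>i\<in>A. (cmod (c i))\<^sup>2)"
proof -
  let ?p = "\<Sum>i\<in>A. c i *\<^sub>C u i"
  have "cinner ?p ?p = (\<Sum>i\<in>A. \<Sum>j\<in>A. if i = j then c i * cnj (c i) else 0)"
    unfolding cinner_double_sum using assms(2) by (intro sum.cong refl) auto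
  also have "\<dots> = complex_of_real (\<Sum>i\<in>A. (cmod (c i))\<^sup>2)"
    using assms(1) unfolding of_real_sum complex_norm_square by simp
  finally show ?thesis unfolding cinner_self of_real_eq_iff .
qed

text \<open>Creation operators truncated at length N fit on a finite-dimensional subspace of
  \<open>'k\<close> and act exactly as far as \<open>toep\<close> can see. They form a row
  contraction X, possibly of norm 1, so the hypothesis is applied to rX and r tends to 1.\<close>

lemma toep_nonneg_if_on_ball:
  fixes M :: "'n::finite list \<Rightarrow> nat \<Rightarrow> nat \<Rightarrow> complex"
  assumes K: "separable_infinite_dim TYPE('k::complex_hilbert)"
    and M: "Re_nonneg_on_ball TYPE('k) k M"
  shows "toep_nonneg k M"
  unfolding toep_nonneg_def
proof (intro allI)
  fix N :: nat and \<zeta> :: "nat \<Rightarrow> 'n list \<Rightarrow> complex"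
  define W where "W = {\<alpha> :: 'n list. length \<alpha> \<le> N}"
  have fW: "finite W" unfolding W_def by (rule finite_words)
  obtain e where e: "bij_betw e W {..<card W}"
    using ex_bij_betw_finite_nat[OF fW] by (auto simp: lessThan_atLeast0)
  obtain u' :: "nat \<Rightarrow> 'k" where u': "\<And>i j. i < card W \<Longrightarrow> j < card W \<Longrightarrow> cinner (u' i) (u' j) = (if i
      = j then 1 else 0)"
    using orthonormal_finite[OF K, of "card W"] by blast
  define u where "u = (\<lambda>\<alpha>. u' (e \<alpha>))"
  have u: "cinner (u \<alpha>) (u \<beta>) = (if \<alpha> = \<beta> then 1 else 0)" if "\<alpha> \<in> W" "\<beta> \<in> W" for \<alpha> \<beta>
  proof -
    have "e \<alpha> < card W" "e \<beta> < card W" using bij_betwE[OF e] that by auto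
    moreover have "e \<alpha> = e \<beta> \<longleftrightarrow> \<alpha> = \<beta>" using bij_betw_imp_inj_on[OF e] that by (auto dest: inj_onD)
    ultimately show ?thesis by (simp add: u_def u')
  qed
  \<comment> \<open>The words that may still be lengthened by a letter without leaving W; on the
    longest words X is zero.\<close>
  define V where "V = {\<alpha> :: 'n list. length \<alpha> < N}"
  have VW: "V \<subseteq> W" by (auto simp: V_def W_def)
  have fV: "finite V" by (rule finite_subset[OF VW fW])
  have "\<exists>X\<in>bop. \<forall>v. blinfun_apply X v = (\<Sum>\<alpha>\<in>V. cinner v (u \<alpha>) *\<^sub>C u (i # \<alpha>))" for i
  proof (rule bopI)
    show "(\<Sum>\<alpha>\<in>V. cinner (x + y) (u \<alpha>) *\<^sub>C u (i # \<alpha>)) = (\<Sum>\<alpha>\<in>V. cinner x (u \<alpha>) *\<^sub>C u (i # \<alpha>))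
        + (\<Sum>\<alpha>\<in>V. cinner y (u \<alpha>) *\<^sub>C u (i # \<alpha>))" for x y
      by (simp add: cinner_simps scaleC_add_left sum.distrib)
    show "(\<Sum>\<alpha>\<in>V. cinner (c *\<^sub>C x) (u \<alpha>) *\<^sub>C u (i # \<alpha>)) = c *\<^sub>C (\<Sum>\<alpha>\<in>V. cinner x (u \<alpha>) *\<^sub>C u (i # \<alpha>))" for c x
      by (simp add: cinner_simps scaleC_sum_right scaleC_scaleC)
    show "norm (\<Sum>\<alpha>\<in>V. cinner x (u \<alpha>) *\<^sub>C u (i # \<alpha>)) \<le> (\<Sum>\<alpha>\<in>V. norm (u \<alpha>) * norm (u (i # \<alpha>))) * norm x" for x
      unfolding sum_distrib_right
    proof (rule sum_norm_le)
      fix \<alpha>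
      show "norm (cinner x (u \<alpha>) *\<^sub>C u (i # \<alpha>)) \<le> norm (u \<alpha>) * norm (u (i # \<alpha>)) * norm x"
        using mult_right_mono[OF cmod_cinner_le[of x "u \<alpha>"], of "norm (u (i # \<alpha>))"]
        by (simp add: norm_scaleC mult_ac)
    qed
  qed
  then have "\<forall>i. \<exists>X. X \<in> bop \<and> (\<forall>v. blinfun_apply X v = (\<Sum>\<alpha>\<in>V. cinner v (u \<alpha>) *\<^sub>C u (i # \<alpha>)))" by blast
  from choice[OF this] obtain X where X: "\<And>i. X i \<in> bop"
    and Xv: "\<And>i v. blinfun_apply (X i) v = (\<Sum>\<alpha>\<in>V. cinner v (u \<alpha>) *\<^sub>C u (i # \<alpha>))" by blast
  have "row_contr X"
    unfolding row_contr_def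
  proof
    fix v :: "'n \<Rightarrow> 'k"
    define A where "A = (UNIV :: 'n set) \<times> V"
    have fA: "finite A" using fV by (simp add: A_def)
    have "(\<Sum>i\<in>UNIV. X i (v i)) = (\<Sum>p\<in>A. cinner (v (fst p)) (u (snd p)) *\<^sub>C u (fst p # snd p))"
      by (simp add: Xv A_def sum.cartesian_product split_def)
    then have "(norm (\<Sum>i\<in>UNIV. X i (v i)))\<^sup>2 = (\<Sum>p\<in>A. (cmod (cinner (v (fst p)) (u (snd p))))\<^sup>2)"
      by (simp only:) (rule orthonormal_norm_sum[OF fA],
        auto simp: A_def V_def W_def u prod_eq_iff)
    also have "\<dots> = (\<Sum>i\<in>UNIV. \<Sum>\<alpha>\<in>V. (cmod (cinner (v i) (u \<alpha>)))\<^sup>2)"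
      by (simp add: A_def sum.cartesian_product split_def)
    also have "\<dots> \<le> (\<Sum>i\<in>UNIV. (norm (v i))\<^sup>2)"
      using VW by (intro sum_mono bessel_inequality fV u) auto
    finally show "(norm (\<Sum>i\<in>UNIV. X i (v i)))\<^sup>2 \<le> (\<Sum>i\<in>UNIV. (norm (v i))\<^sup>2)" .
  qed
  have step: "blinfun_apply (X i) (u \<beta>) = (if \<beta> \<in> V then u (i # \<beta>) else 0)" if "\<beta> \<in> W" for i \<beta>
  proof -
    have "blinfun_apply (X i) (u \<beta>) = (\<Sum>\<alpha>\<in>V. if \<beta> = \<alpha> then u (i # \<beta>) else 0)"
      unfolding Xv using that VW by (intro sum.cong refl) (auto simp: u)
    then show ?thesis using fV by simp
  qed
  have word: "blinfun_apply (word_op X \<gamma>) (u \<alpha>) = (if \<gamma> @ \<alpha> \<in> W then u (\<gamma> @ \<alpha>) else 0)" if "\<alpha> \<in> W" for \<gamma> \<alpha>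
    by (induction \<gamma>) (use that in \<open>auto simp: step blinfun.zero_right W_def V_def\<close>)
  define x where "x = (\<lambda>s. \<Sum>\<alpha>\<in>W. \<zeta> s \<alpha> *\<^sub>C u \<alpha>)"
  define S where "S = (\<lambda>s t \<gamma>. \<Sum>\<alpha> | length \<gamma> + length \<alpha> \<le> N. \<zeta> t \<alpha> * cnj (\<zeta> s (\<gamma> @ \<alpha>)))"
  have comb: "cinner (word_op X \<gamma> (x t)) (x s) = S s t \<gamma>" for s t \<gamma>
    unfolding x_def W_def S_def
  proof (rule cinner_word_combination[OF X])
    fix \<alpha> \<beta> :: "'n list" assume "length \<alpha> \<le> N" "length \<beta> \<le> N"
    then show "cinner (word_op X \<gamma> (u \<alpha>)) (u \<beta>) = (if \<beta> = \<gamma> @ \<alpha> then 1 else 0)"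
      using word[of \<alpha> \<gamma>] by (auto simp: W_def u)
  qed
  have pos: "0 \<le> Re (\<Sum>s<k. \<Sum>t<k. \<Sum>\<gamma>\<in>poly_supp k M. M \<gamma> s t * (complex_of_real (r ^ length \<gamma>) * S s t \<gamma>))"
    if r: "0 \<le> r" "r < 1" for r
  proof -
    have "0 \<le> Re (pform k M (\<lambda>i. r *\<^sub>R X i) x)"
      using M scaled_row_contr_op_ball[OF X \<open>row_contr X\<close> r] unfolding Re_nonneg_on_ball_iff by blast
    then show ?thesis
      unfolding pform_def word_op_scaleR blinfun.scaleR_left cinner.scaleR_left comb scaleR_conv_of_real .
  qed
  have "((\<lambda>r::real. Re (\<Sum>s<k. \<Sum>t<k. \<Sum>\<gamma>\<in>poly_supp k M. M \<gamma> s t * (complex_of_real (r ^ length \<gamma>) * S s t \<gamma>)))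
      \<longlongrightarrow> Re (\<Sum>s<k. \<Sum>t<k. \<Sum>\<gamma>\<in>poly_supp k M. M \<gamma> s t * (complex_of_real (1 ^ length \<gamma>) * S s t \<gamma>))) (at_left 1)"
    by (intro tendsto_intros)
  from nonneg_at_left_1[OF this pos]
  show "0 \<le> Re (toep k M \<zeta> N)" by (simp add: toep_def S_def)
qed


section \<open>Positivity of the form of an operator tuple of class \<open>C\<^sub>\<rho>\<close>\<close>

lemma sum_length_Suc_snoc:
  fixes f :: "'n::finite list \<Rightarrow> 'b::comm_monoid_add"
  shows "(\<Sum>\<alpha> | length \<alpha> = Suc n. f \<alpha>) = (\<Sum>\<alpha> | length \<alpha> = n. \<Sum>i\<in>UNIV. f (\<alpha> @ [i]))"
proof -
  have "(\<Sum>\<alpha> | length \<alpha> = n. \<Sum>i\<in>UNIV. f (\<alpha> @ [i])) = (\<Sum>p\<in>{\<alpha>. length \<alpha> = n} \<times> UNIV. f (fst p @ [snd p]))"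
    by (simp add: sum.cartesian_product split_def)
  also have "\<dots> = (\<Sum>\<alpha> | length \<alpha> = Suc n. f \<alpha>)"
  proof (rule sum.reindex_bij_betw)
    show "bij_betw (\<lambda>p. fst p @ [snd p]) ({\<alpha>. length \<alpha> = n} \<times> (UNIV :: 'n set)) {\<alpha>. length \<alpha> = Suc n}"
      by (rule bij_betwI[where g = "\<lambda>\<alpha>. (butlast \<alpha>, last \<alpha>)"])
        (auto simp: length_Suc_conv_rev)
  qed
  finally show ?thesis ..
qed

lemma cadj_id: "cadj id_blinfun = id_blinfun"
  by (rule cadj_eqI) simp

lemma cadj_word_append:
  assumes X: "\<And>i. X i \<in> bop"
  shows "cadj (word_op X (\<alpha> @ \<beta>)) y = cadj (word_op X \<beta>) (cadj (word_op X \<alpha>) y)"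
  by (rule cinner_ext_right)
    (simp add: cinner_cadj[OF word_op_bop[OF X], symmetric] word_op_append)

lemma has_sum_finite_sum:
  fixes f :: "'i \<Rightarrow> 'b \<Rightarrow> complex"
  assumes "\<And>i. i \<in> F \<Longrightarrow> (f i has_sum s i) A"
  shows "((\<lambda>x. \<Sum>i\<in>F. f i x) has_sum (\<Sum>i\<in>F. s i)) A"
  using assms by (induction F rule: infinite_finite_induct) (auto intro!: has_sum_add)

text \<open>In coordinates the vector-valued form is an infinite sum of scalar Toeplitz forms, one
  for each coordinate, and each of them is nonnegative.\<close>

lemma toep_vector_nonneg:
  fixes \<xi> :: "nat \<Rightarrow> 'n::finite list \<Rightarrow> 'a::complex_hilbert"
  assumes "toep_nonneg k M"
  shows "0 \<le> Re (\<Sum>s<k. \<Sum>t<k. \<Sum>\<gamma>\<in>poly_supp k M. M \<gamma> s t *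
     (\<Sum>\<alpha> | length \<gamma> + length \<alpha> \<le> N. cinner (\<xi> t \<alpha>) (\<xi> s (\<gamma> @ \<alpha>))))"
proof -
  obtain \<Phi> :: "'a \<Rightarrow> 'a \<Rightarrow> complex"
    where \<Phi>: "\<And>x y. ((\<lambda>i. \<Phi> x i * cnj (\<Phi> y i)) has_sum cinner x y) UNIV"
    using cinner_coordinates by blast
  have "((\<lambda>i. Re (toep k M (\<lambda>s \<alpha>. \<Phi> (\<xi> s \<alpha>) i) N)) has_sum
      Re (\<Sum>s<k. \<Sum>t<k. \<Sum>\<gamma>\<in>poly_supp k M. M \<gamma> s t *
        (\<Sum>\<alpha> | length \<gamma> + length \<alpha> \<le> N. cinner (\<xi> t \<alpha>) (\<xi> s (\<gamma> @ \<alpha>))))) UNIV"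
    unfolding toep_def by (intro has_sum_Re has_sum_finite_sum has_sum_cmult_right \<Phi>)
  then show ?thesis
    by (rule has_sum_nonneg) (use assms in \<open>simp add: toep_nonneg_def\<close>)
qed

text \<open>
  The map \<open>y \<mapsto> (\<Delta> X\<^sub>\<alpha>\<^sup>* y)\<^sub>\<alpha>\<close> is the Poisson kernel, which intertwines the adjoints of \<open>X\<close> with those of
  the creation operators.
\<close>

lemma poisson_nonneg:
  fixes X :: "'n::finite \<Rightarrow> 'a::complex_hilbert \<Rightarrow>\<^sub>L 'a" and \<Delta> :: "'a \<Rightarrow> 'a"
  assumes X: "\<And>i. X i \<in> bop"
    and \<Delta>: "\<And>y z. cinner y z = cinner (\<Delta> y) (\<Delta> z) + (\<Sum>i\<in>UNIV. cinner (cadj (X i) y) (cadj (X i) z))"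
    and r: "0 \<le> r" "r < 1" and decay: "\<And>y. (\<Sum>i\<in>UNIV. (norm (cadj (X i) y))\<^sup>2) \<le> r * (norm y)\<^sup>2"
    and M: "toep_nonneg k M"
  shows "0 \<le> Re (pform k M X x)"
proof -
  define \<xi> where "\<xi> = (\<lambda>\<alpha> y. cadj (word_op X \<alpha>) y)"
  have \<xi>_append: "\<xi> (\<alpha> @ \<beta>) y = \<xi> \<beta> (\<xi> \<alpha> y)" for \<alpha> \<beta> y
    unfolding \<xi>_def by (rule cadj_word_append[OF X])
  have \<xi>_single: "\<xi> [i] y = cadj (X i) y" for i y
  proof -
    have "X i o\<^sub>L id_blinfun = X i" by (rule blinfun_eqI) simp
    then show ?thesis by (simp add: \<xi>_def)
  qed
  have \<xi>_Nil: "\<xi> [] y = y" for y by (simp add: \<xi>_def cadj_id)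
  \<comment> \<open>The remainder after n iterations of the defect identity for \<Delta>; the factor
    r < 1 in \<open>decay\<close> drives it to 0.\<close>
  define E where "E = (\<lambda>n y z. \<Sum>\<alpha> | length \<alpha> = n. cinner (\<xi> \<alpha> y) (\<xi> \<alpha> z))"
  have E_step: "E n y z = (\<Sum>\<alpha> | length \<alpha> = n. cinner (\<Delta> (\<xi> \<alpha> y)) (\<Delta> (\<xi> \<alpha> z))) + E (Suc n) y z" for n y z
    unfolding E_def sum_length_Suc_snoc sum.distrib[symmetric]
    by (intro sum.cong refl) (simp add: \<xi>_append \<xi>_single \<Delta>[symmetric])
  have words_Suc: "{\<alpha> :: 'n list. length \<alpha> \<le> Suc n} = {\<alpha>. length \<alpha> \<le> n} \<union> {\<alpha>. length \<alpha> = Suc n}" for n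
    by auto
  have tele: "cinner y z = (\<Sum>\<alpha> | length \<alpha> \<le> n. cinner (\<Delta> (\<xi> \<alpha> y)) (\<Delta> (\<xi> \<alpha> z))) + E (Suc n) y z" for n y z
  proof (induction n)
    case 0
    show ?case using E_step[of 0 y z] by (simp add: E_def \<xi>_Nil)
  next
    case (Suc n)
    have "(\<Sum>\<alpha> | length \<alpha> \<le> Suc n. cinner (\<Delta> (\<xi> \<alpha> y)) (\<Delta> (\<xi> \<alpha> z)))
      = (\<Sum>\<alpha> | length \<alpha> \<le> n. cinner (\<Delta> (\<xi> \<alpha> y)) (\<Delta> (\<xi> \<alpha> z))) + (\<Sum>\<alpha> | length \<alpha>
          = Suc n. cinner (\<Delta> (\<xi> \<alpha> y)) (\<Delta> (\<xi> \<alpha> z)))"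
      unfolding words_Suc by (rule sum.union_disjoint) (auto simp: finite_words)
    then show ?case using Suc E_step[of "Suc n" y z] by simp
  qed
  have E_decay: "(\<Sum>\<alpha> | length \<alpha> = n. (norm (\<xi> \<alpha> y))\<^sup>2) \<le> r ^ n * (norm y)\<^sup>2" for n y
  proof (induction n)
    case 0
    show ?case by (simp add: \<xi>_Nil)
  next
    case (Suc n)
    have "(\<Sum>\<alpha> | length \<alpha> = Suc n. (norm (\<xi> \<alpha> y))\<^sup>2) \<le> (\<Sum>\<alpha> | length \<alpha> = n. r * (norm (\<xi> \<alpha> y))\<^sup>2)"
      unfolding sum_length_Suc_snoc \<xi>_append \<xi>_single by (intro sum_mono decay)
    also have "\<dots> \<le> r * (r ^ n * (norm y)\<^sup>2)"
      unfolding sum_distrib_left[symmetric] using r Suc by (intro mult_left_mono)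
    finally show ?case by simp
  qed
  have E_lim: "(\<lambda>n. E n y z) \<longlonglongrightarrow> 0" for y z
  proof (rule Lim_null_comparison)
    show "\<forall>\<^sub>F n in sequentially. norm (E n y z) \<le> r ^ n * (norm y * norm z)"
    proof (rule always_eventually, rule allI)
      fix n
      have "cmod (E n y z) \<le> sqrt (\<Sum>\<alpha> | length \<alpha> = n. (norm (\<xi> \<alpha> y))\<^sup>2) * sqrt (\<Sum>\<alpha> | length \<alpha>
          = n. (norm (\<xi> \<alpha> z))\<^sup>2)"
        unfolding E_def by (rule cmod_sum_cinner_le)
      also have "\<dots> \<le> sqrt (r ^ n * (norm y)\<^sup>2) * sqrt (r ^ n * (norm z)\<^sup>2)"
        by (intro mult_mono real_sqrt_le_mono E_decay) (use r in \<open>auto simp: sum_nonneg\<close>)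
      also have "\<dots> = r ^ n * (norm y * norm z)"
        using r by (simp add: real_sqrt_mult)
      finally show "norm (E n y z) \<le> r ^ n * (norm y * norm z)" .
    qed
    show "(\<lambda>n. r ^ n * (norm y * norm z)) \<longlonglongrightarrow> 0"
      using r by (intro tendsto_mult_left_zero LIMSEQ_realpow_zero) auto
  qed
  \<comment> \<open>The telescoped identity is applied to y and the adjoint word \<gamma> at z. The
    offset by the length of \<gamma> leaves precisely the words \<alpha> of length at most
    n.\<close>
  have conv: "(\<lambda>N. \<Sum>\<alpha> | length \<gamma> + length \<alpha> \<le> N. cinner (\<Delta> (\<xi> \<alpha> y)) (\<Delta> (\<xi> (\<gamma> @ \<alpha>) z)))
      \<longlonglongrightarrow> cinner (word_op X \<gamma> y) z" for \<gamma> y z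
  proof (rule LIMSEQ_offset[where k = "length \<gamma>"])
    have "(\<lambda>n. cinner y (\<xi> \<gamma> z) - E (Suc n) y (\<xi> \<gamma> z)) \<longlonglongrightarrow> cinner y (\<xi> \<gamma> z) - 0"
      by (intro tendsto_intros LIMSEQ_Suc E_lim)
    moreover have "cinner y (\<xi> \<gamma> z) - E (Suc n) y (\<xi> \<gamma> z)
        = (\<Sum>\<alpha> | length \<gamma> + length \<alpha> \<le> n + length \<gamma>. cinner (\<Delta> (\<xi> \<alpha> y)) (\<Delta> (\<xi> (\<gamma> @ \<alpha>) z)))" for n
      using tele[of y "\<xi> \<gamma> z" n] by (simp add: \<xi>_append add.commute)
    ultimately show "(\<lambda>n. \<Sum>\<alpha> | length \<gamma> + length \<alpha> \<le> n + length \<gamma>. cinner (\<Delta> (\<xi> \<alpha> y)) (\<Delta> (\<xi> (\<gamma> @ \<alpha>) z)))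
        \<longlonglongrightarrow> cinner (word_op X \<gamma> y) z"
      by (simp add: \<xi>_def cinner_cadj[OF word_op_bop[OF X]])
  qed
  have "(\<lambda>N. Re (\<Sum>s<k. \<Sum>t<k. \<Sum>\<gamma>\<in>poly_supp k M. M \<gamma> s t *
     (\<Sum>\<alpha> | length \<gamma> + length \<alpha> \<le> N. cinner (\<Delta> (\<xi> \<alpha> (x t))) (\<Delta> (\<xi> (\<gamma> @ \<alpha>) (x s)))))) \<longlonglongrightarrow> Re (pform k M X x)"
    unfolding pform_def by (intro tendsto_intros conv)
  then show ?thesis
    by (rule LIMSEQ_le_const)
      (use toep_vector_nonneg[OF M, where \<xi> = "\<lambda>s \<alpha>. \<Delta> (\<xi> \<alpha> (x s))"] in blast)
qed

section \<open>Dilations as row isometries on the whole space\<close>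

lemma isometry_cinner:
  fixes V :: "'a::complex_hilbert \<Rightarrow>\<^sub>L 'b::complex_hilbert"
  assumes V: "V \<in> bop" and iso: "\<And>x. x \<in> G \<Longrightarrow> norm (V x) = norm x"
    and G: "\<And>x y. x \<in> G \<Longrightarrow> y \<in> G \<Longrightarrow> x + y \<in> G" "\<And>c x. x \<in> G \<Longrightarrow> c *\<^sub>C x \<in> G"
    and xy: "x \<in> G" "y \<in> G"
  shows "cinner (V x) (V y) = cinner x y"
proof -
  have re: "inner (V x) (V y) = inner x y" if "x \<in> G" "y \<in> G" for x y
  proof -
    have "(norm (V (x + y)))\<^sup>2 = (norm (x + y))\<^sup>2" "(norm (V x))\<^sup>2 = (norm x)\<^sup>2" "(norm (V y))\<^sup>2 = (norm y)\<^sup>2"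
      using that G by (simp_all add: iso)
    then show ?thesis
      by (simp add: blinfun.add_right power2_norm_eq_inner inner_simps inner_commute)
  qed
  show ?thesis
  proof (rule complex_eqI)
    show "Re (cinner (V x) (V y)) = Re (cinner x y)"
      using re[OF xy] by (simp add: inner_eq_Re_cinner)
    \<comment> \<open>The imaginary part is minus the real inner product with x replaced by \<i>x,
      which is why G has to admit complex scalars.\<close>
    show "Im (cinner (V x) (V y)) = Im (cinner x y)"
      using re[OF G(2)[OF xy(1), of \<i>] xy(2)] by (simp add: inner_eq_Re_cinner bopD[OF V] cinner_scaleC_left)
  qed
qed

text \<open>
  \<open>W\<close> consists of isometries with orthogonal ranges on the range of the projection \<open>P\<close>, extended by
  zero to the whole space.
\<close>

definition row_isometry ::
    "('n \<Rightarrow> 'a::complex_hilbert \<Rightarrow>\<^sub>L 'a) \<Rightarrow> ('a \<Rightarrow>\<^sub>L 'a) \<Rightarrow> bool" where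
  "row_isometry W P \<longleftrightarrow> (\<forall>i. W i \<in> bop) \<and> (\<forall>x y. cinner (P x) y = cinner x (P y)) \<and>
     (\<forall>x. norm (P x) \<le> norm x) \<and> (\<forall>i x. W i (P x) = W i x) \<and>
     (\<forall>i j x y. cinner (W i x) (W j y) = (if i = j then cinner (P x) (P y) else 0))"

lemma row_isometryD:
  assumes "row_isometry W P"
  shows "W i \<in> bop" "cinner (P x) y = cinner x (P y)" "norm (P x) \<le> norm x" "W i (P x) = W i x"
    "cinner (W i x) (W j y) = (if i = j then cinner (P x) (P y) else 0)"
  using assms unfolding row_isometry_def by blast+

text \<open>The V i are isometric on G only. Composing them with the projection P onto G gives
  operators controlled on the whole space which agree with the V i on G, and so on every word
  applied to the range of J.\<close>

lemma class_C_dilation: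
  fixes T :: "'n::finite \<Rightarrow> 'h::complex_hilbert \<Rightarrow>\<^sub>L 'h"
  assumes "T \<in> class_C \<rho>"
  shows "\<exists>(J :: 'h \<Rightarrow>\<^sub>L ('n list \<times> 'h, complex) l2) W P. row_isometry W P \<and>
    (\<forall>h h'. cinner (J h) (J h') = cinner h h') \<and>
    (\<forall>\<alpha> h h'. \<alpha> \<noteq> [] \<longrightarrow> cinner (word_op T \<alpha> h) h' = complex_of_real \<rho> * cinner (word_op W \<alpha> (J h)) (J h'))"
proof -
  obtain G :: "('n list \<times> 'h, complex) l2 set" and J :: "'h \<Rightarrow>\<^sub>L ('n list \<times> 'h, complex) l2"
    and V :: "'n \<Rightarrow> ('n list \<times> 'h, complex) l2 \<Rightarrow>\<^sub>L ('n list \<times> 'h, complex) l2"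
    where G: "closed G" "0 \<in> G" "\<forall>x\<in>G. \<forall>y\<in>G. x + y \<in> G" "\<forall>c. \<forall>x\<in>G. c *\<^sub>C x \<in> G"
      and J: "J \<in> bop" "\<forall>h. norm (J h) = norm h" "range J \<subseteq> G"
      and V': "\<forall>i. V i \<in> bop \<and> V i ` G \<subseteq> G \<and> (\<forall>x\<in>G. norm (V i x) = norm x)"
      and orth: "\<forall>i j. i \<noteq> j \<longrightarrow> (\<forall>x\<in>G. \<forall>y\<in>G. cinner (V i x) (V j y) = 0)"
      and dil: "\<forall>\<alpha>. \<alpha> \<noteq> [] \<longrightarrow> word_op T \<alpha> = \<rho> *\<^sub>R (cadj J o\<^sub>L word_op V \<alpha> o\<^sub>L J)"
    using assms unfolding class_C_def mem_Collect_eq by (elim conjE exE) (rule that; assumption)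
  note G = G(1,2) G(3,4)[rule_format] and J = J(1) J(2)[rule_format] J(3)
    and orth = orth[rule_format] and dil = dil[rule_format]
  have V: "V i \<in> bop" "V i ` G \<subseteq> G" "x \<in> G \<Longrightarrow> norm (V i x) = norm x" for i x
    using V' by auto
  obtain P where P: "P \<in> bop" "\<And>x. P x \<in> G" "\<And>x. x \<in> G \<Longrightarrow> P x = x"
      "\<And>x y. cinner (P x) y = cinner x (P y)" "\<And>x. norm (P x) \<le> norm x"
    using orth_projection[OF G] by blast
  define W where "W = (\<lambda>i. V i o\<^sub>L P)"
  have W: "W i x = V i (P x)" for i x by (simp add: W_def)
  have JG: "J h \<in> G" for h using J(3) by auto
  have VG: "V i x \<in> G" if "x \<in> G" for i x using V(2)[of i] that by auto
  have word: "word_op W \<alpha> x = word_op V \<alpha> x \<and> word_op V \<alpha> x \<in> G" if "x \<in> G" for \<alpha> x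
    by (induction \<alpha>) (use that in \<open>simp_all add: W P(3) VG\<close>)
  have "row_isometry W P"
    unfolding row_isometry_def
  proof (intro conjI allI)
    show "W i \<in> bop" for i unfolding W_def by (intro bop_compose V P)
    show "W i (P x) = W i x" for i x by (simp add: W P)
    show "cinner (W i x) (W j y) = (if i = j then cinner (P x) (P y) else 0)" for i j x y
    proof (cases "i = j")
      case True
      then show ?thesis unfolding W using isometry_cinner[OF V(1) V(3) G(3,4) P(2) P(2)] by simp
    next
      case False
      then show ?thesis unfolding W using orth[OF False P(2) P(2)] by simp
    qed
  qed (fact P)+
  moreover have "cinner (J h) (J h') = cinner h h'" for h h'
    by (rule isometry_cinner[of J UNIV]) (simp_all add: J)
  moreover have "cinner (word_op T \<alpha> h) h' = complex_of_real \<rho> * cinner (word_op W \<alpha> (J h)) (J h')"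
      if "\<alpha> \<noteq> []" for \<alpha> h h'
    using word[OF JG, of \<alpha> h]
    by (simp add: dil[OF that] blinfun.scaleR_left cinner.scaleR_left cinner_cadj'[OF J(1)] scaleR_conv_of_real)
  ultimately show ?thesis by (intro exI[of _ J] exI[of _ W] exI[of _ P]) simp
qed

lemma row_isometry_row_contr:
  fixes W :: "'n::finite \<Rightarrow> 'a::complex_hilbert \<Rightarrow>\<^sub>L 'a"
  assumes "row_isometry W P"
  shows "row_contr W"
  unfolding row_contr_def
proof
  note P = row_isometryD(3)[OF assms] and PW = row_isometryD(5)[OF assms]
  fix u :: "'n \<Rightarrow> 'a"
  have "cinner (\<Sum>i\<in>UNIV. W i (u i)) (\<Sum>i\<in>UNIV. W i (u i)) = (\<Sum>i\<in>UNIV. cinner (P (u i)) (P (u i)))"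
    unfolding cinner.sum_left cinner.sum_right PW by simp
  then have "complex_of_real ((norm (\<Sum>i\<in>UNIV. W i (u i)))\<^sup>2) = complex_of_real (\<Sum>i\<in>UNIV. (norm (P (u i)))\<^sup>2)"
    unfolding cinner_self of_real_sum .
  then have "(norm (\<Sum>i\<in>UNIV. W i (u i)))\<^sup>2 = (\<Sum>i\<in>UNIV. (norm (P (u i)))\<^sup>2)"
    unfolding of_real_eq_iff .
  also have "\<dots> \<le> (\<Sum>i\<in>UNIV. (norm (u i))\<^sup>2)" by (intro sum_mono power_mono P) simp
  finally show "(norm (\<Sum>i\<in>UNIV. W i (u i)))\<^sup>2 \<le> (\<Sum>i\<in>UNIV. (norm (u i))\<^sup>2)" .
qed

text \<open>The Poisson kernel asks for \<Delta> with \<Delta>*\<Delta> = I - r^2 R, where R =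
  \<Sum> \<open>W\<^sub>i W\<^sub>i\<close>*. As R is an orthogonal projection, the square root is
  explicit: \<Delta> = I - cR with (1 - c)^2 = 1 - r^2.\<close>

lemma row_isometry_pform_nonneg:
  fixes W :: "'n::finite \<Rightarrow> 'a::complex_hilbert \<Rightarrow>\<^sub>L 'a"
  assumes WP: "row_isometry W P" and M: "toep_nonneg k M"
  shows "0 \<le> Re (pform k M W x)"
proof -
  note W = row_isometryD(1)[OF WP]
  define R where "R = (\<lambda>y. \<Sum>i\<in>UNIV. W i (cadj (W i) y))"
  have Ryz: "cinner (R y) z = (\<Sum>i\<in>UNIV. cinner (cadj (W i) y) (cadj (W i) z))" for y z
    unfolding R_def cinner.sum_left cinner_cadj[OF W] ..
  have yRz: "cinner y (R z) = (\<Sum>i\<in>UNIV. cinner (cadj (W i) y) (cadj (W i) z))" for y z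
    unfolding R_def cinner.sum_right cinner_cadj'[OF W] ..
  have PWa: "P (cadj (W i) y) = cadj (W i) y" for i y
    by (rule cinner_ext) (simp only: row_isometryD(2,4)[OF WP] cinner_cadj'[OF W])
  \<comment> \<open>Together with \<open>Ryz\<close> this is idempotence of R: on the range of P the
    W i are isometric with orthogonal ranges, and their adjoints take values there.\<close>
  have RR: "cinner (R y) (R z) = (\<Sum>i\<in>UNIV. cinner (cadj (W i) y) (cadj (W i) z))" for y z
    unfolding R_def cinner.sum_left cinner.sum_right row_isometryD(5)[OF WP] by (simp add: PWa)
  have contr: "(\<Sum>i\<in>UNIV. (norm (cadj (W i) y))\<^sup>2) \<le> (norm y)\<^sup>2" for y
    by (rule row_contr_adjD[OF W row_isometry_row_contr[OF WP]])
  have pos: "0 \<le> Re (pform k M (\<lambda>i. r *\<^sub>R W i) x)" if r: "0 \<le> r" "r < 1" for r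
  proof -
    have r2: "r\<^sup>2 < 1" "0 \<le> r\<^sup>2" using r by (auto simp: power_less_one_iff)
    define d where "d = 1 - sqrt (1 - r\<^sup>2)"
    define c where "c = complex_of_real d"
    have "(1 - d) * (1 - d) = 1 - r\<^sup>2" using r2 by (simp add: d_def)
    then have "d * d - d - d = - (r\<^sup>2)" by (simp add: algebra_simps)
    then have cc: "c * cnj c - c - cnj c = - complex_of_real (r\<^sup>2)"
      unfolding c_def complex_cnj_complex_of_real of_real_mult[symmetric] of_real_diff[symmetric]
        of_real_minus[symmetric] of_real_eq_iff .
    show ?thesis
    proof (rule poisson_nonneg[where \<Delta> = "\<lambda>y. y - c *\<^sub>C R y" and r = "r\<^sup>2"])
      show "r *\<^sub>R W i \<in> bop" for i by (intro bop_scaleR W)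
      show "cinner y z = cinner (y - c *\<^sub>C R y) (z - c *\<^sub>C R z)
          + (\<Sum>i\<in>UNIV. cinner (cadj (r *\<^sub>R W i) y) (cadj (r *\<^sub>R W i) z))" for y z
      proof -
        define q where "q = (\<Sum>i\<in>UNIV. cinner (cadj (W i) y) (cadj (W i) z))"
        have "(\<Sum>i\<in>UNIV. cinner (cadj (r *\<^sub>R W i) y) (cadj (r *\<^sub>R W i) z)) = complex_of_real (r\<^sup>2) * q"
          unfolding q_def cadj_scaleR[OF W] blinfun.scaleR_left cinner.scaleR_left cinner.scaleR_right
            sum_distrib_left by (simp add: scaleR_conv_of_real power2_eq_square mult.assoc)
        moreover have "cinner (y - c *\<^sub>C R y) (z - c *\<^sub>C R z)
            = cinner y z - cnj c * cinner y (R z) - c * cinner (R y) z + c * (cnj c * cinner (R y) (R z))"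
          by (simp only: cinner_simps) (simp add: algebra_simps)
        then have "cinner (y - c *\<^sub>C R y) (z - c *\<^sub>C R z) = cinner y z + (c * cnj c - c - cnj c) * q"
          unfolding RR[of y z] Ryz[of y z] yRz[of y z] q_def[symmetric] by (simp add: algebra_simps)
        ultimately show ?thesis unfolding cc by simp
      qed
      show "(\<Sum>i\<in>UNIV. (norm (cadj (r *\<^sub>R W i) y))\<^sup>2) \<le> r\<^sup>2 * (norm y)\<^sup>2" for y
        using mult_left_mono[OF contr[of y] r2(2)]
        by (simp add: cadj_scaleR[OF W] blinfun.scaleR_left power_mult_distrib sum_distrib_left)
    qed (use r2 M in auto)
  qed
  have "((\<lambda>r::real. Re (\<Sum>s<k. \<Sum>t<k. \<Sum>\<gamma>\<in>poly_supp k M. M \<gamma> s t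
      * ((r ^ length \<gamma>) *\<^sub>R cinner (word_op W \<gamma> (x t)) (x s))))
      \<longlongrightarrow> Re (\<Sum>s<k. \<Sum>t<k. \<Sum>\<gamma>\<in>poly_supp k M. M \<gamma> s t * ((1 ^ length \<gamma>) *\<^sub>R cinner (word_op W \<gamma> (x t)) (x
          s)))) (at_left 1)"
    by (intro tendsto_intros)
  then have "((\<lambda>r::real. Re (pform k M (\<lambda>i. r *\<^sub>R W i) x)) \<longlongrightarrow> Re (pform k M W x)) (at_left 1)"
    unfolding pform_def word_op_scaleR blinfun.scaleR_left cinner.scaleR_left by simp
  then show ?thesis by (rule nonneg_at_left_1) (rule pos)
qed

lemma class_C_bop: "T \<in> class_C \<rho> \<Longrightarrow> T i \<in> bop"
  unfolding class_C_def mem_Collect_eq by (elim conjE) (rule spec)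

text \<open>The Harnack form of T is \<rho> times the form of its row isometry: for nonempty words
  by the dilation equation, for the empty word because 1 + (\<rho> - 1) = \<rho>.\<close>

lemma class_C_form_nonneg:
  fixes T :: "'n::finite \<Rightarrow> 'h::complex_hilbert \<Rightarrow>\<^sub>L 'h"
  assumes \<rho>: "0 < \<rho>" and T: "T \<in> class_C \<rho>" and M: "toep_nonneg k M"
  shows "0 \<le> Re (pform k M T x) + (\<rho> - 1) * Re (pform k M (\<lambda>_. 0) x)"
proof -
  obtain J :: "'h \<Rightarrow>\<^sub>L ('n list \<times> 'h, complex) l2" and W P
    where W: "row_isometry W P" and J: "\<forall>h h'. cinner (J h) (J h') = cinner h h'"
      and dil: "\<forall>\<alpha> h h'. \<alpha> \<noteq> [] \<longrightarrow> cinner (word_op T \<alpha> h) h' = complex_of_real \<rho>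
          * cinner (word_op W \<alpha> (J h)) (J h')"
    using class_C_dilation[OF T] by (elim exE conjE) (rule that; assumption)
  have eq: "cinner (word_op T \<gamma> h) h' + complex_of_real (\<rho> - 1) * cinner (word_op (\<lambda>_. 0) \<gamma> h) h'
      = complex_of_real \<rho> * cinner (word_op W \<gamma> (J h)) (J h')" for \<gamma> h h'
    by (cases "\<gamma> = []") (simp_all add: dil word_op_0 J algebra_simps)
  have aux: "p * (m * w) = m * a + r * (m * b)" if "a + r * b = p * w" for a b m p r w :: complex
    using that by algebra
  have "complex_of_real \<rho> * pform k M W (\<lambda>s. J (x s))
      = pform k M T x + complex_of_real (\<rho> - 1) * pform k M (\<lambda>_. 0) x"
    unfolding pform_def sum_distrib_left sum.distrib[symmetric]
    by (intro sum.cong refl aux eq)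
  from arg_cong[OF this, of Re]
  have "Re (pform k M T x) + (\<rho> - 1) * Re (pform k M (\<lambda>_. 0) x) = \<rho> * Re (pform k M W (\<lambda>s. J (x s)))"
    by simp
  moreover have "0 \<le> Re (pform k M W (\<lambda>s. J (x s)))"
    by (rule row_isometry_pform_nonneg[OF W M])
  ultimately show ?thesis using \<rho> by simp
qed


section \<open>Free holomorphic functions\<close>

definition hom_part :: "('n::finite list \<Rightarrow> complex) \<Rightarrow> nat \<Rightarrow> ('n \<Rightarrow> 'a::complex_hilbert \<Rightarrow>\<^sub>L 'a) \<Rightarrow> 'a \<Rightarrow>\<^sub>L 'a" where
  "hom_part a n X = (\<Sum>\<alpha> | length \<alpha> = n. a \<alpha> *\<^sub>C word_op X \<alpha>)"

definition coeff_norm :: "('n::finite list \<Rightarrow> complex) \<Rightarrow> nat \<Rightarrow> real" where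
  "coeff_norm a n = sqrt (\<Sum>\<alpha> | length \<alpha> = n. (cmod (a \<alpha>))\<^sup>2)"

lemma coeff_norm_nonneg [simp]: "0 \<le> coeff_norm a n"
  by (simp add: coeff_norm_def sum_nonneg)

lemma sum_length_Suc_Cons:
  fixes f :: "'n::finite list \<Rightarrow> 'b::comm_monoid_add"
  shows "(\<Sum>\<alpha> | length \<alpha> = Suc n. f \<alpha>) = (\<Sum>i\<in>UNIV. \<Sum>\<alpha> | length \<alpha> = n. f (i # \<alpha>))"
proof -
  have "(\<Sum>i\<in>UNIV. \<Sum>\<alpha> | length \<alpha> = n. f (i # \<alpha>)) = (\<Sum>p\<in>UNIV \<times> {\<alpha>. length \<alpha> = n}. f (fst p # snd p))"
    by (simp add: sum.cartesian_product split_def)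
  also have "\<dots> = (\<Sum>\<alpha> | length \<alpha> = Suc n. f \<alpha>)"
  proof (rule sum.reindex_bij_betw)
    show "bij_betw (\<lambda>p. fst p # snd p) ((UNIV :: 'n set) \<times> {\<alpha>. length \<alpha> = n}) {\<alpha>. length \<alpha> = Suc n}"
      by (rule bij_betwI[where g = "\<lambda>\<alpha>. (hd \<alpha>, tl \<alpha>)"]) (auto simp: length_Suc_conv)
  qed
  finally show ?thesis ..
qed

text \<open>Splitting off the first letter shows that the row of all words of length n is an
  iterated row contraction. This gives homogeneous parts the Euclidean norm of their coefficients as
  a bound.\<close>

lemma row_contr_words:
  fixes X :: "'n::finite \<Rightarrow> 'a::complex_hilbert \<Rightarrow>\<^sub>L 'a"
  assumes X: "row_contr X"
  shows "(norm (\<Sum>\<alpha> | length \<alpha> = n. word_op X \<alpha> (u \<alpha>)))\<^sup>2 \<le> (\<Sum>\<alpha> | length \<alpha> = n. (norm (u \<alpha>))\<^sup>2)"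
proof (induction n arbitrary: u)
  case (Suc n)
  have "(\<Sum>\<alpha> | length \<alpha> = Suc n. word_op X \<alpha> (u \<alpha>)) = (\<Sum>i\<in>UNIV. X i (\<Sum>\<alpha> | length \<alpha>
      = n. word_op X \<alpha> (u (i # \<alpha>))))"
    unfolding sum_length_Suc_Cons by (simp add: blinfun.sum_right)
  also have "(norm \<dots>)\<^sup>2 \<le> (\<Sum>i\<in>UNIV. (norm (\<Sum>\<alpha> | length \<alpha> = n. word_op X \<alpha> (u (i # \<alpha>))))\<^sup>2)"
    by (rule row_contrD[OF X])
  also have "\<dots> \<le> (\<Sum>i\<in>UNIV. \<Sum>\<alpha> | length \<alpha> = n. (norm (u (i # \<alpha>)))\<^sup>2)"
    by (intro sum_mono Suc)
  finally show ?case unfolding sum_length_Suc_Cons .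
qed simp

lemma norm_hom_part_le:
  assumes X: "row_contr X" "\<And>i. X i \<in> bop"
  shows "norm (hom_part a n X) \<le> coeff_norm a n"
proof (rule norm_blinfun_bound)
  fix x
  have "hom_part a n X x = (\<Sum>\<alpha> | length \<alpha> = n. word_op X \<alpha> (a \<alpha> *\<^sub>C x))"
    by (simp add: hom_part_def blinfun.sum_left scaleC_blinfun.rep_eq bopD[OF word_op_bop[OF X(2)]])
  then have "(norm (hom_part a n X x))\<^sup>2 \<le> (\<Sum>\<alpha> | length \<alpha> = n. (norm (a \<alpha> *\<^sub>C x))\<^sup>2)"
    using row_contr_words[OF X(1)] by simp
  also have "\<dots> = (coeff_norm a n * norm x)\<^sup>2"
    by (simp add: norm_scaleC power_mult_distrib coeff_norm_def sum_nonneg sum_distrib_right)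
  finally show "norm (hom_part a n X x) \<le> coeff_norm a n * norm x"
    by (simp add: power2_le_iff_abs_le)
qed simp

lemma hom_part_bop: "(\<And>i. X i \<in> bop) \<Longrightarrow> hom_part a n X \<in> bop"
  by (simp add: hom_part_def bop_sum bop_scaleC word_op_bop)

lemma hom_part_scaleR: "hom_part a n (\<lambda>i. r *\<^sub>R X i) = r ^ n *\<^sub>R hom_part a n X"
proof -
  have "c *\<^sub>C (s *\<^sub>R T) = s *\<^sub>R (c *\<^sub>C T)" for c s and T :: "'a \<Rightarrow>\<^sub>L 'a"
    by (simp add: scaleR_scaleC scaleC_scaleC mult.commute)
  then show ?thesis by (simp add: hom_part_def word_op_scaleR scaleR_sum_right)
qed

section \<open>Convergence of the homogeneous expansion\<close>

lemma free_holomorphic_summable: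
  assumes a: "free_holomorphic a" and r: "0 \<le> r" "r < 1"
  shows "summable (\<lambda>n. r ^ n * coeff_norm a n)"
proof -
  \<comment> \<open>Chosen with R > 1 and rR < 1: the root condition bounds the coefficients by
    powers of R, and the series is then dominated by a geometric one of ratio rR.\<close>
  define R where "R = 2 / (1 + r)"
  have R: "1 < R" "r * R < 1" "0 \<le> r * R" using r by (auto simp: R_def field_simps)
  define s where "s = (\<lambda>n. \<Sum>\<alpha> | length \<alpha> = n. (cmod (a \<alpha>))\<^sup>2)"
  have s0: "0 \<le> s n" for n by (simp add: s_def sum_nonneg)
  have "limsup (\<lambda>n. ereal (s n powr (1 / (2 * real n)))) < ereal R"
  proof (rule le_less_trans)
    show "limsup (\<lambda>n. ereal (s n powr (1 / (2 * real n)))) \<le> 1"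
      using a unfolding free_holomorphic_def s_def .
    show "1 < ereal R" using R(1) by (simp add: one_ereal_def)
  qed
  then have "\<forall>\<^sub>F n in sequentially. ereal (s n powr (1 / (2 * real n))) < ereal R"
    by (rule Limsup_lessD)
  then have ev: "\<forall>\<^sub>F n in sequentially. norm (r ^ n * coeff_norm a n) \<le> (r * R) ^ n"
    using eventually_gt_at_top[of 0]
  proof eventually_elim
    case (elim n)
    have "s n \<le> (R ^ n)\<^sup>2"
    proof (cases "s n = 0")
      case False
      then have "s n = (s n powr (1 / (2 * real n))) powr (2 * real n)"
        using s0[of n] elim(2) by (simp add: powr_powr)
      also have "\<dots> \<le> R powr (2 * real n)"
        using elim by (intro powr_mono2) auto
      also have "\<dots> = (R ^ n)\<^sup>2"
        using R(1) powr_realpow[of R "2 * n"] by (simp add: power_mult[symmetric] mult.commute)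
      finally show ?thesis .
    qed simp
    then have "sqrt (s n) \<le> R ^ n" using R(1) by (intro real_le_lsqrt) (auto simp: s0)
    then have "coeff_norm a n \<le> R ^ n" by (simp add: coeff_norm_def s_def)
    then show ?case using r by (simp add: power_mult_distrib mult_left_mono)
  qed
  show ?thesis
    by (rule summable_comparison_test_ev[OF ev]) (use R in \<open>simp add: summable_geometric\<close>)
qed

lemma free_eval_hom_part: "free_eval a (\<lambda>i. r *\<^sub>R X i) = (\<Sum>n. r ^ n *\<^sub>R hom_part a n X)"
  unfolding free_eval_def hom_part_def[symmetric] hom_part_scaleR ..

lemma free_eval_summable:
  assumes a: "free_holomorphic a" and r: "0 \<le> r" "r < 1" and C: "\<And>n. norm (hom_part a n X) \<le> C * coeff_norm a n"
  shows "summable (\<lambda>n. r ^ n *\<^sub>R hom_part a n X)" "summable (\<lambda>n. norm (r ^ n *\<^sub>R hom_part a n X))"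
proof -
  have sm: "summable (\<lambda>n. C * (r ^ n * coeff_norm a n))"
    by (intro summable_mult free_holomorphic_summable a r)
  have le: "norm (r ^ n *\<^sub>R hom_part a n X) \<le> C * (r ^ n * coeff_norm a n)" for n
    using mult_left_mono[OF C[of n], of "r ^ n"] r by (simp add: mult_ac)
  show "summable (\<lambda>n. norm (r ^ n *\<^sub>R hom_part a n X))"
    by (rule summable_comparison_test'[OF sm, where N = 0]) (simp only: real_norm_def abs_norm_cancel le)
  then show "summable (\<lambda>n. r ^ n *\<^sub>R hom_part a n X)" by (rule summable_norm_cancel)
qed

lemma free_eval_limit:
  assumes a: "free_holomorphic a" and r: "0 \<le> r" "r < 1" and C: "\<And>n. norm (hom_part a n X) \<le> C * coeff_norm a n"
  shows "(\<lambda>N. \<Sum>n<N. r ^ n *\<^sub>R hom_part a n X) \<longlonglongrightarrow> free_eval a (\<lambda>i. r *\<^sub>R X i)"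
  unfolding free_eval_hom_part using free_eval_summable(1)[OF assms] by (rule summable_LIMSEQ)

lemma closed_bop: "closed bop"
  unfolding closed_sequential_limits
proof (intro allI impI, elim conjE)
  fix S :: "nat \<Rightarrow> 'a::complex_hilbert \<Rightarrow>\<^sub>L 'b::complex_hilbert" and T
  assume S: "\<forall>n. S n \<in> bop" and lim: "S \<longlonglongrightarrow> T"
  have "blinfun_apply T (c *\<^sub>C x) = c *\<^sub>C blinfun_apply T x" for c x
  proof (rule LIMSEQ_unique)
    show "(\<lambda>n. S n (c *\<^sub>C x)) \<longlonglongrightarrow> T (c *\<^sub>C x)" by (intro blinfun.tendsto lim tendsto_const)
    have "(\<lambda>n. c *\<^sub>C S n x) \<longlonglongrightarrow> c *\<^sub>C T x" by (intro tendsto_scaleC blinfun.tendsto lim tendsto_const)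
    then show "(\<lambda>n. S n (c *\<^sub>C x)) \<longlonglongrightarrow> c *\<^sub>C T x" using S by (simp add: bopD)
  qed
  then show "T \<in> bop" by (simp add: bop_def)
qed

lemma free_eval_bop:
  assumes a: "free_holomorphic a" and r: "0 \<le> r" "r < 1" and C: "\<And>n. norm (hom_part a n X) \<le> C * coeff_norm a n"
    and X: "\<And>i. X i \<in> bop"
  shows "free_eval a (\<lambda>i. r *\<^sub>R X i) \<in> bop"
  by (rule closed_sequentially[OF closed_bop _ free_eval_limit[OF a r C]])
    (intro bop_sum bop_scaleR hom_part_bop X)

text \<open>The bound depends on r, N and the coefficients, but not on X. One normalising factor
  will therefore suit all X in the ball.\<close>

lemma free_eval_tail:
  assumes a: "free_holomorphic a" and r: "0 \<le> r" "r < 1" and X: "row_contr X" "\<And>i. X i \<in> bop"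
  shows "norm (free_eval a (\<lambda>i. r *\<^sub>R X i) - (\<Sum>n<N. r ^ n *\<^sub>R hom_part a n X))
    \<le> (\<Sum>n. r ^ (n + N) * coeff_norm a (n + N))"
proof -
  have C: "norm (hom_part a n X) \<le> 1 * coeff_norm a n" for n using norm_hom_part_le[OF X] by simp
  note S = free_eval_summable[OF a r C]
  have "free_eval a (\<lambda>i. r *\<^sub>R X i) - (\<Sum>n<N. r ^ n *\<^sub>R hom_part a n X) = (\<Sum>n. r ^ (n + N) *\<^sub>R hom_part a (n
      + N) X)"
    unfolding free_eval_hom_part suminf_minus_initial_segment[OF S(1), of N] ..
  also have "norm \<dots> \<le> (\<Sum>n. norm (r ^ (n + N) *\<^sub>R hom_part a (n + N) X))"
    using summable_ignore_initial_segment[OF S(2), of N] by (rule summable_norm)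
  also have "\<dots> \<le> (\<Sum>n. r ^ (n + N) * coeff_norm a (n + N))"
  proof (rule suminf_le)
    show "norm (r ^ (n + N) *\<^sub>R hom_part a (n + N) X) \<le> r ^ (n + N) * coeff_norm a (n + N)" for n
      using mult_left_mono[OF C[of "n + N"], of "r ^ (n + N)"] r by simp
    show "summable (\<lambda>n. norm (r ^ (n + N) *\<^sub>R hom_part a (n + N) X))"
      using summable_ignore_initial_segment[OF S(2), of N] .
    show "summable (\<lambda>n. r ^ (n + N) * coeff_norm a (n + N))"
      using summable_ignore_initial_segment[OF free_holomorphic_summable[OF a r], of N] .
  qed
  finally show ?thesis .
qed

lemma norm_blinfun_le_cinner:
  assumes "\<And>x y. cmod (cinner (blinfun_apply T x) y) \<le> C * norm x * norm y" "0 \<le> C"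
  shows "norm T \<le> C"
proof (rule norm_blinfun_bound[OF assms(2)])
  fix x
  have "norm (T x) * norm (T x) \<le> C * norm x * norm (T x)"
    using assms(1)[of x "T x"] unfolding cinner_self norm_of_real by (simp add: power2_eq_square)
  then show "norm (T x) \<le> C * norm x"
    using assms(2) by (cases "T x = 0") simp_all
qed

text \<open>Compressing the row isometry costs a factor \<rho> when n > 0. The constant term lies
  outside the dilation equation and needs a factor 1, which \<rho> alone would not provide when
  \<rho> < 1; \<rho> + 1 covers both.\<close>

lemma norm_hom_part_class_C:
  fixes T :: "'n::finite \<Rightarrow> 'h::complex_hilbert \<Rightarrow>\<^sub>L 'h"
  assumes \<rho>: "0 < \<rho>" and T: "T \<in> class_C \<rho>"
  shows "norm (hom_part a n T) \<le> (\<rho> + 1) * coeff_norm a n"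
proof (cases "n = 0")
  case True
  have "norm (a [] *\<^sub>C id_blinfun :: 'h \<Rightarrow>\<^sub>L 'h) \<le> cmod (a [])"
    by (rule norm_blinfun_bound) (simp_all add: scaleC_blinfun.rep_eq norm_scaleC)
  also have "\<dots> \<le> (\<rho> + 1) * cmod (a [])"
    using \<rho> by (simp add: mult_right_mono distrib_right)
  finally show ?thesis using True by (simp add: hom_part_def coeff_norm_def)
next
  case False
  obtain J :: "'h \<Rightarrow>\<^sub>L ('n list \<times> 'h, complex) l2" and W P
    where W: "row_isometry W P" and J: "\<forall>h h'. cinner (J h) (J h') = cinner h h'"
      and dil: "\<forall>\<alpha> h h'. \<alpha> \<noteq> [] \<longrightarrow> cinner (word_op T \<alpha> h) h' = complex_of_real \<rho>
          * cinner (word_op W \<alpha> (J h)) (J h')"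
    using class_C_dilation[OF T] by (elim exE conjE) (rule that; assumption)
  have normJ: "norm (J h) = norm h" for h
    using J by (intro norm_eq_if_cinner_eq) blast
  have "norm (hom_part a n T) \<le> \<rho> * coeff_norm a n"
  proof (rule norm_blinfun_le_cinner)
    fix h h'
    have "cinner (hom_part a n T h) h' = (\<Sum>\<alpha> | length \<alpha> = n. a \<alpha> * cinner (word_op T \<alpha> h) h')"
      by (simp add: hom_part_def blinfun.sum_left scaleC_blinfun.rep_eq cinner_simps)
    also have "\<dots> = (\<Sum>\<alpha> | length \<alpha> = n. complex_of_real \<rho> * (a \<alpha> * cinner (word_op W \<alpha> (J h)) (J h')))"
      by (intro sum.cong refl) (use False dil in auto)
    also have "\<dots> = complex_of_real \<rho> * cinner (hom_part a n W (J h)) (J h')"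
      by (simp add: hom_part_def blinfun.sum_left scaleC_blinfun.rep_eq cinner_simps sum_distrib_left)
    finally have "cmod (cinner (hom_part a n T h) h') = \<rho> * cmod (cinner (hom_part a n W (J h)) (J h'))"
      using \<rho> by (simp add: norm_mult)
    also have "\<dots> \<le> \<rho> * (norm (hom_part a n W (J h)) * norm (J h'))"
      using \<rho> by (intro mult_left_mono cmod_cinner_le) auto
    also have "\<dots> \<le> \<rho> * ((coeff_norm a n * norm (J h)) * norm (J h'))"
    proof (intro mult_left_mono mult_right_mono)
      have "norm (hom_part a n W (J h)) \<le> norm (hom_part a n W) * norm (J h)" by (rule norm_blinfun)
      also have "\<dots> \<le> coeff_norm a n * norm (J h)"
        by (intro mult_right_mono norm_hom_part_le row_isometry_row_contr[OF W] row_isometryD[OF W]) simp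
      finally show "norm (hom_part a n W (J h)) \<le> coeff_norm a n * norm (J h)" .
    qed (use \<rho> in auto)
    finally show "cmod (cinner (hom_part a n T h) h') \<le> \<rho> * coeff_norm a n * norm h * norm h'"
      by (simp add: normJ mult_ac)
  qed (use \<rho> in simp)
  then show ?thesis by (simp add: distrib_right add_increasing2)
qed

lemma pform_superset:
  assumes "finite F" "poly_supp k M \<subseteq> F"
  shows "pform k M X x = (\<Sum>s<k. \<Sum>t<k. \<Sum>\<alpha>\<in>F. M \<alpha> s t * cinner (word_op X \<alpha> (x t)) (x s))"
  unfolding pform_def
proof (rule sum.cong[OF refl], rule sum.cong[OF refl])
  fix s t assume st: "s \<in> {..<k}" "t \<in> {..<k}"
  show "(\<Sum>\<alpha>\<in>poly_supp k M. M \<alpha> s t * cinner (word_op X \<alpha> (x t)) (x s))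
      = (\<Sum>\<alpha>\<in>F. M \<alpha> s t * cinner (word_op X \<alpha> (x t)) (x s))"
  proof (rule sum.mono_neutral_left[OF assms], rule ballI)
    fix \<alpha> assume "\<alpha> \<in> F - poly_supp k M"
    then have "M \<alpha> s t = 0" using st unfolding poly_supp_def by blast
    then show "M \<alpha> s t * cinner (word_op X \<alpha> (x t)) (x s) = 0" by simp
  qed
qed

section \<open>Creation operators and a von Neumann inequality for the class\<close>

lemma creation_bop: "creation i \<in> bop"
  unfolding bop_def
  by (auto simp: creation.rep_eq l2_nth_inject[symmetric] creation_fun.rep_eq scaleC_l2.rep_eq
      prefix_coords_def fun_eq_iff split: list.splits)

lemma creation_basis: "blinfun_apply (creation i) (l2_basis \<alpha>) = l2_basis (i # \<alpha>)"
  by (auto simp: creation.rep_eq l2_nth_inject[symmetric] creation_fun.rep_eq l2_basis.rep_eq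
      prefix_coords_def fun_eq_iff split: list.splits)

lemma word_creation_basis: "blinfun_apply (word_op creation \<gamma>) (l2_basis \<alpha>) = l2_basis (\<gamma> @ \<alpha>)"
  by (induction \<gamma>) (simp_all add: creation_basis)

lemma toep_eq_pform_creation:
  fixes M :: "'n::finite list \<Rightarrow> nat \<Rightarrow> nat \<Rightarrow> complex"
  shows "toep k M \<zeta> N = pform k M creation (\<lambda>s. \<Sum>\<alpha> | length \<alpha> \<le> N. \<zeta> s \<alpha> *\<^sub>C l2_basis \<alpha>)"
proof -
  have "cinner (word_op creation \<gamma> (\<Sum>\<alpha> | length \<alpha> \<le> N. \<zeta> t \<alpha> *\<^sub>C l2_basis \<alpha>)) (\<Sum>\<alpha> | length \<alpha>
      \<le> N. \<zeta> s \<alpha> *\<^sub>C l2_basis \<alpha>)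
      = (\<Sum>\<alpha> | length \<gamma> + length \<alpha> \<le> N. \<zeta> t \<alpha> * cnj (\<zeta> s (\<gamma> @ \<alpha>)))" for s t \<gamma>
    by (rule cinner_word_combination[OF creation_bop]) (auto simp: word_creation_basis l2_nth_basis)
  then show ?thesis unfolding toep_def pform_def by simp
qed

lemma creation_row_contr: "row_contr (creation :: 'n::finite \<Rightarrow> _)"
proof (rule row_isometry_row_contr[where P = id_blinfun])
  have orth: "cinner (creation i x) (creation j y) = 0" if "i \<noteq> j" for i j :: 'n and x y
    unfolding cinner_l2_def
    by (rule infsum_0) (use that in \<open>auto simp: creation.rep_eq creation_fun.rep_eq prefix_coords_def
        split: list.splits\<close>)
  have "cinner (creation i x) (creation i y) = cinner x y" for i :: 'n and x y
    by (rule isometry_cinner[OF creation_bop, where G = UNIV]) (auto simp: creation.rep_eq norm_creation_fun)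
  then show "row_isometry (creation :: 'n \<Rightarrow> _) id_blinfun"
    unfolding row_isometry_def using creation_bop orth by auto
qed

lemma sum_length_less:
  fixes f :: "'n::finite list \<Rightarrow> 'b::comm_monoid_add"
  shows "(\<Sum>n<N. \<Sum>\<alpha> | length \<alpha> = n. f \<alpha>) = (\<Sum>\<alpha> | length \<alpha> < N. f \<alpha>)"
proof (induction N)
  case (Suc N)
  have "{\<alpha> :: 'n list. length \<alpha> < Suc N} = {\<alpha>. length \<alpha> < N} \<union> {\<alpha>. length \<alpha> = N}" by auto
  moreover have "finite {\<alpha> :: 'n list. length \<alpha> < N}"
    by (rule finite_subset[OF _ finite_words[of N]]) auto
  ultimately have "(\<Sum>\<alpha> | length \<alpha> < Suc N. f \<alpha>) = (\<Sum>\<alpha> | length \<alpha> < N. f \<alpha>) + (\<Sum>\<alpha> | length \<alpha> = N. f \<alpha>)"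
    by (simp only:) (rule sum.union_disjoint, auto)
  then show ?case using Suc by simp
qed simp

text \<open>The hypothesis is positivity of the block matrix with c on the diagonal and g, g* off
  it; z is taken opposite to g y.\<close>

lemma norm_le_if_form_nonneg:
  fixes g :: "'a::complex_hilbert \<Rightarrow>\<^sub>L 'a"
  assumes c: "0 \<le> c" and pos: "\<And>y z. 0 \<le> c * ((norm z)\<^sup>2 + (norm y)\<^sup>2) + 2 * Re (cinner (g y) z)"
  shows "norm g \<le> c"
proof (rule norm_blinfun_bound[OF c])
  fix y
  show "norm (g y) \<le> c * norm y"
  proof (cases "g y = 0 \<or> y = 0")
    case True
    then show ?thesis using c by (auto simp: blinfun.zero_right)
  next
    case False
    \<comment> \<open>Scales z = -t g(y) to the norm of y, which balances the two squares.\<close>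
    define t where "t = norm y / norm (g y)"
    have t: "t > 0" "t * norm (g y) = norm y" using False by (simp_all add: t_def)
    have "Re (cinner (g y) ((- t) *\<^sub>R g y)) = - t * (norm (g y))\<^sup>2"
      by (simp add: inner_eq_Re_cinner[symmetric] power2_norm_eq_inner)
    also have "\<dots> = - norm y * norm (g y)"
      using t(2) by (simp add: power2_eq_square mult.assoc[symmetric])
    finally have "0 \<le> c * ((norm ((- t) *\<^sub>R g y))\<^sup>2 + (norm y)\<^sup>2) + 2 * (- norm y * norm (g y))"
      using pos[of "(- t) *\<^sub>R g y" y] by simp
    then have "0 \<le> c * ((norm y)\<^sup>2 + (norm y)\<^sup>2) + 2 * (- norm y * norm (g y))"
      using t by simp
    then have "norm y * norm (g y) \<le> norm y * (c * norm y)"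
      by (simp add: power2_eq_square algebra_simps)
    then show ?thesis using False by simp
  qed
qed

text \<open>A von Neumann inequality with factor \<rho>. For m the norm at the creation operators,
  the matrix polynomial with diagonal m and upper corner 2b has nonnegative real part on Fock space.
  Since b has no constant term, adding \<rho> - 1 times the value at 0 changes only the diagonal,
  from m to \<rho> m.\<close>

lemma norm_polynomial_le:
  fixes T :: "'n::finite \<Rightarrow> 'h::complex_hilbert \<Rightarrow>\<^sub>L 'h"
  assumes \<rho>: "0 < \<rho>" and T: "T \<in> class_C \<rho>" and b0: "b [] = 0"
  shows "norm (\<Sum>n<N. hom_part b n T) \<le> \<rho> * norm (\<Sum>n<N. hom_part b n (creation :: 'n \<Rightarrow> _))"
proof -
  define m where "m = norm (\<Sum>n<N. hom_part b n (creation :: 'n \<Rightarrow> _))"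
  define M :: "'n list \<Rightarrow> nat \<Rightarrow> nat \<Rightarrow> complex" where
    "M = (\<lambda>\<gamma> s t. (if \<gamma> = [] \<and> s = t then complex_of_real m else 0)
       + (if s = 0 \<and> t = 1 \<and> length \<gamma> < N then 2 * b \<gamma> else 0))"
  define F where "F = {\<gamma> :: 'n list. length \<gamma> \<le> N}"
  have fF: "finite F" unfolding F_def by (rule finite_words)
  have supp: "poly_supp 2 M \<subseteq> F"
    by (auto simp: poly_supp_def M_def F_def split: if_splits)
  have form: "pform 2 M X x = complex_of_real (m * ((norm (x 0))\<^sup>2 + (norm (x 1))\<^sup>2))
      + 2 * cinner ((\<Sum>n<N. hom_part b n X) (x 1)) (x 0)" for X :: "'n \<Rightarrow> 'c::complex_hilbert \<Rightarrow>\<^sub>L 'c" and x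
  proof -
    have diag: "(\<Sum>\<gamma>\<in>F. M \<gamma> s s * cinner (word_op X \<gamma> (x s)) (x s)) = complex_of_real (m * (norm (x s))\<^sup>2)" for s
    proof -
      have "(\<Sum>\<gamma>\<in>F. M \<gamma> s s * cinner (word_op X \<gamma> (x s)) (x s))
          = (\<Sum>\<gamma>\<in>F. if \<gamma> = [] then complex_of_real m * cinner (x s) (x s) else 0)"
        by (intro sum.cong refl) (auto simp: M_def)
      then show ?thesis using fF by (simp add: F_def cinner_self)
    qed
    have off: "(\<Sum>\<gamma>\<in>F. M \<gamma> 1 0 * cinner (word_op X \<gamma> (x 0)) (x 1)) = 0"
      by (intro sum.neutral) (simp add: M_def)
    have "(\<Sum>n<N. hom_part b n X) = (\<Sum>\<gamma> | length \<gamma> < N. b \<gamma> *\<^sub>C word_op X \<gamma>)"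
      unfolding hom_part_def by (rule sum_length_less)
    then have "2 * cinner ((\<Sum>n<N. hom_part b n X) (x 1)) (x 0)
        = (\<Sum>\<gamma> | length \<gamma> < N. 2 * b \<gamma> * cinner (word_op X \<gamma> (x 1)) (x 0))"
      by (simp add: blinfun.sum_left scaleC_blinfun.rep_eq cinner.sum_left cinner_scaleC_left
          sum_distrib_left mult.assoc)
    also have "\<dots> = (\<Sum>\<gamma>\<in>F. M \<gamma> 0 1 * cinner (word_op X \<gamma> (x 1)) (x 0))"
      using fF by (intro sum.mono_neutral_cong_left) (auto simp: F_def M_def)
    finally have on: "(\<Sum>\<gamma>\<in>F. M \<gamma> 0 1 * cinner (word_op X \<gamma> (x 1)) (x 0))
        = 2 * cinner ((\<Sum>n<N. hom_part b n X) (x 1)) (x 0)" ..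
    have two: "(\<Sum>s<2. f s) = f 0 + f 1" for f :: "nat \<Rightarrow> complex" by (simp add: numeral_2_eq_2)
    show ?thesis
      unfolding pform_superset[OF fF supp] two diag off on by (simp add: distrib_left)
  qed
  have m0: "0 \<le> m" by (simp add: m_def)
  have "toep_nonneg 2 M"
    unfolding toep_nonneg_def toep_eq_pform_creation form
  proof (intro allI)
    fix N' and \<zeta> :: "nat \<Rightarrow> 'n list \<Rightarrow> complex"
    let ?x = "\<lambda>s. \<Sum>\<alpha> | length \<alpha> \<le> N'. \<zeta> s \<alpha> *\<^sub>C l2_basis \<alpha>"
    let ?g = "\<Sum>n<N. hom_part b n (creation :: 'n \<Rightarrow> _)"
    have "cmod (cinner (?g (?x 1)) (?x 0)) \<le> norm (?g (?x 1)) * norm (?x 0)" by (rule cmod_cinner_le)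
    also have "\<dots> \<le> m * norm (?x 1) * norm (?x 0)"
      unfolding m_def by (intro mult_right_mono norm_blinfun) simp
    finally have "2 * cmod (cinner (?g (?x 1)) (?x 0)) \<le> m * (2 * norm (?x 0) * norm (?x 1))"
      by (simp add: mult_ac)
    also have "\<dots> \<le> m * ((norm (?x 0))\<^sup>2 + (norm (?x 1))\<^sup>2)"
      by (intro mult_left_mono sum_squares_bound m0)
    finally have "- (2 * Re (cinner (?g (?x 1)) (?x 0))) \<le> m * ((norm (?x 0))\<^sup>2 + (norm (?x 1))\<^sup>2)"
      using abs_Re_le_cmod[of "cinner (?g (?x 1)) (?x 0)"] by linarith
    then show "0 \<le> Re (complex_of_real (m * ((norm (?x 0))\<^sup>2 + (norm (?x 1))\<^sup>2)) + 2 * cinner (?g (?x 1)) (?x 0))"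
      by simp
  qed
  note pos = class_C_form_nonneg[OF \<rho> T this, unfolded form]
  have "hom_part b n (\<lambda>_. 0 :: 'h \<Rightarrow>\<^sub>L 'h) = 0" for n
    unfolding hom_part_def
  proof (intro sum.neutral ballI)
    fix \<alpha> :: "'n list"
    show "b \<alpha> *\<^sub>C word_op (\<lambda>_. 0 :: 'h \<Rightarrow>\<^sub>L 'h) \<alpha> = 0"
      by (cases "\<alpha> = []") (simp_all add: b0 word_op_0)
  qed
  then have zero: "(\<Sum>n<N. hom_part b n (\<lambda>_. 0 :: 'h \<Rightarrow>\<^sub>L 'h)) = 0" by simp
  have "norm (\<Sum>n<N. hom_part b n T) \<le> \<rho> * m"
  proof (rule norm_le_if_form_nonneg)
    fix y z :: 'h
    show "0 \<le> \<rho> * m * ((norm z)\<^sup>2 + (norm y)\<^sup>2) + 2 * Re (cinner ((\<Sum>n<N. hom_part b n T) y) z)"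
      using pos[of "\<lambda>s. if s = 0 then z else y"] unfolding zero by (simp add: algebra_simps)
  qed (use \<rho> m0 in simp)
  then show ?thesis by (simp add: m_def)
qed

text \<open>In the difference of two radii the constant terms cancel, which makes the von Neumann
  inequality available. The estimate transfers convergence as r tends to 1 from the creation
  operators to T.\<close>

lemma norm_free_eval_diff_le:
  fixes T :: "'n::finite \<Rightarrow> 'h::complex_hilbert \<Rightarrow>\<^sub>L 'h"
  assumes a: "free_holomorphic a" and \<rho>: "0 < \<rho>" and T: "T \<in> class_C \<rho>"
    and r: "0 \<le> r" "r < 1" and r': "0 \<le> r'" "r' < 1"
  shows "norm (free_eval a (\<lambda>i. r *\<^sub>R T i) - free_eval a (\<lambda>i. r' *\<^sub>R T i))
    \<le> \<rho> * norm (free_eval a (\<lambda>i. r *\<^sub>R (creation :: 'n \<Rightarrow> _) i) - free_eval a (\<lambda>i. r' *\<^sub>R (creation :: 'n \<Rightarrow> _) i))"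
proof -
  define b where "b = (\<lambda>\<alpha> :: 'n list. complex_of_real (r ^ length \<alpha> - r' ^ length \<alpha>) * a \<alpha>)"
  have hom: "hom_part b n X = r ^ n *\<^sub>R hom_part a n X - r' ^ n *\<^sub>R hom_part a n X"
    for n and X :: "'n \<Rightarrow> 'c::complex_hilbert \<Rightarrow>\<^sub>L 'c"
  proof -
    have "hom_part b n X = (\<Sum>\<alpha> | length \<alpha> = n. (r ^ n - r' ^ n) *\<^sub>R (a \<alpha> *\<^sub>C word_op X \<alpha>))"
      unfolding hom_part_def by (intro sum.cong refl) (simp add: b_def scaleR_scaleC scaleC_scaleC)
    then show ?thesis by (simp add: hom_part_def scaleR_sum_right scaleR_diff_left sum_subtractf)
  qed
  have lim: "(\<lambda>N. norm (\<Sum>n<N. hom_part b n X)) \<longlonglongrightarrow> norm (free_eval a (\<lambda>i. r *\<^sub>R X i)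
      - free_eval a (\<lambda>i. r' *\<^sub>R X i))"
    if C: "\<And>n. norm (hom_part a n X) \<le> C * coeff_norm a n" for X :: "'n \<Rightarrow> 'c::complex_hilbert \<Rightarrow>\<^sub>L 'c" and C
    unfolding hom sum_subtractf
    by (intro tendsto_norm tendsto_diff free_eval_limit[OF a r C] free_eval_limit[OF a r' C])
  have C1: "norm (hom_part a n (creation :: 'n \<Rightarrow> _)) \<le> 1 * coeff_norm a n" for n
    using norm_hom_part_le[OF creation_row_contr creation_bop] by simp
  show ?thesis
  proof (rule LIMSEQ_le[OF lim tendsto_mult_left[OF lim]])
    show "norm (hom_part a n T) \<le> (\<rho> + 1) * coeff_norm a n" for n by (rule norm_hom_part_class_C[OF \<rho> T])
    show "norm (hom_part a n (creation :: 'n \<Rightarrow> _)) \<le> 1 * coeff_norm a n" for n by (rule C1)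
    have "b [] = 0" by (simp add: b_def)
    then show "\<exists>N. \<forall>n\<ge>N. norm (\<Sum>n<n. hom_part b n T) \<le> \<rho> * norm (\<Sum>n<n. hom_part b n (creation :: 'n \<Rightarrow> _))"
      using norm_polynomial_le[OF \<rho> T] by blast
  qed
qed

text \<open>\<open>free_apply\<close> is defined through \<open>Lim\<close>, so existence of the
  limit has to be proved. It comes from norm convergence at the creation operators, by
  completeness.\<close>

lemma free_apply_tendsto:
  fixes T :: "'n::finite \<Rightarrow> 'h::complex_hilbert \<Rightarrow>\<^sub>L 'h"
  assumes a: "free_holomorphic (a j)" "boundary_in_disc_algebra (a j)" and \<rho>: "0 < \<rho>" and T: "T \<in> class_C \<rho>"
  shows "((\<lambda>r. free_eval (a j) (\<lambda>i. r *\<^sub>R T i)) \<longlongrightarrow> free_apply a T j) (at_left 1)"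
proof -
  define F where "F = (\<lambda>r::real. free_eval (a j) (\<lambda>i. r *\<^sub>R T i))"
  define S where "S = (\<lambda>r::real. free_eval (a j) (\<lambda>i. r *\<^sub>R (creation :: 'n \<Rightarrow> _) i))"
  obtain S1 where S1: "(S \<longlongrightarrow> S1) (at_left 1)"
    using a(2) unfolding boundary_in_disc_algebra_def S_def by blast
  have FS: "norm (F r - F r') \<le> \<rho> * norm (S r - S r')" if "0 \<le> r" "r < 1" "0 \<le> r'" "r' < 1" for r r'
    unfolding F_def S_def by (rule norm_free_eval_diff_le[OF a(1) \<rho> T that])
  \<comment> \<open>The limit L is found along this sequence, where the Cauchy criterion applies;
    the bound \<open>le\<close> then gives the full one-sided limit.\<close>
  define q where "q = (\<lambda>n. 1 - 1 / real (Suc n))"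
  have q: "0 \<le> q n" "q n < 1" for n by (simp_all add: q_def)
  have "q \<longlonglongrightarrow> 1 - 0" unfolding q_def by (intro tendsto_intros LIMSEQ_Suc lim_1_over_n)
  then have q1: "filterlim q (at_left 1) sequentially"
    unfolding filterlim_at using q(2) by (auto simp: less_imp_neq intro!: always_eventually)
  have Sq: "(\<lambda>n. S (q n)) \<longlonglongrightarrow> S1" by (rule filterlim_compose[OF S1 q1])
  have "Cauchy (\<lambda>n. F (q n))"
  proof (rule CauchyI)
    fix e :: real assume "e > 0"
    then have "e / \<rho> > 0" using \<rho> by simp
    then obtain M where M: "\<And>m n. m \<ge> M \<Longrightarrow> n \<ge> M \<Longrightarrow> norm (S (q m) - S (q n)) < e / \<rho>"
      using CauchyD[OF LIMSEQ_imp_Cauchy[OF Sq]] by blast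
    have "norm (F (q m) - F (q n)) < e" if "m \<ge> M" "n \<ge> M" for m n
      using FS[OF q q, of m n] M[OF that] \<rho> by (simp add: field_simps)
    then show "\<exists>M. \<forall>m\<ge>M. \<forall>n\<ge>M. norm (F (q m) - F (q n)) < e" by blast
  qed
  then obtain L where L: "(\<lambda>n. F (q n)) \<longlonglongrightarrow> L" by (auto simp: Cauchy_convergent_iff convergent_def)
  have le: "norm (F r - L) \<le> \<rho> * norm (S r - S1)" if "0 \<le> r" "r < 1" for r
  proof (rule LIMSEQ_le)
    show "(\<lambda>n. norm (F r - F (q n))) \<longlonglongrightarrow> norm (F r - L)" by (intro tendsto_intros L)
    show "(\<lambda>n. \<rho> * norm (S r - S (q n))) \<longlonglongrightarrow> \<rho> * norm (S r - S1)" by (intro tendsto_intros Sq)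
    show "\<exists>N. \<forall>n\<ge>N. norm (F r - F (q n)) \<le> \<rho> * norm (S r - S (q n))" using FS[OF that q] by blast
  qed
  have "(F \<longlongrightarrow> L) (at_left 1)"
  proof (rule LIM_zero_cancel, rule Lim_null_comparison)
    show "\<forall>\<^sub>F r in at_left 1. norm (F r - L) \<le> \<rho> * norm (S r - S1)"
      using eventually_at_left_1 by eventually_elim (use le in blast)
    show "((\<lambda>r. \<rho> * norm (S r - S1)) \<longlongrightarrow> 0) (at_left 1)"
      using tendsto_mult_right_zero[OF tendsto_norm_zero[OF LIM_zero[OF S1]]] .
  qed
  moreover from this have "free_apply a T j = L"
    unfolding free_apply_def F_def by (intro tendsto_Lim) auto
  ultimately show ?thesis by (simp add: F_def)
qed

lemma free_apply_bop:
  fixes T :: "'n::finite \<Rightarrow> 'h::complex_hilbert \<Rightarrow>\<^sub>L 'h"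
  assumes a: "free_holomorphic (a j)" "boundary_in_disc_algebra (a j)" and \<rho>: "0 < \<rho>" and T: "T \<in> class_C \<rho>"
  shows "free_apply a T j \<in> bop"
proof (rule Lim_in_closed_set[OF closed_bop _ _ free_apply_tendsto[where a = a and j = j, OF assms]])
  show "\<forall>\<^sub>F r in at_left 1. free_eval (a j) (\<lambda>i. r *\<^sub>R T i) \<in> bop"
    using eventually_at_left_1 by eventually_elim
      (intro free_eval_bop[OF a(1) _ _ norm_hom_part_class_C[OF \<rho> T] class_C_bop[OF T]]; blast)
qed simp


section \<open>Composition with polynomials\<close>

lemma tendsto_word_op:
  assumes "\<And>j. ((\<lambda>n. Y n j) \<longlongrightarrow> L j) F"
  shows "((\<lambda>n. word_op (Y n) \<gamma>) \<longlongrightarrow> word_op L \<gamma>) F"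
  by (induction \<gamma>) (auto intro!: bounded_bilinear.tendsto[OF bounded_bilinear_blinfun_compose] assms)

lemma tendsto_pform:
  assumes "\<And>j. ((\<lambda>n. Y n j) \<longlongrightarrow> L j) F"
  shows "((\<lambda>n. pform k M (Y n) x) \<longlongrightarrow> pform k M L x) F"
  unfolding pform_def
  by (intro tendsto_sum tendsto_mult tendsto_const cinner.tendsto blinfun.tendsto tendsto_word_op assms)

definition conv :: "('n list \<Rightarrow> complex) \<Rightarrow> ('n list \<Rightarrow> complex) \<Rightarrow> 'n list \<Rightarrow> complex" where
  "conv c d \<alpha> = (\<Sum>i\<le>length \<alpha>. c (take i \<alpha>) * d (drop i \<alpha>))"

primrec comp_coeff :: "('m \<Rightarrow> 'n list \<Rightarrow> complex) \<Rightarrow> 'm list \<Rightarrow> 'n list \<Rightarrow> complex" where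
  "comp_coeff b [] = (\<lambda>\<alpha>. if \<alpha> = [] then 1 else 0)"
| "comp_coeff b (j # \<gamma>) = conv (b j) (comp_coeff b \<gamma>)"

text \<open>The coefficients of p(b) as a polynomial in the inner variables:
  \<open>comp_coeff b \<gamma>\<close> expands the product of the b j along \<gamma>, and the values
  of p are the matrix weights.\<close>

definition comp_poly ::
    "nat \<Rightarrow> ('m list \<Rightarrow> nat \<Rightarrow> nat \<Rightarrow> complex) \<Rightarrow> ('m \<Rightarrow> 'n list \<Rightarrow> complex) \<Rightarrow> 'n list \<Rightarrow> nat \<Rightarrow> nat \<Rightarrow> complex" where
  "comp_poly k M b \<alpha> s t = (\<Sum>\<gamma>\<in>poly_supp k M. M \<gamma> s t * comp_coeff b \<gamma> \<alpha>)"

lemma conv_supp: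
  assumes "\<And>\<alpha>. N < length \<alpha> \<Longrightarrow> c \<alpha> = 0" "\<And>\<alpha>. L < length \<alpha> \<Longrightarrow> d \<alpha> = 0" "N + L < length \<alpha>"
  shows "conv c d \<alpha> = 0"
  unfolding conv_def
proof (intro sum.neutral ballI)
  fix i assume "i \<in> {..length \<alpha>}"
  then have "N < length (take i \<alpha>) \<or> L < length (drop i \<alpha>)" using assms(3) by auto
  then show "c (take i \<alpha>) * d (drop i \<alpha>) = 0" using assms(1,2) by auto
qed

lemma conv_eval:
  fixes X :: "'n::finite \<Rightarrow> 'a::complex_hilbert \<Rightarrow>\<^sub>L 'a"
  assumes c: "\<And>\<alpha>. N < length \<alpha> \<Longrightarrow> c \<alpha> = 0" and d: "\<And>\<alpha>. L < length \<alpha> \<Longrightarrow> d \<alpha> = 0"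
    and X: "\<And>i. X i \<in> bop"
  shows "(\<Sum>\<alpha> | length \<alpha> \<le> N. c \<alpha> *\<^sub>C word_op X \<alpha>) o\<^sub>L (\<Sum>\<alpha> | length \<alpha> \<le> L. d \<alpha> *\<^sub>C word_op X \<alpha>)
    = (\<Sum>\<alpha> | length \<alpha> \<le> N + L. conv c d \<alpha> *\<^sub>C word_op X \<alpha>)"
proof (rule blinfun_eqI)
  fix x
  define A B U where "A = {\<alpha> :: 'n list. length \<alpha> \<le> N}" and "B = {\<alpha> :: 'n list. length \<alpha> \<le> L}"
    and "U = {\<alpha> :: 'n list. length \<alpha> \<le> N + L}"
  have fin: "finite A" "finite B" "finite U" unfolding A_def B_def U_def by (rule finite_words)+
  define f where "f = (\<lambda>\<beta> \<delta>. (c \<beta> * d \<delta>) *\<^sub>C word_op X (\<beta> @ \<delta>) x)"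
  have "((\<Sum>\<alpha>\<in>A. c \<alpha> *\<^sub>C word_op X \<alpha>) o\<^sub>L (\<Sum>\<alpha>\<in>B. d \<alpha> *\<^sub>C word_op X \<alpha>)) x = (\<Sum>\<beta>\<in>A. \<Sum>\<delta>\<in>B. f \<beta> \<delta>)"
    by (subst sum.swap) (simp add: f_def blinfun.sum_left blinfun.sum_right scaleC_blinfun.rep_eq
        scaleC_sum_right scaleC_scaleC bopD[OF word_op_bop[OF X]] word_op_append)
  also have "\<dots> = (\<Sum>p\<in>A \<times> B. f (fst p) (snd p))"
    by (simp add: sum.cartesian_product split_def)
  \<comment> \<open>The rectangle of pairs is enlarged, by vanishing terms, to all pairs of total
    length at most N + L; these correspond one to one to a word together with a cutting
    position.\<close>
  also have "\<dots> = (\<Sum>p | length (fst p @ snd p) \<le> N + L. f (fst p) (snd p))"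
  proof (rule sum.mono_neutral_left)
    show "finite {p :: 'n list \<times> 'n list. length (fst p @ snd p) \<le> N + L}"
      by (rule finite_subset[OF _ finite_cartesian_product[OF fin(3) fin(3)]]) (auto simp: U_def)
    show "A \<times> B \<subseteq> {p. length (fst p @ snd p) \<le> N + L}" by (auto simp: A_def B_def)
    show "\<forall>p\<in>{p. length (fst p @ snd p) \<le> N + L} - A \<times> B. f (fst p) (snd p) = 0"
    proof
      fix p assume "p \<in> {p. length (fst p @ snd p) \<le> N + L} - A \<times> B"
      then have "fst p \<notin> A \<or> snd p \<notin> B" by (auto simp: mem_Times_iff)
      then have "c (fst p) = 0 \<or> d (snd p) = 0"
        using c[of "fst p"] d[of "snd p"] by (auto simp: A_def B_def not_le)
      then show "f (fst p) (snd p) = 0" by (auto simp: f_def)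
    qed
  qed
  also have "\<dots> = (\<Sum>p\<in>Sigma U (\<lambda>\<alpha>. {..length \<alpha>}). f (take (snd p) (fst p)) (drop (snd p) (fst p)))"
    by (rule sum.reindex_bij_witness[where j = "\<lambda>p. (fst p @ snd p, length (fst p))"
          and i = "\<lambda>p. (take (snd p) (fst p), drop (snd p) (fst p))"])
      (auto simp: U_def)
  also have "\<dots> = (\<Sum>\<alpha>\<in>U. \<Sum>i\<le>length \<alpha>. f (take i \<alpha>) (drop i \<alpha>))"
    using fin by (simp add: sum.Sigma split_def)
  also have "\<dots> = (\<Sum>\<alpha>\<in>U. conv c d \<alpha> *\<^sub>C word_op X \<alpha>) x"
    unfolding blinfun.sum_left
  proof (intro sum.cong refl)
    fix \<alpha>
    have "(\<Sum>i\<in>I. e i) *\<^sub>C (y :: 'a) = (\<Sum>i\<in>I. e i *\<^sub>C y)" for I :: "nat set" and e y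
      by (induction I rule: infinite_finite_induct) (simp_all add: scaleC_add_left)
    then show "(\<Sum>i\<le>length \<alpha>. f (take i \<alpha>) (drop i \<alpha>)) = (conv c d \<alpha> *\<^sub>C word_op X \<alpha>) x"
      by (simp add: f_def conv_def scaleC_blinfun.rep_eq)
  qed
  finally show "((\<Sum>\<alpha> | length \<alpha> \<le> N. c \<alpha> *\<^sub>C word_op X \<alpha>) o\<^sub>L (\<Sum>\<alpha> | length \<alpha> \<le> L. d \<alpha> *\<^sub>C word_op X \<alpha>)) x
    = (\<Sum>\<alpha> | length \<alpha> \<le> N + L. conv c d \<alpha> *\<^sub>C word_op X \<alpha>) x"
    by (simp only: A_def B_def U_def)
qed

lemma comp_coeff_supp:
  assumes "\<And>j \<alpha>. N < length \<alpha> \<Longrightarrow> b j \<alpha> = 0" "N * length \<gamma> < length \<alpha>"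
  shows "comp_coeff b \<gamma> \<alpha> = 0"
  using assms(2)
proof (induction \<gamma> arbitrary: \<alpha>)
  case (Cons j \<gamma>)
  then show ?case using conv_supp[of N "b j" "N * length \<gamma>" "comp_coeff b \<gamma>" \<alpha>] assms(1) by simp
qed auto

lemma comp_coeff_eval:
  fixes X :: "'n::finite \<Rightarrow> 'a::complex_hilbert \<Rightarrow>\<^sub>L 'a"
  assumes b: "\<And>j \<alpha>. N < length \<alpha> \<Longrightarrow> b j \<alpha> = 0" and X: "\<And>i. X i \<in> bop" and L: "N * length \<gamma> \<le> L"
  shows "(\<Sum>\<alpha> | length \<alpha> \<le> L. comp_coeff b \<gamma> \<alpha> *\<^sub>C word_op X \<alpha>)
    = word_op (\<lambda>j. \<Sum>\<alpha> | length \<alpha> \<le> N. b j \<alpha> *\<^sub>C word_op X \<alpha>) \<gamma>"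
proof -
  have "(\<Sum>\<alpha> | length \<alpha> \<le> N * length \<gamma>. comp_coeff b \<gamma> \<alpha> *\<^sub>C word_op X \<alpha>)
    = word_op (\<lambda>j. \<Sum>\<alpha> | length \<alpha> \<le> N. b j \<alpha> *\<^sub>C word_op X \<alpha>) \<gamma>"
  proof (induction \<gamma>)
    case (Cons j \<gamma>)
    have supp: "comp_coeff b \<gamma> \<alpha> = 0" if "N * length \<gamma> < length \<alpha>" for \<alpha>
      by (rule comp_coeff_supp[OF b that])
    show ?case
      using conv_eval[where c = "b j" and d = "comp_coeff b \<gamma>" and N = N
          and L = "N * length \<gamma>" and X = X, OF b supp X] Cons by simp
  qed simp
  moreover have "(\<Sum>\<alpha> | length \<alpha> \<le> N * length \<gamma>. comp_coeff b \<gamma> \<alpha> *\<^sub>C word_op X \<alpha>)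
      = (\<Sum>\<alpha> | length \<alpha> \<le> L. comp_coeff b \<gamma> \<alpha> *\<^sub>C word_op X \<alpha>)"
  proof (rule sum.mono_neutral_left)
    show "\<forall>\<alpha>\<in>{\<alpha>. length \<alpha> \<le> L} - {\<alpha>. length \<alpha> \<le> N * length \<gamma>}. comp_coeff b \<gamma> \<alpha> *\<^sub>C word_op X \<alpha> = 0"
      by (auto simp: not_le comp_coeff_supp[OF b])
  qed (use L in \<open>auto simp: finite_words\<close>)
  ultimately show ?thesis by simp
qed

lemma comp_poly:
  fixes b :: "'m \<Rightarrow> 'n::finite list \<Rightarrow> complex"
  assumes b: "\<And>j \<alpha>. N < length \<alpha> \<Longrightarrow> b j \<alpha> = 0" and M: "is_nc_poly k M"
  shows "is_nc_poly k (comp_poly k M b)"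
    and "\<And>X :: 'n \<Rightarrow> 'a::complex_hilbert \<Rightarrow>\<^sub>L 'a. (\<And>i. X i \<in> bop) \<Longrightarrow>
      pform k (comp_poly k M b) X x = pform k M (\<lambda>j. \<Sum>\<alpha> | length \<alpha> \<le> N. b j \<alpha> *\<^sub>C word_op X \<alpha>) x"
proof -
  have fin: "finite (poly_supp k M)" using M by (simp add: is_nc_poly_def)
  define D where "D = Max (insert 0 (length ` poly_supp k M))"
  have D: "length \<gamma> \<le> D" if "\<gamma> \<in> poly_supp k M" for \<gamma>
    using fin that by (auto simp: D_def intro!: Max_ge)
  have LD: "N * length \<gamma> \<le> N * D" if "\<gamma> \<in> poly_supp k M" for \<gamma> using D[OF that] by simp
  have supp: "poly_supp k (comp_poly k M b) \<subseteq> {\<alpha>. length \<alpha> \<le> N * D}"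
  proof (rule subsetI, rule ccontr)
    fix \<alpha> assume \<alpha>: "\<alpha> \<in> poly_supp k (comp_poly k M b)" "\<alpha> \<notin> {\<alpha>. length \<alpha> \<le> N * D}"
    have "comp_coeff b \<gamma> \<alpha> = 0" if "\<gamma> \<in> poly_supp k M" for \<gamma>
      by (rule comp_coeff_supp[OF b], simp, rule le_less_trans[OF LD[OF that]]) (use \<alpha>(2) in auto)
    then have "comp_poly k M b \<alpha> s t = 0" for s t
      unfolding comp_poly_def by (intro sum.neutral) simp
    then show False using \<alpha>(1) by (simp add: poly_supp_def)
  qed
  show "is_nc_poly k (comp_poly k M b)"
    unfolding is_nc_poly_def by (rule finite_subset[OF supp finite_words])
  fix X :: "'n \<Rightarrow> 'a \<Rightarrow>\<^sub>L 'a" assume X: "\<And>i. X i \<in> bop"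
  let ?Y = "\<lambda>j. \<Sum>\<alpha> | length \<alpha> \<le> N. b j \<alpha> *\<^sub>C word_op X \<alpha>"
  have "(\<Sum>\<alpha> | length \<alpha> \<le> N * D. comp_poly k M b \<alpha> s t * cinner (word_op X \<alpha> (x t)) (x s))
      = (\<Sum>\<gamma>\<in>poly_supp k M. M \<gamma> s t * cinner (word_op ?Y \<gamma> (x t)) (x s))" for s t
  proof -
    have "(\<Sum>\<alpha> | length \<alpha> \<le> N * D. comp_poly k M b \<alpha> s t * cinner (word_op X \<alpha> (x t)) (x s))
        = (\<Sum>\<gamma>\<in>poly_supp k M. \<Sum>\<alpha> | length \<alpha> \<le> N * D. M \<gamma> s t * (comp_coeff b \<gamma> \<alpha>
            * cinner (word_op X \<alpha> (x t)) (x s)))"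
      unfolding comp_poly_def sum_distrib_right by (subst sum.swap) (simp add: mult.assoc)
    also have "\<dots> = (\<Sum>\<gamma>\<in>poly_supp k M. M \<gamma> s t * cinner (word_op ?Y \<gamma> (x t)) (x s))"
      by (intro sum.cong refl)
        (simp add: comp_coeff_eval[OF b X LD, symmetric] blinfun.sum_left scaleC_blinfun.rep_eq
          cinner.sum_left cinner_scaleC_left sum_distrib_left)
    finally show ?thesis .
  qed
  then show "pform k (comp_poly k M b) X x = pform k M ?Y x"
    unfolding pform_superset[OF finite_words supp] by (simp add: pform_def)
qed

text \<open>Contractivity of f places its values in the closed ball only, so positivity is extended
  there by radial limits.\<close>

lemma row_contr_pform_nonneg:
  fixes Y :: "'m::finite \<Rightarrow> 'k::complex_hilbert \<Rightarrow>\<^sub>L 'k"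
  assumes M: "Re_nonneg_on_ball TYPE('k) k M" and Y: "\<And>j. Y j \<in> bop" "row_contr Y"
  shows "0 \<le> Re (pform k M Y x)"
proof (rule nonneg_at_left_1)
  have "((\<lambda>s::real. s *\<^sub>R Y j) \<longlongrightarrow> 1 *\<^sub>R Y j) (at_left 1)" for j by (intro tendsto_intros)
  then show "((\<lambda>s::real. Re (pform k M (\<lambda>j. s *\<^sub>R Y j) x)) \<longlongrightarrow> Re (pform k M Y x)) (at_left 1)"
    by (intro tendsto_Re tendsto_pform) simp
  fix s :: real assume "0 \<le> s" "s < 1"
  then show "0 \<le> Re (pform k M (\<lambda>j. s *\<^sub>R Y j) x)"
    using M scaled_row_contr_op_ball[OF Y] unfolding Re_nonneg_on_ball_iff by blast
qed

section \<open>Normalised Taylor polynomials of a contractive function\<close>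

lemma row_contr_if_row_op:
  fixes Y :: "'m::finite \<Rightarrow> 'a::complex_hilbert \<Rightarrow>\<^sub>L 'a"
  assumes "norm (row_op Y) \<le> 1"
  shows "row_contr Y"
  unfolding row_contr_def
proof
  fix u :: "'m \<Rightarrow> 'a"
  have nth: "l2_nth (Abs_l2 u) = u" by (rule Abs_l2_inverse) simp
  have "norm (\<Sum>i\<in>UNIV. Y i (u i)) = norm (row_op Y (Abs_l2 u))"
    by (simp add: row_op.rep_eq nth)
  also have "\<dots> \<le> norm (row_op Y) * norm (Abs_l2 u)" by (rule norm_blinfun)
  also have "\<dots> \<le> 1 * norm (Abs_l2 u)" using assms by (intro mult_right_mono) auto
  finally have "(norm (\<Sum>i\<in>UNIV. Y i (u i)))\<^sup>2 \<le> (norm (Abs_l2 u))\<^sup>2" by (intro power_mono) auto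
  then show "(norm (\<Sum>i\<in>UNIV. Y i (u i)))\<^sup>2 \<le> (\<Sum>i\<in>UNIV. (norm (u i))\<^sup>2)"
    by (simp add: l2_norm_power2 nth)
qed

text \<open>Bounds the norm of the row of Taylor remainders of f at rX, uniformly over row
  contractions X; summing the component bounds is enough because the quantity only has to tend to
  0.\<close>

definition tail_bound :: "('m::finite \<Rightarrow> 'n::finite list \<Rightarrow> complex) \<Rightarrow> real \<Rightarrow> nat \<Rightarrow> real" where
  "tail_bound a r N = (\<Sum>j\<in>UNIV. \<Sum>n. r ^ (n + N) * coeff_norm (a j) (n + N))"

text \<open>
  Dividing the Taylor polynomials by \<open>1 + tail_bound\<close> makes them exactly contractive.
\<close>

definition trunc :: "('m::finite \<Rightarrow> 'n::finite list \<Rightarrow> complex) \<Rightarrow> real \<Rightarrow> nat \<Rightarrow> 'm \<Rightarrow> 'n list \<Rightarrow> complex" where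
  "trunc a r N j \<alpha> =
    (if length \<alpha> < N then complex_of_real (1 / (1 + tail_bound a r N) * r ^ length \<alpha>) * a j \<alpha> else 0)"

lemma trunc_eval:
  "(\<Sum>\<alpha> | length \<alpha> \<le> N. trunc a r N j \<alpha> *\<^sub>C word_op X \<alpha>)
    = (1 / (1 + tail_bound a r N)) *\<^sub>R (\<Sum>n<N. r ^ n *\<^sub>R hom_part (a j) n X)"
proof -
  have "(\<Sum>\<alpha> | length \<alpha> \<le> N. trunc a r N j \<alpha> *\<^sub>C word_op X \<alpha>)
      = (\<Sum>\<alpha> | length \<alpha> < N. (1 / (1 + tail_bound a r N)) *\<^sub>R (r ^ length \<alpha> *\<^sub>R (a j \<alpha> *\<^sub>C word_op X \<alpha>)))"
    by (intro sum.mono_neutral_cong_right)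
      (auto simp: finite_words trunc_def scaleR_scaleC scaleC_scaleC mult.assoc)
  also have "\<dots> = (1 / (1 + tail_bound a r N)) *\<^sub>R (\<Sum>n<N. r ^ n *\<^sub>R hom_part (a j) n X)"
    unfolding scaleR_sum_right[symmetric] sum_length_less[symmetric]
    by (simp add: hom_part_def scaleR_sum_right)
  finally show ?thesis .
qed

lemma trunc_supp: "N < length \<alpha> \<Longrightarrow> trunc a r N j \<alpha> = 0"
  by (simp add: trunc_def)

lemma tail_bound_nonneg:
  assumes f: "\<And>j. free_holomorphic (a j)" and r: "0 \<le> r" "r < 1"
  shows "0 \<le> tail_bound a r N"
  unfolding tail_bound_def
  using r by (intro sum_nonneg suminf_nonneg summable_ignore_initial_segment
      free_holomorphic_summable f) auto

lemma tail_bound_tendsto: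
  assumes f: "\<And>j. free_holomorphic (a j)" and r: "0 \<le> r" "r < 1"
  shows "(\<lambda>N. tail_bound a r N) \<longlonglongrightarrow> 0"
proof -
  have "(\<lambda>N. \<Sum>n. r ^ (n + N) * coeff_norm (a j) (n + N)) \<longlonglongrightarrow> 0" for j
  proof -
    note S = free_holomorphic_summable[OF f[of j] r]
    have "(\<lambda>N. (\<Sum>n. r ^ n * coeff_norm (a j) n) - (\<Sum>n<N. r ^ n * coeff_norm (a j) n))
        \<longlonglongrightarrow> (\<Sum>n. r ^ n * coeff_norm (a j) n) - (\<Sum>n. r ^ n * coeff_norm (a j) n)"
      by (intro tendsto_diff tendsto_const summable_LIMSEQ S)
    then show ?thesis unfolding suminf_minus_initial_segment[OF S] by simp
  qed
  then have "(\<lambda>N. tail_bound a r N) \<longlonglongrightarrow> (\<Sum>j\<in>(UNIV :: 'a set). 0)"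
    unfolding tail_bound_def by (intro tendsto_sum)
  then show ?thesis by simp
qed

text \<open>The row of Taylor sections differs from the contractive row f(rX) by at most \<eta>,
  hence has norm at most 1 + \<eta>, the factor divided out.\<close>

lemma trunc_row_contr:
  fixes X :: "'n::finite \<Rightarrow> 'k::complex_hilbert \<Rightarrow>\<^sub>L 'k" and a :: "'m::finite \<Rightarrow> 'n list \<Rightarrow> complex"
  assumes f: "\<And>j. free_holomorphic (a j)" and contr: "free_contractive TYPE('k) a"
    and r: "0 \<le> r" "r < 1" and X: "X \<in> op_ball"
  shows "row_contr (\<lambda>j. (1 / (1 + tail_bound a r N)) *\<^sub>R (\<Sum>n<N. r ^ n *\<^sub>R hom_part (a j) n X))"
proof -
  have X1: "\<And>i. X i \<in> bop" using X by (simp add: op_ball_def)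
  have X2: "row_contr X" by (rule op_ball_row_contr[OF X])
  define Fr where "Fr = (\<lambda>j. free_eval (a j) (\<lambda>i. r *\<^sub>R X i))"
  define P where "P = (\<lambda>j. \<Sum>n<N. r ^ n *\<^sub>R hom_part (a j) n X)"
  define \<eta> where "\<eta> = tail_bound a r N"
  have \<eta>: "0 \<le> \<eta>" unfolding \<eta>_def by (rule tail_bound_nonneg[OF f r])
  have Fr: "row_contr Fr"
    unfolding Fr_def using contr scaled_row_contr_op_ball[OF X1 X2 r]
    by (intro row_contr_if_row_op) (simp add: free_contractive_def)
  have "(norm (\<Sum>j\<in>UNIV. ((1 / (1 + \<eta>)) *\<^sub>R P j) (u j)))\<^sup>2 \<le> (\<Sum>j\<in>UNIV. (norm (u j))\<^sup>2)" for u
  proof -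
    define q where "q = sqrt (\<Sum>j\<in>UNIV. (norm (u j))\<^sup>2)"
    have q0: "0 \<le> q" by (simp add: q_def sum_nonneg)
    have uq: "norm (u j) \<le> q" for j
      unfolding q_def by (rule real_le_rsqrt) (rule member_le_sum, auto)
    have 1: "norm (\<Sum>j\<in>UNIV. Fr j (u j)) \<le> q"
      unfolding q_def by (rule real_le_rsqrt) (rule row_contrD[OF Fr])
    have "norm (\<Sum>j\<in>UNIV. (Fr j - P j) (u j)) \<le> (\<Sum>j\<in>UNIV. (\<Sum>n. r ^ (n + N) * coeff_norm (a j) (n + N)) * q)"
    proof (rule sum_norm_le)
      fix j
      have "norm ((Fr j - P j) (u j)) \<le> norm (Fr j - P j) * norm (u j)" by (rule norm_blinfun)
      also have "\<dots> \<le> (\<Sum>n. r ^ (n + N) * coeff_norm (a j) (n + N)) * q"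
        unfolding Fr_def P_def
        by (intro mult_mono free_eval_tail f r X1 X2 uq suminf_nonneg summable_ignore_initial_segment
            free_holomorphic_summable) (use r in auto)
      finally show "norm ((Fr j - P j) (u j)) \<le> (\<Sum>n. r ^ (n + N) * coeff_norm (a j) (n + N)) * q" .
    qed
    then have 2: "norm (\<Sum>j\<in>UNIV. (Fr j - P j) (u j)) \<le> \<eta> * q"
      by (simp add: \<eta>_def tail_bound_def sum_distrib_right)
    have "(\<Sum>j\<in>UNIV. P j (u j)) = (\<Sum>j\<in>UNIV. Fr j (u j)) - (\<Sum>j\<in>UNIV. (Fr j - P j) (u j))"
      by (simp add: blinfun.diff_left sum_subtractf)
    then have "norm (\<Sum>j\<in>UNIV. P j (u j)) \<le> q + \<eta> * q"
      using norm_triangle_ineq4[of "\<Sum>j\<in>UNIV. Fr j (u j)" "\<Sum>j\<in>UNIV. (Fr j - P j) (u j)"] 1 2 by simp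
    moreover have "(\<Sum>j\<in>UNIV. ((1 / (1 + \<eta>)) *\<^sub>R P j) (u j)) = (1 / (1 + \<eta>)) *\<^sub>R (\<Sum>j\<in>UNIV. P j (u j))"
      by (simp add: blinfun.scaleR_left scaleR_sum_right)
    ultimately have "norm (\<Sum>j\<in>UNIV. ((1 / (1 + \<eta>)) *\<^sub>R P j) (u j)) \<le> q"
      using \<eta> by (simp add: field_simps)
    then have "(norm (\<Sum>j\<in>UNIV. ((1 / (1 + \<eta>)) *\<^sub>R P j) (u j)))\<^sup>2 \<le> q\<^sup>2" by (intro power_mono) auto
    then show ?thesis by (simp add: q_def sum_nonneg)
  qed
  then show ?thesis by (simp add: row_contr_def P_def \<eta>_def)
qed

lemma comp_trunc_eval:
  fixes X :: "'n::finite \<Rightarrow> 'h::complex_hilbert \<Rightarrow>\<^sub>L 'h"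
  assumes M: "is_nc_poly k M" and X: "\<And>i. X i \<in> bop"
  shows "pform k (comp_poly k M (trunc a r N)) X x
    = pform k M (\<lambda>j. (1 / (1 + tail_bound a r N)) *\<^sub>R (\<Sum>n<N. r ^ n *\<^sub>R hom_part (a j) n X)) x"
  unfolding trunc_eval[symmetric] by (rule comp_poly(2)) (simp_all add: trunc_supp M X)

lemma comp_trunc_nonneg:
  fixes a :: "'m::finite \<Rightarrow> 'n::finite list \<Rightarrow> complex"
  assumes f: "\<And>j. free_holomorphic (a j)" and contr: "free_contractive TYPE('k::complex_hilbert) a"
    and r: "0 \<le> r" "r < 1" and M: "is_nc_poly k M" "Re_nonneg_on_ball TYPE('k) k M"
  shows "is_nc_poly k (comp_poly k M (trunc a r N))"
    and "Re_nonneg_on_ball TYPE('k) k (comp_poly k M (trunc a r N))"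
proof -
  show "is_nc_poly k (comp_poly k M (trunc a r N))"
    by (rule comp_poly(1)[where N = N]) (simp_all add: trunc_supp M)
  show "Re_nonneg_on_ball TYPE('k) k (comp_poly k M (trunc a r N))"
    unfolding Re_nonneg_on_ball_iff
  proof (intro ballI allI)
    fix X :: "'n \<Rightarrow> 'k \<Rightarrow>\<^sub>L 'k" and x assume X: "X \<in> op_ball"
    have X1: "\<And>i. X i \<in> bop" using X by (simp add: op_ball_def)
    show "0 \<le> Re (pform k (comp_poly k M (trunc a r N)) X x)"
      unfolding comp_trunc_eval[OF M(1) X1]
      by (intro row_contr_pform_nonneg[OF M(2)] trunc_row_contr[OF f contr r X] bop_scaleR bop_sum
          hom_part_bop X1)
  qed
qed

lemma comp_trunc_tendsto:
  fixes a :: "'m::finite \<Rightarrow> 'n::finite list \<Rightarrow> complex" and X :: "'n \<Rightarrow> 'h::complex_hilbert \<Rightarrow>\<^sub>L 'h"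
  assumes f: "\<And>j. free_holomorphic (a j)" and r: "0 \<le> r" "r < 1" and M: "is_nc_poly k M"
    and X: "\<And>i. X i \<in> bop" and C: "\<And>j n. norm (hom_part (a j) n X) \<le> C * coeff_norm (a j) n"
  shows "(\<lambda>N. pform k (comp_poly k M (trunc a r N)) X x) \<longlonglongrightarrow> pform k M (\<lambda>j. free_eval (a j) (\<lambda>i. r *\<^sub>R X i)) x"
proof -
  have "(\<lambda>N. (1 / (1 + tail_bound a r N)) *\<^sub>R (\<Sum>n<N. r ^ n *\<^sub>R hom_part (a j) n X))
      \<longlonglongrightarrow> (1 / (1 + 0)) *\<^sub>R free_eval (a j) (\<lambda>i. r *\<^sub>R X i)" for j
    by (intro tendsto_intros tail_bound_tendsto f r free_eval_limit[where C = C] C) simp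
  then have "(\<lambda>N. pform k M (\<lambda>j. (1 / (1 + tail_bound a r N)) *\<^sub>R (\<Sum>n<N. r ^ n *\<^sub>R hom_part (a j) n X)) x)
      \<longlonglongrightarrow> pform k M (\<lambda>j. free_eval (a j) (\<lambda>i. r *\<^sub>R X i)) x"
    by (intro tendsto_pform) simp
  then show ?thesis
    unfolding comp_trunc_eval[OF M X] .
qed

definition const_op :: "('m \<Rightarrow> 'n list \<Rightarrow> complex) \<Rightarrow> 'm \<Rightarrow> 'h::complex_hilbert \<Rightarrow>\<^sub>L 'h" where
  "const_op a j = a j [] *\<^sub>C id_blinfun"

lemma free_eval_0:
  fixes a :: "'m \<Rightarrow> 'n::finite list \<Rightarrow> complex"
  shows "free_eval (a j) (\<lambda>_. 0 :: 'h::complex_hilbert \<Rightarrow>\<^sub>L 'h) = const_op a j"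
proof -
  have "hom_part (a j) n (\<lambda>_. 0 :: 'h \<Rightarrow>\<^sub>L 'h) = 0" if "n \<noteq> 0" for n
    unfolding hom_part_def
  proof (intro sum.neutral ballI)
    fix \<alpha> :: "'n list" assume "\<alpha> \<in> {\<alpha>. length \<alpha> = n}"
    then have "\<alpha> \<noteq> []" using that by auto
    then show "a j \<alpha> *\<^sub>C word_op (\<lambda>_. 0 :: 'h \<Rightarrow>\<^sub>L 'h) \<alpha> = 0" by (simp add: word_op_0)
  qed
  then have "(\<Sum>n. hom_part (a j) n (\<lambda>_. 0 :: 'h \<Rightarrow>\<^sub>L 'h)) = (\<Sum>n\<in>{0}. hom_part (a j) n (\<lambda>_. 0))"
    by (intro suminf_finite) auto
  then show ?thesis by (simp add: free_eval_def hom_part_def const_op_def)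
qed

text \<open>The weights p, q, s are left free so that one limit argument serves both class
  membership and Harnack domination. The hypothesis is applied to M composed with the normalised
  sections; the degree goes to infinity first, then r to 1. Evaluation of the compositions at 0
  tends to M at f(0), which is why \<open>const_op a\<close> replaces the zero tuple.\<close>

lemma form_inequality_transfer:
  fixes a :: "'m::finite \<Rightarrow> 'n::finite list \<Rightarrow> complex" and A B :: "'n \<Rightarrow> 'h::complex_hilbert \<Rightarrow>\<^sub>L 'h"
  assumes f: "\<And>j. free_holomorphic (a j)" and contr: "free_contractive TYPE('k::complex_hilbert) a"
    and bd: "\<And>j. boundary_in_disc_algebra (a j)"
    and \<rho>: "0 < \<rho>" and A: "A \<in> class_C \<rho>" and B: "B \<in> class_C \<rho>"
    and H: "\<And>Q. is_nc_poly k Q \<Longrightarrow> Re_nonneg_on_ball TYPE('k) k (Q :: 'n list \<Rightarrow> _)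
      \<Longrightarrow> 0 \<le> p * Re (pform k Q A x) + q * Re (pform k Q B x) + s * Re (pform k Q (\<lambda>_. 0) x)"
    and M: "is_nc_poly k M" "Re_nonneg_on_ball TYPE('k) k M"
  shows "0 \<le> p * Re (pform k M (free_apply a A) x) + q * Re (pform k M (free_apply a B) x)
    + s * Re (pform k M (const_op a) x)"
proof (rule nonneg_at_left_1)
  have lim: "((\<lambda>r. free_eval (a j) (\<lambda>i. r *\<^sub>R T i)) \<longlongrightarrow> free_apply a T j) (at_left 1)"
    if "T \<in> class_C \<rho>" for T :: "'n \<Rightarrow> 'h \<Rightarrow>\<^sub>L 'h" and j
    by (rule free_apply_tendsto[where \<rho> = \<rho>]) (fact f bd \<rho> that)+
  let ?f = "\<lambda>T r j. free_eval (a j) (\<lambda>i. r *\<^sub>R (T :: 'n \<Rightarrow> 'h \<Rightarrow>\<^sub>L 'h) i)"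
  show "((\<lambda>r::real. p * Re (pform k M (?f A r) x) + q * Re (pform k M (?f B r) x) + s
      * Re (pform k M (const_op a) x))
      \<longlongrightarrow> p * Re (pform k M (free_apply a A) x) + q * Re (pform k M (free_apply a B) x)
        + s * Re (pform k M (const_op a) x)) (at_left 1)"
    by (intro tendsto_intros tendsto_pform lim A B)
  show "0 \<le> p * Re (pform k M (?f A r) x) + q * Re (pform k M (?f B r) x) + s * Re (pform k M (const_op a) x)"
    if r: "0 \<le> r" "r < 1" for r
  proof (rule LIMSEQ_le_const)
    have C0: "norm (hom_part (a j) n (\<lambda>_. 0 :: 'h \<Rightarrow>\<^sub>L 'h)) \<le> 1 * coeff_norm (a j) n" for j n
      using norm_hom_part_le[of "\<lambda>_. 0 :: 'h \<Rightarrow>\<^sub>L 'h" "a j" n] by (simp add: row_contr_def sum_nonneg bop_0)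
    let ?Q = "\<lambda>N. comp_poly k M (trunc a r N)"
    have z: "(\<lambda>N. pform k (?Q N) (\<lambda>_. 0) x) \<longlonglongrightarrow> pform k M (const_op a) x"
      using comp_trunc_tendsto[where a = a and X = "\<lambda>_. 0 :: 'h \<Rightarrow>\<^sub>L 'h", OF f r M(1) bop_0 C0, of x]
      by (simp add: free_eval_0)
    have t: "(\<lambda>N. pform k (?Q N) T x) \<longlonglongrightarrow> pform k M (?f T r) x" if T: "T \<in> class_C \<rho>" for T :: "'n \<Rightarrow> 'h \<Rightarrow>\<^sub>L 'h"
      by (rule comp_trunc_tendsto[OF f r M(1) class_C_bop[OF T] norm_hom_part_class_C[OF \<rho> T]])
    show "(\<lambda>N. p * Re (pform k (?Q N) A x) + q * Re (pform k (?Q N) B x) + s * Re (pform k (?Q N) (\<lambda>_. 0) x))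
      \<longlonglongrightarrow> p * Re (pform k M (?f A r) x) + q * Re (pform k M (?f B r) x) + s * Re (pform k M (const_op a) x)"
      by (intro tendsto_intros z t A B)
    show "\<exists>N. \<forall>n\<ge>N. 0 \<le> p * Re (pform k (?Q n) A x) + q * Re (pform k (?Q n) B x) + s
        * Re (pform k (?Q n) (\<lambda>_. 0) x)"
      using H[OF comp_trunc_nonneg[OF f contr r M]] by blast
  qed
qed


section \<open>The scalar Harnack inequality\<close>

text \<open>The Cayley transform h of g maps the disc into itself and sends 0 to 0, so |h(t)| \<le>
  t by the Schwarz lemma. Strict positivity keeps its denominator away from 0.\<close>

lemma harnack_disc_strict:
  fixes g :: "complex \<Rightarrow> complex" and t :: real
  assumes hol: "g holomorphic_on ball 0 1" and pos: "\<And>z. norm z < 1 \<Longrightarrow> 0 < Re (g z)" and t: "0 \<le> t" "t < 1"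
  shows "(1 - t) * Re (g 0) \<le> (1 + t) * Re (g t)" "(1 - t) * Re (g t) \<le> (1 + t) * Re (g 0)"
proof -
  define h where "h = (\<lambda>z. (g z - g 0) / (g z + cnj (g 0)))"
  have ne: "g z + cnj (g 0) \<noteq> 0" if "norm z < 1" for z
    using pos[OF that] pos[of 0] by (auto simp: complex_eq_iff)
  have hh: "h holomorphic_on ball 0 1"
    unfolding h_def using ne by (intro holomorphic_intros hol) auto
  have sq: "(cmod (w - v))\<^sup>2 = (Re w - Re v)\<^sup>2 + (Im w - Im v)\<^sup>2"
    "(cmod (w + cnj v))\<^sup>2 = (Re w + Re v)\<^sup>2 + (Im w - Im v)\<^sup>2" for v w
    by (simp_all add: cmod_power2)
  have h1: "norm (h z) < 1" if z: "norm z < 1" for z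
  proof -
    have "(cmod (g z + cnj (g 0)))\<^sup>2 - (cmod (g z - g 0))\<^sup>2 = 4 * (Re (g z) * Re (g 0))"
      unfolding sq by (simp add: power2_eq_square algebra_simps)
    moreover have "0 < Re (g z) * Re (g 0)" using pos[OF z] pos[of 0] by simp
    ultimately have "(cmod (g z - g 0))\<^sup>2 < (cmod (g z + cnj (g 0)))\<^sup>2" by linarith
    then have "cmod (g z - g 0) < cmod (g z + cnj (g 0))" by (rule power_less_imp_less_base) simp
    then show ?thesis using ne[OF z] by (simp add: h_def norm_divide)
  qed
  have "norm (h (complex_of_real t)) \<le> norm (complex_of_real t)"
    by (rule Schwarz_Lemma(1)[OF hh _ h1]) (use t in \<open>auto simp: h_def\<close>)
  then have "cmod (g t - g 0) \<le> t * cmod (g t + cnj (g 0))"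
    using t ne[of t] by (simp add: h_def norm_divide divide_le_eq)
  then have "(cmod (g t - g 0))\<^sup>2 \<le> (t * cmod (g t + cnj (g 0)))\<^sup>2" by (intro power_mono) auto
  then have "(Re (g t) - Re (g 0))\<^sup>2 + (Im (g t) - Im (g 0))\<^sup>2
      \<le> t\<^sup>2 * (Re (g t) + Re (g 0))\<^sup>2 + t\<^sup>2 * (Im (g t) - Im (g 0))\<^sup>2"
    unfolding power_mult_distrib sq by (simp add: distrib_left)
  moreover have "t\<^sup>2 * (Im (g t) - Im (g 0))\<^sup>2 \<le> 1 * (Im (g t) - Im (g 0))\<^sup>2"
    using t by (intro mult_right_mono) (auto simp: power_le_one)
  ultimately have "(Re (g t) - Re (g 0))\<^sup>2 \<le> (t * (Re (g t) + Re (g 0)))\<^sup>2"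
    by (simp add: power_mult_distrib)
  moreover have "0 \<le> t * (Re (g t) + Re (g 0))"
    using t pos[of t] pos[of 0] by simp
  ultimately have "\<bar>Re (g t) - Re (g 0)\<bar> \<le> t * (Re (g t) + Re (g 0))"
    using power2_le_iff_abs_le by blast
  then show "(1 - t) * Re (g 0) \<le> (1 + t) * Re (g t)" "(1 - t) * Re (g t) \<le> (1 + t) * Re (g 0)"
    by (simp_all add: abs_le_iff algebra_simps)
qed

lemma harnack_disc:
  fixes g :: "complex \<Rightarrow> complex" and t :: real
  assumes hol: "g holomorphic_on ball 0 1" and pos: "\<And>z. norm z < 1 \<Longrightarrow> 0 \<le> Re (g z)" and t: "0 \<le> t" "t < 1"
  shows "(1 - t) * Re (g 0) \<le> (1 + t) * Re (g t)" "(1 - t) * Re (g t) \<le> (1 + t) * Re (g 0)"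
proof -
  have e: "(1 - t) * Re (g 0) \<le> (1 + t) * Re (g t) + e \<and> (1 - t) * Re (g t) \<le> (1 + t) * Re (g 0) + e"
    if e: "e > 0" for e
  proof -
    \<comment> \<open>Adding d to g raises the two sides by (1 - t)d and (1 + t)d, which differ by
      2td = te, at most e.\<close>
    define d where "d = e / 2"
    have d: "d > 0" using e by (simp add: d_def)
    have hd: "(\<lambda>z. g z + complex_of_real d) holomorphic_on ball 0 1" by (intro holomorphic_intros hol)
    have pd: "0 < Re (g z + complex_of_real d)" if "norm z < 1" for z using pos[OF that] d by simp
    have "t * e \<le> 1 * e" using t e by (intro mult_right_mono) auto
    then have "(1 + t) * d \<le> (1 - t) * d + e" by (simp add: d_def field_simps)
    moreover have "(1 - t) * d \<le> (1 + t) * d" using t d by (intro mult_right_mono) auto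
    ultimately show ?thesis
      using harnack_disc_strict[OF hd pd t] by (simp add: distrib_left)
  qed
  show "(1 - t) * Re (g 0) \<le> (1 + t) * Re (g t)" "(1 - t) * Re (g t) \<le> (1 + t) * Re (g 0)"
    using e by (auto intro: field_le_epsilon)
qed

lemma cinner_word_scalar:
  "cinner (word_op (\<lambda>j. w j *\<^sub>C id_blinfun) \<gamma> y) (z :: 'a::complex_hilbert) = prod_list (map w \<gamma>) * cinner y z"
  by (induction \<gamma>) (simp_all add: scaleC_blinfun.rep_eq cinner_scaleC_left)

text \<open>For scalar tuples the defect is the number 1 - r, so \<Delta> is multiplication by its
  square root.\<close>

lemma scalar_pform_nonneg:
  fixes w :: "'m::finite \<Rightarrow> complex" and x :: "nat \<Rightarrow> 'h::complex_hilbert"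
  assumes M: "toep_nonneg k M" and w: "(\<Sum>j\<in>UNIV. (cmod (w j))\<^sup>2) < 1"
  shows "0 \<le> Re (pform k M (\<lambda>j. w j *\<^sub>C id_blinfun) x)"
proof -
  define r where "r = (\<Sum>j\<in>UNIV. (cmod (w j))\<^sup>2)"
  have r: "0 \<le> r" "r < 1" using w by (simp_all add: r_def sum_nonneg)
  have adj: "cadj (w j *\<^sub>C id_blinfun) = (cnj (w j) *\<^sub>C id_blinfun :: 'h \<Rightarrow>\<^sub>L 'h)" for j
    by (rule cadj_eqI) (simp add: scaleC_blinfun.rep_eq cinner_scaleC_left cinner_scaleC_right)
  show ?thesis
  proof (rule poisson_nonneg[where \<Delta> = "\<lambda>y. sqrt (1 - r) *\<^sub>R y" and r = r])
    show "w j *\<^sub>C id_blinfun \<in> (bop :: ('h \<Rightarrow>\<^sub>L 'h) set)" for j by (intro bop_scaleC bop_id)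
    show "cinner y z = cinner (sqrt (1 - r) *\<^sub>R y) (sqrt (1 - r) *\<^sub>R z)
        + (\<Sum>j\<in>UNIV. cinner (cadj (w j *\<^sub>C id_blinfun) y) (cadj (w j *\<^sub>C id_blinfun) z))" for y z :: 'h
    proof -
      have "(\<Sum>j\<in>UNIV. cinner (cadj (w j *\<^sub>C id_blinfun) y) (cadj (w j *\<^sub>C id_blinfun) z))
          = (\<Sum>j\<in>UNIV. complex_of_real ((cmod (w j))\<^sup>2) * cinner y z)"
        unfolding complex_norm_square
        by (intro sum.cong refl) (simp add: adj scaleC_blinfun.rep_eq cinner_scaleC_left cinner_scaleC_right)
      also have "\<dots> = complex_of_real r * cinner y z"
        by (simp add: r_def sum_distrib_right)
      moreover have "cinner (sqrt (1 - r) *\<^sub>R y) (sqrt (1 - r) *\<^sub>R z) = complex_of_real (1 - r) * cinner y z"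
        using r by (simp add: cinner.scaleR_left cinner.scaleR_right scaleR_conv_of_real flip: of_real_mult)
      ultimately show ?thesis by (simp add: algebra_simps)
    qed
    show "(\<Sum>j\<in>UNIV. (norm (cadj (w j *\<^sub>C id_blinfun) y))\<^sup>2) \<le> r * (norm y)\<^sup>2" for y :: 'h
      by (simp add: adj scaleC_blinfun.rep_eq norm_scaleC power_mult_distrib r_def sum_distrib_right)
  qed (use r M in auto)
qed

text \<open>On the complex line through f(0) the form is a holomorphic function of one variable with
  nonnegative real part on the disc. It gives the value at the zero tuple at 0 and the value at f(0)
  at t.\<close>

lemma scalar_harnack:
  fixes a :: "'m::finite \<Rightarrow> 'n list \<Rightarrow> complex" and x :: "nat \<Rightarrow> 'h::complex_hilbert"
  assumes M: "toep_nonneg k M" and t: "t = norm (free_at_0 a)" "t < 1"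
  shows "(1 - t) * Re (pform k M (\<lambda>_. 0) x) \<le> (1 + t) * Re (pform k M (const_op a) x)"
    and "(1 - t) * Re (pform k M (const_op a) x) \<le> (1 + t) * Re (pform k M (\<lambda>_. 0) x)"
proof -
  have t0: "0 \<le> t" by (simp add: t)
  have t2: "t\<^sup>2 = (\<Sum>j\<in>UNIV. (cmod (a j []))\<^sup>2)"
    by (simp add: t norm_vec_def L2_set_def free_at_0_def sum_nonneg)
  \<comment> \<open>A unit direction of f(0). For t = 0 division by zero makes u vanish, and t u =
    f(0) still holds.\<close>
  define u where "u = (\<lambda>j. a j [] / complex_of_real t)"
  have tu: "complex_of_real t * u j = a j []" for j
  proof (cases "t = 0")
    case True
    then have "(cmod (a j []))\<^sup>2 = 0" using t2 by (simp add: sum_nonneg_eq_0_iff)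
    then show ?thesis using True by simp
  qed (simp add: u_def)
  have u: "(\<Sum>j\<in>UNIV. (cmod (u j))\<^sup>2) \<le> 1"
  proof (cases "t = 0")
    case False
    then show ?thesis
      by (simp add: u_def norm_divide power_divide sum_divide_distrib[symmetric] t2[symmetric])
  qed (simp add: u_def)
  define g where "g = (\<lambda>l. pform k M (\<lambda>j. (l * u j) *\<^sub>C (id_blinfun :: 'h \<Rightarrow>\<^sub>L 'h)) x)"
  have "(\<lambda>l. prod_list (map (\<lambda>j. l * u j) \<gamma>)) holomorphic_on ball 0 1" for \<gamma>
    by (induction \<gamma>) (auto intro!: holomorphic_intros)
  then have hol: "g holomorphic_on ball 0 1"
    unfolding g_def pform_def cinner_word_scalar by (intro holomorphic_intros)
  have pos: "0 \<le> Re (g l)" if "norm l < 1" for l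
    unfolding g_def
  proof (rule scalar_pform_nonneg[OF M])
    have "(\<Sum>j\<in>UNIV. (cmod (l * u j))\<^sup>2) = (cmod l)\<^sup>2 * (\<Sum>j\<in>UNIV. (cmod (u j))\<^sup>2)"
      by (simp add: norm_mult power_mult_distrib sum_distrib_left)
    also have "\<dots> \<le> (cmod l)\<^sup>2 * 1" using u by (intro mult_left_mono) auto
    also have "\<dots> < 1" using that by (simp add: power_less_one_iff)
    finally show "(\<Sum>j\<in>UNIV. (cmod (l * u j))\<^sup>2) < 1" .
  qed
  have "g (complex_of_real t) = pform k M (const_op a) x"
    unfolding g_def tu const_op_def ..
  moreover have "g 0 = pform k M (\<lambda>_. 0) x" by (simp add: g_def)
  ultimately show "(1 - t) * Re (pform k M (\<lambda>_. 0) x) \<le> (1 + t) * Re (pform k M (const_op a) x)"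
    "(1 - t) * Re (pform k M (const_op a) x) \<le> (1 + t) * Re (pform k M (\<lambda>_. 0) x)"
    using harnack_disc[OF hol pos t0 t(2)] by simp_all
qed


section \<open>The Schwarz-Pick inequality\<close>

text \<open>For \<rho> < 1 the factor (1 - t)/(1 + t) is at most 1, so the new constant is at least
  \<rho>; otherwise it is at least 1.\<close>

lemma rho_f_pos:
  assumes "0 < \<rho>" "0 \<le> t" "t < 1"
  shows "0 < rho_f \<rho> t"
proof (cases "\<rho> < 1")
  case True
  have "(1 - \<rho>) * ((1 - t) / (1 + t)) \<le> (1 - \<rho>) * 1"
    using True assms by (intro mult_left_mono) auto
  moreover have "(\<rho> - 1) * ((1 - t) / (1 + t)) = - ((1 - \<rho>) * ((1 - t) / (1 + t)))"
    unfolding mult_minus_left[symmetric] by simp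
  ultimately have "0 < 1 + (\<rho> - 1) * ((1 - t) / (1 + t))"
    using assms(1) by (simp only: mult_1_right)
  then show ?thesis using True by (simp add: rho_f_def)
next
  case False
  then have "0 \<le> (\<rho> - 1) * ((1 + t) / (1 - t))" using assms by (intro mult_nonneg_nonneg) auto
  then show ?thesis using False by (simp add: rho_f_def)
qed

text \<open>Multiplication by a negative \<rho> - 1 reverses inequalities, so the lower Harnack
  bound enters for \<rho> < 1 and the upper one otherwise; these are the two cases of
  \<open>rho_f\<close>.\<close>

lemma rho_f_form_le:
  fixes a :: "'m::finite \<Rightarrow> 'n list \<Rightarrow> complex" and x :: "nat \<Rightarrow> 'h::complex_hilbert"
  assumes M: "toep_nonneg k M" and t: "norm (free_at_0 a) < 1"
  shows "(\<rho> - 1) * Re (pform k M (const_op a) x)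
    \<le> (rho_f \<rho> (norm (free_at_0 a)) - 1) * Re (pform k M (\<lambda>_. 0) x)"
proof -
  define t where "t = norm (free_at_0 a)"
  have t: "0 \<le> t" "t < 1" using assms by (simp_all add: t_def)
  note H = scalar_harnack[OF M t_def t(2), of x]
  show ?thesis
  proof (cases "\<rho> < 1")
    case True
    have "((1 - t) / (1 + t)) * Re (pform k M (\<lambda>_. 0) x) \<le> Re (pform k M (const_op a) x)"
      using H(1) t by (simp add: divide_le_eq mult.commute)
    then have "(\<rho> - 1) * Re (pform k M (const_op a) x) \<le> (\<rho> - 1) * (((1 - t) / (1 + t))
        * Re (pform k M (\<lambda>_. 0) x))"
      using True by (intro mult_left_mono_neg) auto
    then show ?thesis using True by (simp add: rho_f_def t_def)
  next
    case False
    have "Re (pform k M (const_op a) x) \<le> ((1 + t) / (1 - t)) * Re (pform k M (\<lambda>_. 0) x)"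
      using H(2) t by (simp add: le_divide_eq mult.commute)
    then have "(\<rho> - 1) * Re (pform k M (const_op a) x) \<le> (\<rho> - 1) * (((1 + t) / (1 - t))
        * Re (pform k M (\<lambda>_. 0) x))"
      using False by (intro mult_left_mono) auto
    then show ?thesis using False by (simp add: rho_f_def t_def)
  qed
qed

section \<open>Harnack domination in terms of scalar forms\<close>

lemma harnack_domD:
  assumes "harnack_dom TYPE('k::complex_hilbert) \<rho> c A B"
  shows "A \<in> class_C \<rho>" "B \<in> class_C \<rho>" "c > 0"
    "is_nc_poly k M \<Longrightarrow> Re_nonneg_on_ball TYPE('k) k M \<Longrightarrow>
      Re (pform k M A x) + (\<rho> - 1) * Re (pform k M (\<lambda>_. 0) x)
        \<le> c\<^sup>2 * (Re (pform k M B x) + (\<rho> - 1) * Re (pform k M (\<lambda>_. 0) x))"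
proof -
  show A: "A \<in> class_C \<rho>" and B: "B \<in> class_C \<rho>" and "c > 0"
    using assms unfolding harnack_dom_def by blast+
  assume "is_nc_poly k M" "Re_nonneg_on_ball TYPE('k) k M"
  then have "opmat_le k (harnack_form \<rho> k M A) (\<lambda>s t. c\<^sup>2 *\<^sub>R harnack_form \<rho> k M B s t)"
    using assms unfolding harnack_dom_def by blast
  then show "Re (pform k M A x) + (\<rho> - 1) * Re (pform k M (\<lambda>_. 0) x)
        \<le> c\<^sup>2 * (Re (pform k M B x) + (\<rho> - 1) * Re (pform k M (\<lambda>_. 0) x))"
    unfolding harnack_le_iff[OF class_C_bop[OF A] class_C_bop[OF B]] by (rule spec)
qed

lemma harnack_domI:
  assumes A: "A \<in> class_C \<rho>" and B: "B \<in> class_C \<rho>" and "c > 0"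
    and H: "\<And>k M x. is_nc_poly k M \<Longrightarrow> Re_nonneg_on_ball TYPE('k::complex_hilbert) k M \<Longrightarrow>
      Re (pform k M A x) + (\<rho> - 1) * Re (pform k M (\<lambda>_. 0) x)
        \<le> c\<^sup>2 * (Re (pform k M B x) + (\<rho> - 1) * Re (pform k M (\<lambda>_. 0) x))"
  shows "harnack_dom TYPE('k) \<rho> c A B"
  unfolding harnack_dom_def harnack_le_iff[OF class_C_bop[OF A] class_C_bop[OF B]]
  using assms by blast

lemma harnack_dom_trans:
  fixes A B D :: "'n::finite \<Rightarrow> 'h::complex_hilbert \<Rightarrow>\<^sub>L 'h"
  assumes "harnack_dom TYPE('k::complex_hilbert) \<rho> c A B" "harnack_dom TYPE('k) \<rho> d B D"
  shows "harnack_dom TYPE('k) \<rho> (c * d) A D"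
proof (rule harnack_domI)
  show "A \<in> class_C \<rho>" "D \<in> class_C \<rho>" "0 < c * d"
    using harnack_domD(1-3)[OF assms(1)] harnack_domD(1-3)[OF assms(2)] by simp_all
  fix k and x :: "nat \<Rightarrow> 'h" and M :: "'n list \<Rightarrow> nat \<Rightarrow> nat \<Rightarrow> complex"
  assume M: "is_nc_poly k M" "Re_nonneg_on_ball TYPE('k) k M"
  let ?q = "(\<rho> - 1) * Re (pform k M (\<lambda>_. 0) x)"
  have "Re (pform k M A x) + ?q \<le> c\<^sup>2 * (Re (pform k M B x) + ?q)" by (rule harnack_domD(4)[OF assms(1) M])
  also have "\<dots> \<le> c\<^sup>2 * (d\<^sup>2 * (Re (pform k M D x) + ?q))"
    by (intro mult_left_mono harnack_domD(4)[OF assms(2) M]) simp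
  finally show "Re (pform k M A x) + ?q \<le> (c * d)\<^sup>2 * (Re (pform k M D x) + ?q)"
    by (simp add: power_mult_distrib mult.assoc)
qed

text \<open>The form is nonnegative by membership in the class, so a factor of at least 1 cannot
  decrease it. Combined with transitivity this allows constants to be enlarged.\<close>

lemma harnack_dom_refl:
  fixes A :: "'n::finite \<Rightarrow> 'h::complex_hilbert \<Rightarrow>\<^sub>L 'h"
  assumes K: "separable_infinite_dim TYPE('k::complex_hilbert)" and \<rho>: "0 < \<rho>" and A: "A \<in> class_C \<rho>"
      and c: "1 \<le> c"
  shows "harnack_dom TYPE('k) \<rho> c A A"
proof (rule harnack_domI[OF A A])
  fix k and x :: "nat \<Rightarrow> 'h" and M :: "'n list \<Rightarrow> nat \<Rightarrow> nat \<Rightarrow> complex"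
  assume M: "Re_nonneg_on_ball TYPE('k) k M"
  let ?F = "Re (pform k M A x) + (\<rho> - 1) * Re (pform k M (\<lambda>_. 0) x)"
  have "0 \<le> ?F" by (rule class_C_form_nonneg[OF \<rho> A toep_nonneg_if_on_ball[OF K M]])
  then have "1 * ?F \<le> c\<^sup>2 * ?F" using c by (intro mult_right_mono) (auto simp: one_le_power)
  then show "?F \<le> c\<^sup>2 * ?F" by simp
qed (use c in simp)

lemma free_apply_class_C:
  fixes a :: "'m::finite \<Rightarrow> 'n::finite list \<Rightarrow> complex" and T :: "'n \<Rightarrow> 'h::complex_hilbert \<Rightarrow>\<^sub>L 'h"
  assumes K: "separable_infinite_dim TYPE('k::complex_hilbert)" and \<rho>: "0 < \<rho>"
    and f: "\<And>j. free_holomorphic (a j)" and contr: "free_contractive TYPE('k) a"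
    and f0: "norm (free_at_0 a) < 1" and bd: "\<And>j. boundary_in_disc_algebra (a j)"
    and T: "T \<in> class_C \<rho>"
  shows "free_apply a T \<in> class_C (rho_f \<rho> (norm (free_at_0 a)))"
proof (rule class_C_if_harnack_nonneg[where 'k = 'k])
  show "free_apply a T j \<in> bop" for j by (rule free_apply_bop[OF f bd \<rho> T])
  show "0 < rho_f \<rho> (norm (free_at_0 a))" by (rule rho_f_pos[OF \<rho> norm_ge_zero f0])
  fix k x and M :: "'m list \<Rightarrow> nat \<Rightarrow> nat \<Rightarrow> complex"
  assume M: "is_nc_poly k M" "Re_nonneg_on_ball TYPE('k) k M"
  \<comment> \<open>Both tuples of the transfer are T, and the second carries weight 0.\<close>
  have "0 \<le> 1 * Re (pform k M (free_apply a T) x) + 0 * Re (pform k M (free_apply a T) x)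
      + (\<rho> - 1) * Re (pform k M (const_op a) x)"
  proof (rule form_inequality_transfer[OF f contr bd \<rho> T T _ M])
    fix Q :: "'n list \<Rightarrow> nat \<Rightarrow> nat \<Rightarrow> complex" assume "Re_nonneg_on_ball TYPE('k) k Q"
    from class_C_form_nonneg[OF \<rho> T toep_nonneg_if_on_ball[OF K this]]
    show "0 \<le> 1 * Re (pform k Q T x) + 0 * Re (pform k Q T x) + (\<rho> - 1) * Re (pform k Q (\<lambda>_. 0) x)"
      by simp
  qed
  then show "0 \<le> Re (pform k M (free_apply a T) x) + (rho_f \<rho> (norm (free_at_0 a)) - 1)
      * Re (pform k M (\<lambda>_. 0) x)"
    using rho_f_form_le[OF toep_nonneg_if_on_ball[OF K M(2)] f0, of \<rho> x] by linarith
qed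

text \<open>The transfer carries over the inequality with (\<rho> - 1) Re p(f(0)) as correction
  term; enlarging this term to the one for \<open>rho_f\<close> preserves domination because c \<ge>
  1.\<close>

lemma free_apply_harnack_dom:
  fixes a :: "'m::finite \<Rightarrow> 'n::finite list \<Rightarrow> complex" and A B :: "'n \<Rightarrow> 'h::complex_hilbert \<Rightarrow>\<^sub>L 'h"
  assumes K: "separable_infinite_dim TYPE('k::complex_hilbert)" and \<rho>: "0 < \<rho>"
    and f: "\<And>j. free_holomorphic (a j)" and contr: "free_contractive TYPE('k) a"
    and f0: "norm (free_at_0 a) < 1" and bd: "\<And>j. boundary_in_disc_algebra (a j)"
    and AB: "harnack_dom TYPE('k) \<rho> c A B" and c: "1 \<le> c"
  shows "harnack_dom TYPE('k) (rho_f \<rho> (norm (free_at_0 a))) c (free_apply a A) (free_apply a B)"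
proof (rule harnack_domI)
  note A = harnack_domD(1)[OF AB] and B = harnack_domD(2)[OF AB]
  show "free_apply a A \<in> class_C (rho_f \<rho> (norm (free_at_0 a)))" "free_apply a B \<in> class_C (rho_f \<rho>
      (norm (free_at_0 a)))"
    by (rule free_apply_class_C[OF K \<rho> f contr f0 bd]; fact A B)+
  show "c > 0" using c by simp
  fix k x and M :: "'m list \<Rightarrow> nat \<Rightarrow> nat \<Rightarrow> complex"
  assume M: "is_nc_poly k M" "Re_nonneg_on_ball TYPE('k) k M"
  let ?A = "Re (pform k M (free_apply a A) x)" and ?B = "Re (pform k M (free_apply a B) x)"
    and ?Z = "(\<rho> - 1) * Re (pform k M (const_op a) x)"
  let ?D = "(rho_f \<rho> (norm (free_at_0 a)) - 1) * Re (pform k M (\<lambda>_. 0) x)"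
  have "0 \<le> (-1) * ?A + c\<^sup>2 * ?B + (c\<^sup>2 - 1) * (\<rho> - 1) * Re (pform k M (const_op a) x)"
  proof (rule form_inequality_transfer[OF f contr bd \<rho> A B _ M])
    fix Q :: "'n list \<Rightarrow> nat \<Rightarrow> nat \<Rightarrow> complex" assume "is_nc_poly k Q" "Re_nonneg_on_ball TYPE('k) k Q"
    from harnack_domD(4)[OF AB this, of x]
    show "0 \<le> (-1) * Re (pform k Q A x) + c\<^sup>2 * Re (pform k Q B x)
        + (c\<^sup>2 - 1) * (\<rho> - 1) * Re (pform k Q (\<lambda>_. 0) x)"
      by (simp add: algebra_simps)
  qed
  then have "?A + ?Z \<le> c\<^sup>2 * (?B + ?Z)" by (simp add: algebra_simps)
  \<comment> \<open>D - Z is nonnegative by \<open>rho_f_form_le\<close>, and so gains at least as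
    much on the side multiplied by c^2.\<close>
  moreover have "1 * (?D - ?Z) \<le> c\<^sup>2 * (?D - ?Z)"
    using rho_f_form_le[OF toep_nonneg_if_on_ball[OF K M(2)] f0, of \<rho> x] c
    by (intro mult_right_mono) (auto simp: one_le_power)
  ultimately have "(?A + ?Z) + 1 * (?D - ?Z) \<le> c\<^sup>2 * (?B + ?Z) + c\<^sup>2 * (?D - ?Z)"
    by (rule add_mono)
  then have "(?A + ?Z) + 1 * (?D - ?Z) \<le> c\<^sup>2 * ((?B + ?Z) + (?D - ?Z))"
    by (simp only: distrib_left[of "c\<^sup>2" "?B + ?Z"])
  then show "?A + ?D \<le> c\<^sup>2 * (?B + ?D)" by simp
qed

theorem theorem4p8:
  fixes \<rho> :: real
    and \<Delta> :: "('n::finite \<Rightarrow> 'h::complex_hilbert \<Rightarrow>\<^sub>L 'h) set"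
    and a :: "'m::finite \<Rightarrow> 'n list \<Rightarrow> complex"
    and A B :: "'n \<Rightarrow> 'h \<Rightarrow>\<^sub>L 'h"
  assumes K: "separable_infinite_dim TYPE('k::complex_hilbert)"
    and \<rho>: "\<rho> > 0"
    and \<Delta>: "\<Delta> \<in> harnack_parts TYPE('k) \<rho>"
    and f: "\<And>j. free_holomorphic (a j)"
    and contractive: "free_contractive TYPE('k) a"
    and f0: "norm (free_at_0 a) < 1"
    and boundary: "\<And>j. boundary_in_disc_algebra (a j)"
    and A: "A \<in> \<Delta>" and B: "B \<in> \<Delta>"
  shows "(\<exists>\<Delta>' \<in> harnack_parts TYPE('k) (rho_f \<rho> (norm (free_at_0 a))).
            free_apply a A \<in> \<Delta>' \<and> free_apply a B \<in> \<Delta>') \<and>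
         hyp_metric TYPE('k) (rho_f \<rho> (norm (free_at_0 a))) (free_apply a A) (free_apply a B)
           \<le> hyp_metric TYPE('k) \<rho> A B"
proof -
  let ?\<sigma> = "rho_f \<rho> (norm (free_at_0 a))"
  \<comment> \<open>A and B are compared through a representative X of the part; their constant is
    the product of those to X.\<close>
  obtain X where X: "\<Delta> = harnack_rel TYPE('k) \<rho> `` {X}"
    using \<Delta> unfolding harnack_parts_def by (elim quotientE)
  obtain c where c: "1 \<le> c" "harnack_equiv_const TYPE('k) \<rho> c X A"
    using A unfolding X harnack_rel_def by auto
  obtain d where d: "1 \<le> d" "harnack_equiv_const TYPE('k) \<rho> d X B"
    using B unfolding X harnack_rel_def by auto
  note cX = c(2)[unfolded harnack_equiv_const_def] and dX = d(2)[unfolded harnack_equiv_const_def]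
  have AB: "harnack_equiv_const TYPE('k) \<rho> (c * d) A B"
    using harnack_dom_trans[OF conjunct2[OF cX] conjunct1[OF dX]]
      harnack_dom_trans[OF conjunct2[OF dX] conjunct1[OF cX]]
    by (simp add: harnack_equiv_const_def mult.commute)
  have cd: "1 \<le> c * d" using c(1) d(1) mult_mono[of 1 c 1 d] by simp
  have Acl: "A \<in> class_C \<rho>" and Bcl: "B \<in> class_C \<rho>"
    using harnack_domD(2)[OF conjunct1[OF cX]] harnack_domD(2)[OF conjunct1[OF dX]] .
  have fA: "free_apply a A \<in> class_C ?\<sigma>"
    by (rule free_apply_class_C[OF K \<rho> f contractive f0 boundary Acl])
  have transfer: "harnack_equiv_const TYPE('k) ?\<sigma> e (free_apply a A) (free_apply a B)"
    if "1 \<le> e" "harnack_equiv_const TYPE('k) \<rho> e A B" for e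
    using that free_apply_harnack_dom[OF K \<rho> f contractive f0 boundary]
    unfolding harnack_equiv_const_def by blast
  have "harnack_dom TYPE('k) ?\<sigma> 1 (free_apply a A) (free_apply a A)"
    by (rule harnack_dom_refl[OF K rho_f_pos[OF \<rho> norm_ge_zero f0] fA order_refl])
  then have "(free_apply a A, free_apply a A) \<in> harnack_rel TYPE('k) ?\<sigma>"
    unfolding harnack_rel_def harnack_equiv_const_def by auto
  moreover have "(free_apply a A, free_apply a B) \<in> harnack_rel TYPE('k) ?\<sigma>"
    using transfer[OF cd AB] cd unfolding harnack_rel_def by auto
  moreover have "harnack_rel TYPE('k) ?\<sigma> `` {free_apply a A} \<in> harnack_parts TYPE('k) ?\<sigma>"
    unfolding harnack_parts_def by (rule quotientI[OF fA])
  ultimately have part: "\<exists>\<Delta>' \<in> harnack_parts TYPE('k) ?\<sigma>. free_apply a A \<in> \<Delta>' \<and> free_apply a B \<in> \<Delta>'"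
    by (intro bexI[of _ "harnack_rel TYPE('k) ?\<sigma> `` {free_apply a A}"]) auto
  let ?S = "{c. c > 1 \<and> harnack_equiv_const TYPE('k) \<rho> c A B}"
  let ?S' = "{c. c > 1 \<and> harnack_equiv_const TYPE('k) ?\<sigma> c (free_apply a A) (free_apply a B)}"
  \<comment> \<open>The infimum ranges over constants strictly above 1, and c * d may equal 1.
    Doubling it shows that the set is not empty, without which its infimum would carry no
    information.\<close>
  have "harnack_equiv_const TYPE('k) \<rho> (c * d * 2) A B"
    unfolding harnack_equiv_const_def
    using harnack_dom_trans[OF conjunct1[OF AB[unfolded harnack_equiv_const_def]] harnack_dom_refl[OF K \<rho> Bcl]]
      harnack_dom_trans[OF conjunct2[OF AB[unfolded harnack_equiv_const_def]] harnack_dom_refl[OF K \<rho> Acl]]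
    by simp
  then have "c * d * 2 \<in> ?S" using cd by simp
  then have ne: "?S \<noteq> {}" by blast
  have sub: "?S \<subseteq> ?S'" using transfer by auto
  have "Inf ?S' \<le> Inf ?S"
    by (rule cInf_superset_mono[OF ne _ sub]) (auto intro!: bdd_belowI[of _ 1])
  \<comment> \<open>Keeps the arguments of the logarithm positive, where it is monotone.\<close>
  moreover have "1 \<le> Inf ?S'"
    by (rule cInf_greatest) (use ne sub in auto)
  ultimately have "ln (Inf ?S') \<le> ln (Inf ?S)" by (intro ln_mono) auto
  with part show ?thesis by (simp add: hyp_metric_def)
qed

end
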